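(* Let $n\ge 2$, let $\gamma\in\mathrm{Aut}(\mathbb{C}^n,0)$ be a holomorphic contraction, and let $W_\gamma=(\mathbb{C}^n\setminus\{0\})/\langle\gamma\rangle$ be the associated primary Hopf manifold, with complex structure $J$. (1) If $W_\gamma$ is non-diagonal, then there exists no compact torus $H\subset\mathrm{Aut}_0(W_\gamma)$, with Lie algebra $\mathfrak{h}$, such that $J\mathfrak{h}\cap\mathfrak{h}\neq\{0\}$. (2) If $\gamma=d_\lambda$ for some $\lambda=(\lambda_1,\ldots,\lambda_n)\in(\mathbb{D}^* )^n$, then the only complex one-dimensional Lie group $G$ sitting in a compact torus $H\subset\mathrm{Aut}_0(W_\gamma)$ is generated by $$Z:=\sum_{j=1}^n\ln|\lambda_j|\,z_j\frac{\partial}{\partial z_j}.$$ Its action on $W_\gamma$ is induced by the action of $\mathbb{C}^*$ via $$\mu.[z_1,\ldots,z_n]=[\mu^{\ln|\lambda_1|}z_1,\ldots,\mu^{\ln|\lambda_n|}z_n],\qquad \mu\in\mathbb{C}^*,\ [z]\in W_\gamma.$$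
   Context: $\mathbb{D}^*=\{w\in\mathbb{C}:0<|w|<1\}$ and $\mathbb{C}^*=\mathbb{C}\setminus\{0\}$. $\mathrm{Aut}(\mathbb{C}^n,0)$ is the group of biholomorphisms of $\mathbb{C}^n$ fixing $0$. A contraction is an element $\gamma\in\mathrm{Aut}(\mathbb{C}^n,0)$ whose iterates $\gamma^m$ converge uniformly to $0$ on compact neighbourhoods of $0$ as $m\to\infty$; equivalently, all eigenvalues of $d_0\gamma$ lie in $\mathbb{D}^*$. For $\lambda\in(\mathbb{D}^* )^n$, $d_\lambda\colon\mathbb{C}^n\to\mathbb{C}^n$ is the map $z\mapsto(\lambda_1z_1,\ldots,\lambda_nz_n)$. The primary Hopf manifold $W_\gamma$ is called non-diagonal if $\gamma$ admits no diagonal normal form, i.e. there is no $h\in\mathrm{Aut}(\mathbb{C}^n,0)$ with $h\gamma h^{-1}=d_\lambda$ for some $\lambda\in(\mathbb{D}^* )^n$. $\mathrm{Aut}_0(W_\gamma)$ is the identity component of the complex Lie group of biholomorphisms of $W_\gamma$; its Lie algebra is the complex Lie algebra of holomorphic vector fields on $W_\gamma$, on which $J$ acts as multiplication by $\sqrt{-1}$. A compact torus means a real compact torus, and its Lie algebra $\mathfrak{h}$ is a real subalgebra of this Lie algebra. Lie subgroups are allowed to be immersed (not necessarily closed). $Z$ denotes also the holomorphic vector field it induces on $W_\gamma$, and the complex one-dimensional group generated by $Z$ is $\{\exp(tZ):t\in\mathbb{C}\}$. $[z]$ denotes the class in $W_\gamma$ of $z\in\mathbb{C}^n\setminus\{0\}$,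 and $\mu^{\ln|\lambda_j|}$ is the complex power of $\mu$ with real exponent $\ln|\lambda_j|$.
   Formalization: The powers μ^{ln|λ_j|} are multivalued and in general give no action of C^*, so the action is stated for each logarithm s of μ (as exp(sZ), additive in s) and for principal values; the complex one-dimensional group G is taken to be connected, as uniqueness fails otherwise. *)

theory Defs
  imports
    "HOL-Analysis.Analysis"
    "HOL-Algebra.Bij"
    "HOL-Algebra.Product_Groups"
    "HOL-Algebra.Generated_Groups"
begin

subsection \<open>Automorphisms of complex affine space fixing the origin\<close>

text \<open>
  Holomorphy in several variables, on an open set \<open>S\<close>: the real Frechet derivative
  exists and is complex linear.
\<close>

definition holo_on :: "(complex ^ 'n) set \<Rightarrow> (complex ^ 'n \<Rightarrow> complex ^ 'n) \<Rightarrow> bool" where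
  "holo_on S f \<longleftrightarrow>
     (\<forall>z\<in>S. \<exists>D. (f has_derivative D) (at z) \<and> (\<forall>c v. D (c *s v) = c *s D v))"

definition Aut0 :: "(complex ^ 'n \<Rightarrow> complex ^ 'n) set" where
  "Aut0 = {f. bij f \<and> holo_on UNIV f \<and> holo_on UNIV (inv_into UNIV f) \<and> f 0 = 0}"

text \<open>
  Convergence is required on every compact neighbourhood of the origin, so that the
  origin attracts all of space and the Hopf quotient is a compact manifold.
\<close>

definition contraction :: "(complex ^ 'n \<Rightarrow> complex ^ 'n) \<Rightarrow> bool" where
  "contraction \<gamma> \<longleftrightarrow> \<gamma> \<in> Aut0 \<and>
     (\<forall>K. compact K \<and> 0 \<in> interior K \<longrightarrow>
        uniform_limit K (\<lambda>m z. (\<gamma> ^^ m) z) (\<lambda>z. 0) sequentially)"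

definition punctured_disc :: "complex set" where
  "punctured_disc = {w. 0 < cmod w \<and> cmod w < 1}"

definition diag_map :: "complex ^ 'n \<Rightarrow> complex ^ 'n \<Rightarrow> complex ^ 'n" where
  "diag_map lam z = (\<chi> j. lam $ j * z $ j)"

definition non_diagonal :: "(complex ^ 'n \<Rightarrow> complex ^ 'n) \<Rightarrow> bool" where
  "non_diagonal \<gamma> \<longleftrightarrow>
     \<not> (\<exists>h\<in>Aut0. \<exists>lam. (\<forall>j. lam $ j \<in> punctured_disc) \<and> h \<circ> \<gamma> \<circ> inv_into UNIV h = diag_map lam)"


subsection \<open>The primary Hopf manifold\<close>

text \<open>The orbit of \<open>z\<close> under the cyclic group generated by \<open>\<gamma>\<close>.\<close>

definition hopf_class :: "(complex ^ 'n \<Rightarrow> complex ^ 'n) \<Rightarrow> complex ^ 'n \<Rightarrow> (complex ^ 'n) set" where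
  "hopf_class \<gamma> z = (\<Union>k::nat. {(\<gamma> ^^ k) z, (inv_into UNIV \<gamma> ^^ k) z})"

definition hopf :: "(complex ^ 'n \<Rightarrow> complex ^ 'n) \<Rightarrow> (complex ^ 'n) set set" where
  "hopf \<gamma> = hopf_class \<gamma> ` (UNIV - {0})"

definition hopf_topology ::
    "(complex ^ 'n \<Rightarrow> complex ^ 'n) \<Rightarrow> (complex ^ 'n) set topology" where
  "hopf_topology \<gamma> =
     topology (\<lambda>U. U \<subseteq> hopf \<gamma> \<and> open {z. z \<noteq> 0 \<and> hopf_class \<gamma> z \<in> U})"

lemma openin_hopf_topology:
  "openin (hopf_topology \<gamma>) U \<longleftrightarrow>
     U \<subseteq> hopf \<gamma> \<and> open {z. z \<noteq> 0 \<and> hopf_class \<gamma> z \<in> U}"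
proof -
  have "istopology (\<lambda>U. U \<subseteq> hopf \<gamma> \<and> open {z. z \<noteq> 0 \<and> hopf_class \<gamma> z \<in> U})"
    unfolding istopology_def
  proof (intro conjI allI impI; (elim conjE)?)
    fix S T
    assume "open {z. z \<noteq> 0 \<and> hopf_class \<gamma> z \<in> S}" "open {z. z \<noteq> 0 \<and> hopf_class \<gamma> z \<in> T}"
    then have "open ({z. z \<noteq> 0 \<and> hopf_class \<gamma> z \<in> S} \<inter> {z. z \<noteq> 0 \<and> hopf_class \<gamma> z \<in> T})"
      by (rule open_Int)
    also have "{z. z \<noteq> 0 \<and> hopf_class \<gamma> z \<in> S} \<inter> {z. z \<noteq> 0 \<and> hopf_class \<gamma> z \<in> T} =
        {z. z \<noteq> 0 \<and> hopf_class \<gamma> z \<in> S \<inter> T}"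
      by auto
    finally show "open {z. z \<noteq> 0 \<and> hopf_class \<gamma> z \<in> S \<inter> T}" .
  next
    fix \<K>
    assume "\<forall>K\<in>\<K>. K \<subseteq> hopf \<gamma> \<and> open {z. z \<noteq> 0 \<and> hopf_class \<gamma> z \<in> K}"
    then have "open (\<Union>K\<in>\<K>. {z. z \<noteq> 0 \<and> hopf_class \<gamma> z \<in> K})"
      by auto
    also have "(\<Union>K\<in>\<K>. {z. z \<noteq> 0 \<and> hopf_class \<gamma> z \<in> K}) = {z. z \<noteq> 0 \<and> hopf_class \<gamma> z \<in> \<Union>\<K>}"
      by auto
    finally show "open {z. z \<noteq> 0 \<and> hopf_class \<gamma> z \<in> \<Union>\<K>}" .
  qed auto
  then show ?thesis
    by (simp add: hopf_topology_def topology_inverse')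
qed

text \<open>
  The charts of the Hopf manifold are the local inverses of the covering projection
  \<open>hopf_class \<gamma>\<close>, so holomorphy of a self-map means that it has holomorphic local lifts.
\<close>

definition hopf_holo ::
    "(complex ^ 'n \<Rightarrow> complex ^ 'n) \<Rightarrow> ((complex ^ 'n) set \<Rightarrow> (complex ^ 'n) set) \<Rightarrow> bool" where
  "hopf_holo \<gamma> F \<longleftrightarrow> continuous_map (hopf_topology \<gamma>) (hopf_topology \<gamma>) F \<and>
     (\<forall>z. z \<noteq> 0 \<longrightarrow>
        (\<exists>U f. open U \<and> z \<in> U \<and> 0 \<notin> U \<and> holo_on U f \<and>
           (\<forall>w\<in>U. f w \<noteq> 0 \<and> F (hopf_class \<gamma> w) = hopf_class \<gamma> (f w))))"

definition hopf_aut ::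
    "(complex ^ 'n \<Rightarrow> complex ^ 'n) \<Rightarrow> ((complex ^ 'n) set \<Rightarrow> (complex ^ 'n) set) set" where
  "hopf_aut \<gamma> =
     {F \<in> Bij (hopf \<gamma>). hopf_holo \<gamma> F \<and> hopf_holo \<gamma> (restrict (inv_into (hopf \<gamma>) F) (hopf \<gamma>))}"

text \<open>
  The Lie group topology of the biholomorphism group is the compact-open topology.
\<close>

definition hopf_aut_topology ::
    "(complex ^ 'n \<Rightarrow> complex ^ 'n) \<Rightarrow> ((complex ^ 'n) set \<Rightarrow> (complex ^ 'n) set) topology" where
  "hopf_aut_topology \<gamma> = topology_generated_by
     {{F \<in> hopf_aut \<gamma>. F ` K \<subseteq> U} | K U.
        compactin (hopf_topology \<gamma>) K \<and> openin (hopf_topology \<gamma>) U}"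

definition hopf_aut_id_comp ::
    "(complex ^ 'n \<Rightarrow> complex ^ 'n) \<Rightarrow> ((complex ^ 'n) set \<Rightarrow> (complex ^ 'n) set) set" where
  "hopf_aut_id_comp \<gamma> =
     connected_component_of_set (hopf_aut_topology \<gamma>) \<one>\<^bsub>BijGroup (hopf \<gamma>)\<^esub>"


subsection \<open>Holomorphic vector fields and the exponential map\<close>

text \<open>
  A holomorphic vector field on the Hopf manifold is represented by its pull-back to the
  punctured space, i.e. by a \<open>\<gamma>\<close>-invariant holomorphic vector field there. The value at
  the origin has no meaning and is normalised to \<open>0\<close>, so that equality of functions is
  equality of vector fields and the zero field is the constant function \<open>0\<close>.
\<close>

definition hopf_vf :: "(complex ^ 'n \<Rightarrow> complex ^ 'n) \<Rightarrow> (complex ^ 'n \<Rightarrow> complex ^ 'n) set" where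
  "hopf_vf \<gamma> = {X. X 0 = 0 \<and> holo_on (UNIV - {0}) X \<and>
     (\<forall>z. z \<noteq> 0 \<longrightarrow> X (\<gamma> z) = frechet_derivative \<gamma> (at z) (X z))}"

definition scale_vf :: "complex \<Rightarrow> (complex ^ 'n \<Rightarrow> complex ^ 'n) \<Rightarrow> complex ^ 'n \<Rightarrow> complex ^ 'n" where
  "scale_vf c X = (\<lambda>z. c *s X z)"

definition J_vf :: "(complex ^ 'n \<Rightarrow> complex ^ 'n) \<Rightarrow> complex ^ 'n \<Rightarrow> complex ^ 'n" where
  "J_vf = scale_vf \<i>"

definition integral_curve :: "(complex ^ 'n \<Rightarrow> complex ^ 'n) \<Rightarrow> (real \<Rightarrow> complex ^ 'n) \<Rightarrow> bool" where
  "integral_curve X c \<longleftrightarrow>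
     (\<forall>s. c s \<noteq> 0 \<and> (c has_vector_derivative X (c s)) (at s))"

text \<open>
  The exponential is the flow at time one; integral curves in the quotient lift through
  the covering. All holomorphic vector fields are complete, the quotient being compact.
\<close>

definition exp_vf ::
    "(complex ^ 'n \<Rightarrow> complex ^ 'n) \<Rightarrow> (complex ^ 'n \<Rightarrow> complex ^ 'n) \<Rightarrow>
     (complex ^ 'n) set \<Rightarrow> (complex ^ 'n) set" where
  "exp_vf \<gamma> X = (\<lambda>p\<in>hopf \<gamma>.
     THE q. \<exists>c. integral_curve X c \<and> hopf_class \<gamma> (c 0) = p \<and> hopf_class \<gamma> (c 1) = q)"


subsection \<open>Lie subgroups\<close>

text \<open>
  The Lie algebra of a Lie subgroup consists of the fields whose real one-parameter group
  lies in the subgroup. This also holds for connected immersed, not necessarily closed,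
  subgroups.
\<close>

definition lie_algebra ::
    "(complex ^ 'n \<Rightarrow> complex ^ 'n) \<Rightarrow> ((complex ^ 'n) set \<Rightarrow> (complex ^ 'n) set) set \<Rightarrow>
     (complex ^ 'n \<Rightarrow> complex ^ 'n) set" where
  "lie_algebra \<gamma> H =
     {X \<in> hopf_vf \<gamma>. \<forall>t::real. exp_vf \<gamma> (scale_vf (complex_of_real t) X) \<in> H}"

definition circle_group :: "complex monoid" where
  "circle_group = \<lparr>carrier = sphere 0 1, mult = (*), one = 1\<rparr>"

text \<open>
  A compact torus is a subgroup which is isomorphic, as a topological group, to a finite
  power of the circle. Continuous homomorphisms of Lie groups are smooth, so this
  is the same as being isomorphic as a real Lie group. An immersed compact subgroup
  carries the subspace topology, by compactness.
\<close>

definition compact_torus ::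
    "(complex ^ 'n \<Rightarrow> complex ^ 'n) \<Rightarrow> ((complex ^ 'n) set \<Rightarrow> (complex ^ 'n) set) set \<Rightarrow> bool" where
  "compact_torus \<gamma> H \<longleftrightarrow>
     H \<subseteq> hopf_aut_id_comp \<gamma> \<and> subgroup H (BijGroup (hopf \<gamma>)) \<and>
     (\<exists>(k::nat) \<rho>.
        \<rho> \<in> iso (product_group {..<k} (\<lambda>_. circle_group)) ((BijGroup (hopf \<gamma>))\<lparr>carrier := H\<rparr>) \<and>
        homeomorphic_map (product_topology (\<lambda>_. top_of_set (sphere 0 1)) {..<k})
          (subtopology (hopf_aut_topology \<gamma>) H) \<rho>)"

text \<open>
  Connected immersed complex Lie subgroups of dimension one: the Lie algebra is a complex
  line, and connectedness means that the group is generated by the exponentials of its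
  Lie algebra.
\<close>

definition complex_one_dim_subgroup ::
    "(complex ^ 'n \<Rightarrow> complex ^ 'n) \<Rightarrow> ((complex ^ 'n) set \<Rightarrow> (complex ^ 'n) set) set \<Rightarrow> bool" where
  "complex_one_dim_subgroup \<gamma> G \<longleftrightarrow>
     G \<subseteq> hopf_aut_id_comp \<gamma> \<and> subgroup G (BijGroup (hopf \<gamma>)) \<and>
     (\<exists>X\<in>hopf_vf \<gamma>. X \<noteq> (\<lambda>z. 0) \<and> lie_algebra \<gamma> G = range (\<lambda>c. scale_vf c X)) \<and>
     G = generate (BijGroup (hopf \<gamma>)) (exp_vf \<gamma> ` lie_algebra \<gamma> G)"

definition generated_by_vf ::
    "(complex ^ 'n \<Rightarrow> complex ^ 'n) \<Rightarrow> (complex ^ 'n \<Rightarrow> complex ^ 'n) \<Rightarrow>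
     ((complex ^ 'n) set \<Rightarrow> (complex ^ 'n) set) set" where
  "generated_by_vf \<gamma> X = range (\<lambda>t::complex. exp_vf \<gamma> (scale_vf t X))"


subsection \<open>The field of the diagonal case\<close>

definition Z_field :: "complex ^ 'n \<Rightarrow> complex ^ 'n \<Rightarrow> complex ^ 'n" where
  "Z_field lam z = (\<chi> j. complex_of_real (ln (cmod (lam $ j))) * z $ j)"

text \<open>
  The value of the complex power \<open>\<mu>\<^sup>a\<close> given by the logarithm \<open>s\<close> of \<open>\<mu>\<close>, i.e. for
  \<open>exp s = \<mu>\<close>. The principal value \<open>\<mu> powr a\<close> is the one for \<open>s = Ln \<mu>\<close>.
\<close>

definition log_power :: "complex \<Rightarrow> real \<Rightarrow> complex" where
  "log_power s a = exp (complex_of_real a * s)"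

end

theory Submission
  imports
    Defs
    "HOL-Complex_Analysis.Great_Picard"
    "HOL-Computational_Algebra.Fundamental_Theorem_Algebra"
begin

text \<open>
  The whole argument rests on a continuous real function \<open>height\<close> on the punctured space that
  \<open>\<gamma>\<close> raises by one. It is large exactly near the origin, it is bounded below only on bounded
  sets, and the points of height between \<open>0\<close> and \<open>1\<close> form a compact set that meets every orbit.

  Let \<open>X\<close> and \<open>J X\<close> belong to the Lie algebra of a compact torus. Their flows lift to the
  punctured space and commute there, and so they combine into a flow \<open>\<phi>\<close> of \<open>X\<close> in complex
  time \<open>w\<close>. A neighbourhood of the identity in the torus moves all heights by less than a
  quarter, and finitely many of its translates cover the torus; hence the displacement
  \<open>height (\<phi> w z) - height z\<close> depends on \<open>z\<close> only up to a bounded error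
  (\<open>displ_uniform\<close>). It is therefore quasi-additive in \<open>w\<close>, and by Hyers' theorem it lies at
  bounded distance from \<open>Re (a * w)\<close> for some complex number \<open>a\<close> (\<open>displ_linear\<close>). If \<open>a\<close>
  is \<open>0\<close>, the orbits of \<open>\<phi>\<close> are bounded entire curves and \<open>X\<close> vanishes by Liouville's
  theorem. Otherwise a change of time makes \<open>a\<close> equal to \<open>1\<close>, and the result is an entire
  flow \<open>\<Theta>\<close> that commutes with \<open>\<gamma>\<close> and changes the height by \<open>Re w\<close> up to a bounded error
  (\<open>rescaled_flow\<close>).

  For \<open>\<gamma>\<close> diagonal, the flow of the field \<open>Z\<close> has the same property. Following \<open>\<Theta> w\<close> by the
  flow of \<open>Z\<close> at time \<open>- w\<close> gives bounded entire curves, which are constant; so \<open>X\<close> is a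
  multiple of \<open>Z\<close> (\<open>torus_line_unique\<close>). Conversely \<open>Z\<close> generates a subgroup of the torus
  that consists of the rotations of the coordinates together with a real one-parameter group
  through \<open>\<gamma>\<close>.

  For general \<open>\<gamma>\<close> the existence of \<open>\<Theta>\<close> forces a diagonal normal form. The maps
  \<open>\<gamma> ^^ m \<circ> \<Theta> (- m + \<i> t)\<close> form an abelian group that changes heights by a bounded amount, so
  it is equicontinuous at the origin, like a compact group. Averaging over it linearizes its
  elements simultaneously near the origin. The conjugation and the conjugated objects depend
  holomorphically on complex time, so the identity theorem carries the linearization from
  the times \<open>\<i> / 2 ^ q\<close> over to \<open>\<Theta> 1\<close>, and \<open>\<gamma>\<close> itself is the composition of
  \<open>\<Theta> 1\<close> with a group element (\<open>local_linearization\<close>). The linear parts of the group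
  elements are commuting operators with bounded powers, hence jointly diagonalizable, and the
  same passage to \<open>\<Theta> 1\<close> diagonalizes the linear part of \<open>\<gamma>\<close>
  (\<open>linear_part_diagonalizable\<close>). Finally the contraction \<open>\<gamma>\<close> spreads the local conjugation
  over all of space (\<open>global_linearization\<close>).
\<close>

section \<open>Holomorphic maps of several variables\<close>

lemma norm_smult: "norm (c *s v) = cmod c * norm (v :: complex ^ 'n)"
  by (simp add: norm_vec_def norm_mult L2_set_right_distrib)

interpretation smult: bounded_bilinear "(*s) :: complex \<Rightarrow> complex ^ 'n \<Rightarrow> complex ^ 'n"
proof
  show "\<exists>K. \<forall>a b. norm (a *s b :: complex ^ 'n) \<le> norm a * norm b * K"
    by (rule exI[of _ 1]) (simp add: norm_smult)
qed (vector algebra_simps)+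

lemmas smult_intros [continuous_intros] = smult.continuous smult.continuous_on

lemma scaleR_smult: "r *\<^sub>R v = complex_of_real r *s (v :: complex ^ 'n)"
  by (simp add: vec_eq_iff) (simp add: scaleR_conv_of_real)

lemma open_line: "open U \<Longrightarrow> open {\<zeta>. z + \<zeta> *s (v :: complex ^ 'n) \<in> U}"
  using open_vimage[of U "\<lambda>\<zeta>. z + \<zeta> *s v"] by (simp add: vimage_def continuous_intros)

lemma has_derivative_quadratic:
  fixes f :: "'a::real_normed_vector \<Rightarrow> 'b::real_normed_vector"
  assumes "bounded_linear D" "0 < r"
    and "\<And>h. norm h < r \<Longrightarrow> norm (f (z + h) - f z - D h) \<le> K * (norm h)\<^sup>2"
  shows "(f has_derivative D) (at z)"
proof (rule has_derivativeI_sandwich[where e = r and H = "\<lambda>y. K * norm (y - z)"])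
  fix y assume "y \<noteq> z" "dist y z < r"
  then show "norm (f y - f z - D (y - z)) / norm (y - z) \<le> K * norm (y - z)"
    using assms(3)[of "y - z"] by (simp add: dist_norm divide_simps power2_eq_square algebra_simps)
next
  show "((\<lambda>y. K * norm (y - z)) \<longlongrightarrow> 0) (at z)"
    by (rule tendsto_eq_intros | simp)+
qed (use assms in auto)

lemma has_derivative_vecI:
  fixes f :: "'a::real_normed_vector \<Rightarrow> complex ^ 'n"
  assumes "\<And>j. ((\<lambda>x. f x $ j) has_derivative (\<lambda>h. D h $ j)) F"
  shows "(f has_derivative D) F"
proof -
  have lin: "bounded_linear (axis j :: complex \<Rightarrow> complex ^ 'n)" for j
    unfolding linear_conv_bounded_linear[symmetric]
    by (rule linearI) (auto simp: vec_eq_iff axis_def)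
  have ex: "x = (\<Sum>j\<in>UNIV. axis j (x $ j))" for x :: "complex ^ 'n"
    by (simp add: vec_eq_iff axis_def)
  have "((\<lambda>x. \<Sum>j\<in>UNIV. axis j (f x $ j)) has_derivative (\<lambda>h. \<Sum>j\<in>UNIV. axis j (D h $ j))) F"
    by (intro has_derivative_sum bounded_linear.has_derivative[OF lin] assms)
  then show ?thesis by (simp flip: ex)
qed

text \<open>
  Taylor estimates at the unit step, so that a step \<open>v\<close> in several variables is the unit step of
  the function \<open>\<lambda>\<zeta>. g (z + \<zeta> *s v)\<close> on a disc of radius inversely proportional to \<open>norm v\<close>.
\<close>

lemma Cauchy_unit_step:
  assumes S: "open S" "cball 0 R \<subseteq> S" and hol: "\<phi> holomorphic_on S" and R: "0 < R"
    and M: "\<And>\<zeta>. cmod \<zeta> \<le> R \<Longrightarrow> cmod (\<phi> \<zeta>) \<le> M"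
  shows "cmod (deriv \<phi> 0) \<le> M / R"
    and "2 \<le> R \<Longrightarrow> cmod (\<phi> 1 - \<phi> 0 - deriv \<phi> 0) \<le> 8 * M / R\<^sup>2"
proof -
  have cont: "continuous_on (cball \<xi> r) \<phi>" and hol': "\<phi> holomorphic_on ball \<xi> r"
    if "cball \<xi> r \<subseteq> cball 0 R" for \<xi> r
    using hol S that holomorphic_on_subset[OF hol] holomorphic_on_imp_continuous_on ball_subset_cball
    by (meson order_trans)+
  show "cmod (deriv \<phi> 0) \<le> M / R"
    using Cauchy_inequality[of \<phi> 0 R M 1] cont[of 0 R] hol'[of 0 R] R M by simp
  assume "2 \<le> R"
  have M0: "0 \<le> M" using M[of 0] R norm_ge_zero order_trans by (metis less_imp_le norm_zero)
  have b2: "cmod ((deriv ^^ 2) \<phi> x) \<le> 8 * M / R\<^sup>2" if "x \<in> cball 0 1" for x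
  proof -
    have sub: "cball x (R - 1) \<subseteq> cball 0 R"
    proof
      fix y assume "y \<in> cball x (R - 1)"
      then show "y \<in> cball 0 R"
        using that norm_triangle_ineq[of "y - x" x] by (simp add: dist_norm norm_minus_commute)
    qed
    have "cmod ((deriv ^^ 2) \<phi> x) \<le> fact 2 * M / (R - 1)\<^sup>2"
    proof (rule Cauchy_inequality[OF hol'[OF sub] cont[OF sub]])
      fix y assume "cmod (x - y) = R - 1"
      then have "y \<in> cball x (R - 1)" by (simp add: dist_norm)
      with sub have "y \<in> cball 0 R" by blast
      then show "cmod (\<phi> y) \<le> M" by (simp add: M)
    qed (use \<open>2 \<le> R\<close> in auto)
    also have "\<dots> \<le> 2 * M / (R / 2)\<^sup>2"
      using M0 \<open>2 \<le> R\<close> by (auto intro!: divide_left_mono power_mono simp: fact_numeral)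
    finally show ?thesis by (simp add: power_divide)
  qed
  have "cmod ((deriv ^^ 0) \<phi> 1 - (\<Sum>i\<le>1. (deriv ^^ i) \<phi> 0 * (1 - 0) ^ i / fact i))
      \<le> (8 * M / R\<^sup>2) * cmod (1 - 0) ^ Suc 1 / fact 1"
  proof (rule complex_Taylor[where S = "cball 0 1"])
    fix i :: nat and x :: complex assume "x \<in> cball 0 1"
    with \<open>2 \<le> R\<close> S have "x \<in> S" by auto
    then show "((deriv ^^ i) \<phi> has_field_derivative (deriv ^^ Suc i) \<phi> x) (at x within cball 0 1)"
      using holomorphic_higher_deriv[OF hol S(1), of i] S(1)
      by (simp add: has_field_derivative_at_within holomorphic_derivI)
  qed (use b2 in \<open>auto simp: numeral_2_eq_2\<close>)
  then show "cmod (\<phi> 1 - \<phi> 0 - deriv \<phi> 0) \<le> 8 * M / R\<^sup>2" by (simp add: algebra_simps)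
qed

definition line_holo :: "(complex ^ 'n) set \<Rightarrow> (complex ^ 'n \<Rightarrow> complex) \<Rightarrow> bool" where
  "line_holo U g \<longleftrightarrow> continuous_on U g \<and>
     (\<forall>z v. (\<lambda>\<zeta>. g (z + \<zeta> *s v)) holomorphic_on {\<zeta>. z + \<zeta> *s v \<in> U})"

definition line_deriv :: "(complex ^ 'n \<Rightarrow> complex) \<Rightarrow> complex ^ 'n \<Rightarrow> complex ^ 'n \<Rightarrow> complex" where
  "line_deriv g z v = deriv (\<lambda>\<zeta>. g (z + \<zeta> *s v)) 0"

lemma line_deriv_0 [simp]: "line_deriv g z 0 = 0"
  by (simp add: line_deriv_def)

lemma line_field_derivative:
  assumes "open U" "line_holo U g" "z \<in> U"
  shows "((\<lambda>\<zeta>. g (z + \<zeta> *s v)) has_field_derivative line_deriv g z v) (at 0)"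
  unfolding line_deriv_def
  using assms by (intro holomorphic_derivI[OF _ open_line]) (auto simp: line_holo_def)

lemma line_bounds:
  assumes U: "open U" "line_holo U g" and r: "0 < r" "cball z r \<subseteq> U"
    and M: "\<And>y. y \<in> cball z r \<Longrightarrow> cmod (g y) \<le> M"
  shows "cmod (line_deriv g z v) \<le> M / r * norm v"
    and "norm v \<le> r / 2 \<Longrightarrow> cmod (g (z + v) - g z - line_deriv g z v) \<le> 8 * M / r\<^sup>2 * (norm v)\<^sup>2"
proof -
  have "cmod (line_deriv g z v) \<le> M / r * norm v \<and>
    (norm v \<le> r / 2 \<longrightarrow> cmod (g (z + v) - g z - line_deriv g z v) \<le> 8 * M / r\<^sup>2 * (norm v)\<^sup>2)"
  proof (cases "v = 0")
    case False
    define R where "R = r / norm v"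
    have R: "0 < R" using r False by (simp add: R_def)
    have in_ball: "z + \<zeta> *s v \<in> cball z r" if "cmod \<zeta> \<le> R" for \<zeta>
      using that False by (simp add: dist_norm norm_smult R_def field_simps)
    have sub: "cball 0 R \<subseteq> {\<zeta>. z + \<zeta> *s v \<in> U}"
      using in_ball r by auto
    have hol: "(\<lambda>\<zeta>. g (z + \<zeta> *s v)) holomorphic_on {\<zeta>. z + \<zeta> *s v \<in> U}"
      using U by (simp add: line_holo_def)
    have bound: "cmod (g (z + \<zeta> *s v)) \<le> M" if "cmod \<zeta> \<le> R" for \<zeta>
      using M in_ball that by blast
    note C = Cauchy_unit_step[OF open_line[OF U(1)] sub hol R, where M = M]
    have "cmod (line_deriv g z v) \<le> M / R" using C(1) bound by (simp add: line_deriv_def)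
    moreover have "cmod (g (z + v) - g z - line_deriv g z v) \<le> 8 * M / R\<^sup>2" if "norm v \<le> r / 2"
    proof -
      have "2 \<le> R" using that False by (simp add: R_def field_simps)
      with C(2) bound show ?thesis by (simp add: line_deriv_def)
    qed
    ultimately show ?thesis by (auto simp: R_def power_divide)
  qed simp
  then show "cmod (line_deriv g z v) \<le> M / r * norm v"
    and "norm v \<le> r / 2 \<Longrightarrow> cmod (g (z + v) - g z - line_deriv g z v) \<le> 8 * M / r\<^sup>2 * (norm v)\<^sup>2"
    by blast+
qed

lemma line_deriv_scale:
  assumes "open U" "line_holo U g" "z \<in> U"
  shows "line_deriv g z (c *s v) = c * line_deriv g z v"
proof -
  have "((\<lambda>\<zeta>. g (z + (c * \<zeta>) *s v)) has_field_derivative line_deriv g z v * c) (at 0)"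
    using line_field_derivative[OF assms, of v]
    by (intro DERIV_chain'[where f = "\<lambda>\<zeta>. c * \<zeta>" and g = "\<lambda>\<zeta>. g (z + \<zeta> *s v)"])
       (auto intro!: derivative_eq_intros)
  then have "((\<lambda>\<zeta>. g (z + \<zeta> *s (c *s v))) has_field_derivative line_deriv g z v * c) (at 0)"
    by (simp add: vector_smult_assoc mult.commute)
  then show ?thesis
    by (simp add: line_deriv_def[of g z "c *s v"] DERIV_imp_deriv mult.commute)
qed

text \<open>
  The restrictions of \<open>g\<close> to the parallel lines through \<open>y\<close> and \<open>z\<close> are uniformly close
  when \<open>y\<close> is near \<open>z\<close>; Cauchy's inequality for their difference compares the derivatives.
\<close>

lemma line_deriv_tendsto:
  assumes U: "open U" "line_holo U g" "z \<in> U"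
  shows "((\<lambda>y. line_deriv g y v) \<longlongrightarrow> line_deriv g z v) (at z)"
proof (rule LIM_I)
  fix e :: real assume e: "0 < e"
  obtain r where r: "0 < r" "cball z r \<subseteq> U" using U open_contains_cball by blast
  define \<rho> where "\<rho> = r / (2 * (norm v + 1))"
  have \<rho>: "0 < \<rho>" and \<rho>v: "\<rho> * norm v \<le> r / 2"
  proof -
    have "0 < norm v + 1" by (simp add: add_nonneg_pos)
    then show "0 < \<rho>" using r by (simp add: \<rho>_def)
    have "\<rho> * norm v \<le> \<rho> * (norm v + 1)" using \<open>0 < \<rho>\<close> by (intro mult_left_mono) auto
    also have "\<dots> = r / 2" using \<open>0 < norm v + 1\<close> by (auto simp: \<rho>_def divide_simps)
    finally show "\<rho> * norm v \<le> r / 2" .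
  qed
  have "uniformly_continuous_on (cball z r) g"
    using U r by (intro compact_uniformly_continuous) (auto simp: line_holo_def intro: continuous_on_subset)
  then obtain d where d: "0 < d"
    "\<And>x y. x \<in> cball z r \<Longrightarrow> y \<in> cball z r \<Longrightarrow> dist y x < d \<Longrightarrow> dist (g y) (g x) < e * \<rho> / 2"
    unfolding uniformly_continuous_on_def using e \<rho> by (metis half_gt_zero mult_pos_pos)
  have "cmod (line_deriv g y v - line_deriv g z v) < e" if y: "norm (y - z) < min d (r / 2)" for y
  proof -
    have yU: "y \<in> U" using y r by (auto simp: dist_norm norm_minus_commute)
    define \<psi> where "\<psi> \<zeta> = g (y + \<zeta> *s v) - g (z + \<zeta> *s v)" for \<zeta>
    define S where "S = {\<zeta>. y + \<zeta> *s v \<in> U} \<inter> {\<zeta>. z + \<zeta> *s v \<in> U}"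
    have S: "open S" unfolding S_def using U by (intro open_Int open_line)
    have mem: "y + \<zeta> *s v \<in> cball z r \<and> z + \<zeta> *s v \<in> cball z r" if "cmod \<zeta> \<le> \<rho>" for \<zeta>
    proof -
      have "norm (\<zeta> *s v) \<le> r / 2"
        using that \<rho>v mult_right_mono[OF that norm_ge_zero[of v]] by (simp add: norm_smult)
      moreover have "norm (y + \<zeta> *s v - z) \<le> norm (y - z) + norm (\<zeta> *s v)"
        using norm_triangle_ineq[of "y - z" "\<zeta> *s v"] by (simp add: algebra_simps)
      ultimately show ?thesis
        using y r by (auto simp: dist_norm norm_minus_commute[of z])
    qed
    have "\<psi> holomorphic_on S"
      unfolding \<psi>_def S_def using U
      by (intro holomorphic_on_diff; intro holomorphic_on_subset[OF conjunct2[OF U(2)[unfolded line_holo_def], rule_format]]) auto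
    moreover have "cball 0 \<rho> \<subseteq> S" unfolding S_def using mem r by auto
    moreover have "cmod (\<psi> \<zeta>) \<le> e * \<rho> / 2" if "cmod \<zeta> \<le> \<rho>" for \<zeta>
      using d(2)[of "z + \<zeta> *s v" "y + \<zeta> *s v"] mem[OF that] y
      by (simp add: \<psi>_def dist_norm)
    ultimately have "cmod (deriv \<psi> 0) \<le> e * \<rho> / 2 / \<rho>"
      using S \<rho> by (intro Cauchy_unit_step(1))
    moreover have "deriv \<psi> 0 = line_deriv g y v - line_deriv g z v"
      unfolding \<psi>_def using line_field_derivative[OF U(1,2) yU, of v] line_field_derivative[OF U, of v]
      by (intro DERIV_imp_deriv DERIV_diff)
    ultimately show ?thesis using \<rho> e by simp
  qed
  then show "\<exists>s>0. \<forall>x. x \<noteq> z \<and> norm (x - z) < s \<longrightarrow> norm (line_deriv g x v - line_deriv g z v) < e"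
    using d(1) r(1) by (intro exI[of _ "min d (r / 2)"]) auto
qed

text \<open>
  Additivity of the derivative: the increment along \<open>u + v\<close> is the increment along \<open>u\<close>
  followed by the increment along \<open>v\<close> from a nearby base point, with quadratic errors that
  are uniform in the base point.
\<close>

lemma line_deriv_add:
  assumes U: "open U" "line_holo U g" "z \<in> U"
  shows "line_deriv g z (u + v) = line_deriv g z u + line_deriv g z v"
proof (cases "u = 0")
  case False
  obtain r where r: "0 < r" "cball z (2 * r) \<subseteq> U"
  proof -
    obtain r' where "0 < r'" "cball z r' \<subseteq> U" using U open_contains_cball by blast
    then show thesis by (intro that[of "r' / 2"]) auto
  qed
  have "bounded (g ` cball z (2 * r))"
    using U r by (intro compact_imp_bounded compact_continuous_image)
      (auto simp: line_holo_def intro: continuous_on_subset)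
  then obtain M where M: "\<And>y. y \<in> cball z (2 * r) \<Longrightarrow> cmod (g y) \<le> M"
    unfolding bounded_iff by blast
  have M0: "0 \<le> M" using M[of z] r norm_ge_zero order_trans
    by (metis centre_in_cball less_eq_real_def mult_pos_pos zero_less_numeral)
  have sub: "cball y r \<subseteq> cball z (2 * r)" if "norm (y - z) \<le> r" for y
    using that by (simp add: cball_subset_cball_iff dist_norm)
  define K where "K = 8 * M / r\<^sup>2"
  have quad: "cmod (g (y + x) - g y - line_deriv g y x) \<le> K * (norm x)\<^sup>2"
    if "norm (y - z) \<le> r" "norm x \<le> r / 2" for x y
    unfolding K_def using that sub[OF that(1)] M r(2)
    by (intro line_bounds(2)[OF U(1,2) r(1)]) auto
  define E where "E t = cmod (line_deriv g z (u + v) - line_deriv g z u - line_deriv g (z + t *\<^sub>R u) v)" for t :: real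
  define B where "B = norm u + norm v + norm (u + v)"
  have Bt: "t * norm u \<le> r / 2" "t * norm v \<le> r / 2" "t * norm (u + v) \<le> r / 2"
    if "0 < t" "t * B \<le> r / 2" for t
  proof -
    have "t * norm u \<le> t * B" "t * norm v \<le> t * B" "t * norm (u + v) \<le> t * B"
      using that by (auto intro!: mult_left_mono simp: B_def)
    with that show "t * norm u \<le> r / 2" "t * norm v \<le> r / 2" "t * norm (u + v) \<le> r / 2" by linarith+
  qed
  have E: "E t \<le> t * (K * ((norm u)\<^sup>2 + (norm v)\<^sup>2 + (norm (u + v))\<^sup>2))"
    if t: "0 < t" "t * B \<le> r / 2" for t
  proof -
    note b = Bt[OF t]
    have zt: "norm (z + t *\<^sub>R u - z) \<le> r" and zU: "z + t *\<^sub>R u \<in> U"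
    proof -
      show *: "norm (z + t *\<^sub>R u - z) \<le> r" using b t r(1) by simp
      show "z + t *\<^sub>R u \<in> U" using sub[OF *] r by force
    qed
    have lin: "line_deriv g y (t *\<^sub>R x) = t * line_deriv g y x" if "y \<in> U" for x y
      using line_deriv_scale[OF U(1,2) that] by (simp add: scaleR_smult)
    have q1: "cmod (g (z + t *\<^sub>R (u + v)) - g z - line_deriv g z (t *\<^sub>R (u + v))) \<le> K * (t * norm (u + v))\<^sup>2"
      using quad[of z "t *\<^sub>R (u + v)"] b t r by simp
    have q2: "cmod (g (z + t *\<^sub>R u) - g z - line_deriv g z (t *\<^sub>R u)) \<le> K * (t * norm u)\<^sup>2"
      using quad[of z "t *\<^sub>R u"] b t r by simp
    have q3: "cmod (g (z + t *\<^sub>R u + t *\<^sub>R v) - g (z + t *\<^sub>R u) - line_deriv g (z + t *\<^sub>R u) (t *\<^sub>R v))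
        \<le> K * (t * norm v)\<^sup>2"
      using quad[OF zt, of "t *\<^sub>R v"] b t r by simp
    let ?a = "g (z + t *\<^sub>R (u + v)) - g z - line_deriv g z (t *\<^sub>R (u + v))"
    let ?b = "g (z + t *\<^sub>R u) - g z - line_deriv g z (t *\<^sub>R u)"
    let ?c = "g (z + t *\<^sub>R u + t *\<^sub>R v) - g (z + t *\<^sub>R u) - line_deriv g (z + t *\<^sub>R u) (t *\<^sub>R v)"
    have "t * (line_deriv g z (u + v) - line_deriv g z u - line_deriv g (z + t *\<^sub>R u) v) = ?b + ?c - ?a"
      unfolding lin[OF U(3)] lin[OF zU] by (simp add: algebra_simps)
    then have "t * E t = cmod (?b + ?c - ?a)"
      unfolding E_def using t by (metis abs_of_pos norm_mult norm_of_real)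
    also have "\<dots> \<le> cmod ?b + cmod ?c + cmod ?a"
      by (meson norm_triangle_ineq norm_triangle_ineq4 order_trans add_right_mono)
    also have "\<dots> \<le> K * (t * norm u)\<^sup>2 + K * (t * norm v)\<^sup>2 + K * (t * norm (u + v))\<^sup>2"
      using q1 q2 q3 by linarith
    also have "\<dots> = t * (t * (K * ((norm u)\<^sup>2 + (norm v)\<^sup>2 + (norm (u + v))\<^sup>2)))"
      by (simp add: power2_eq_square algebra_simps)
    finally show ?thesis using t by simp
  qed
  have B: "0 < B" using False unfolding B_def by (simp add: add_pos_nonneg)
  have ev: "\<forall>\<^sub>F t in at_right 0. E t \<le> t * (K * ((norm u)\<^sup>2 + (norm v)\<^sup>2 + (norm (u + v))\<^sup>2))"
    unfolding eventually_at_right_field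
    using B r E by (intro exI[of _ "r / (2 * B)"]) (auto simp: field_simps)
  have lim: "((\<lambda>t. line_deriv g (z + t *\<^sub>R u) v) \<longlongrightarrow> line_deriv g z v) (at_right 0)"
  proof (rule tendsto_compose_at[OF _ line_deriv_tendsto[OF U], of "\<lambda>t. z + t *\<^sub>R u", unfolded o_def])
    have "((\<lambda>t. z + t *\<^sub>R u) \<longlongrightarrow> z + 0 *\<^sub>R u) (at_right 0)" by (intro tendsto_intros)
    then show "((\<lambda>t. z + t *\<^sub>R u) \<longlongrightarrow> z) (at_right 0)" by simp
    show "\<forall>\<^sub>F t in at_right 0. z + t *\<^sub>R u = z \<longrightarrow> line_deriv g z v = line_deriv g z v" by simp
  qed
  have "(E \<longlongrightarrow> cmod (line_deriv g z (u + v) - line_deriv g z u - line_deriv g z v)) (at_right 0)"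
    unfolding E_def by (intro tendsto_intros lim)
  moreover have "((\<lambda>t. t * (K * ((norm u)\<^sup>2 + (norm v)\<^sup>2 + (norm (u + v))\<^sup>2))) \<longlongrightarrow> 0) (at_right 0)"
    by (rule tendsto_eq_intros | simp)+
  ultimately have "cmod (line_deriv g z (u + v) - line_deriv g z u - line_deriv g z v) \<le> 0"
    using tendsto_le[OF _ _ _ ev] by (metis trivial_limit_at_right_real)
  then show ?thesis by (simp add: algebra_simps)
qed simp

lemma line_holo_has_derivative:
  assumes U: "open U" "line_holo U g" "z \<in> U"
  shows "(g has_derivative line_deriv g z) (at z)"
proof -
  obtain r where r: "0 < r" "cball z r \<subseteq> U" using U open_contains_cball by blast
  have "bounded (g ` cball z r)"
    using U r by (intro compact_imp_bounded compact_continuous_image)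
      (auto simp: line_holo_def intro: continuous_on_subset)
  then obtain M where M: "\<And>y. y \<in> cball z r \<Longrightarrow> cmod (g y) \<le> M"
    unfolding bounded_iff by blast
  have "linear (line_deriv g z)"
    by (rule linearI) (simp_all add: line_deriv_add[OF U] line_deriv_scale[OF U] scaleR_smult scaleR_conv_of_real)
  then show ?thesis
    using line_bounds(2)[OF U(1,2) r M] r
    by (intro has_derivative_quadratic[where r = "r / 2" and K = "8 * M / r\<^sup>2"])
      (auto simp: linear_conv_bounded_linear)
qed

text \<open>
  Osgood's lemma: continuity and holomorphy along complex lines give complex
  differentiability. This reduces questions about limits and removable singularities to one
  variable.
\<close>

lemma holo_onI_lines:
  assumes U: "open U" and f: "\<And>j. line_holo U (\<lambda>z. f z $ j)"
  shows "holo_on U f"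
  unfolding holo_on_def
proof (intro ballI exI conjI allI)
  fix z assume z: "z \<in> U"
  let ?D = "\<lambda>v. \<chi> j. line_deriv (\<lambda>z. f z $ j) z v"
  show "(f has_derivative ?D) (at z)"
    by (rule has_derivative_vecI) (simp add: line_holo_has_derivative[OF U f z])
  show "?D (c *s v) = c *s ?D v" for c v
    by (simp add: vec_eq_iff line_deriv_scale[OF U f z])
qed

lemma holo_on_subset: "holo_on S f \<Longrightarrow> T \<subseteq> S \<Longrightarrow> holo_on T f"
  by (auto simp: holo_on_def)

lemma holo_on_imp_continuous_on: "holo_on S f \<Longrightarrow> continuous_on S f"
  unfolding holo_on_def
  by (meson continuous_at_imp_continuous_on has_derivative_continuous)

lemma holo_on_compose:
  assumes "holo_on S f" "holo_on T g" "f ` S \<subseteq> T"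
  shows "holo_on S (\<lambda>z. g (f z))"
  unfolding holo_on_def
proof
  fix z assume z: "z \<in> S"
  obtain D where D: "(f has_derivative D) (at z)" "\<And>c v. D (c *s v) = c *s D v"
    using assms(1) z unfolding holo_on_def by blast
  obtain E where E: "(g has_derivative E) (at (f z))" "\<And>c v. E (c *s v) = c *s E v"
    using assms(2,3) z unfolding holo_on_def by blast
  show "\<exists>D. ((\<lambda>z. g (f z)) has_derivative D) (at z) \<and> (\<forall>c v. D (c *s v) = c *s D v)"
    using has_derivative_compose[OF D(1) E(1)] D(2) E(2) by (intro exI[of _ "\<lambda>x. E (D x)"]) auto
qed

lemma holo_on_cong:
  assumes "open S" "holo_on S f" "\<And>z. z \<in> S \<Longrightarrow> f z = g z"
  shows "holo_on S g"
  unfolding holo_on_def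
proof
  fix z assume z: "z \<in> S"
  with assms(2) obtain D where D: "(f has_derivative D) (at z)" "\<forall>c v. D (c *s v) = c *s D v"
    unfolding holo_on_def by blast
  have "(g has_derivative D) (at z)"
    using D(1) assms(1,3) z by (metis has_derivative_transform_within_open)
  with D show "\<exists>D. (g has_derivative D) (at z) \<and> (\<forall>c v. D (c *s v) = c *s D v)" by blast
qed

lemma holo_on_curve:
  assumes f: "holo_on U f" and S: "open S" "c ` S \<subseteq> U" and c: "\<And>j. (\<lambda>w. c w $ j) holomorphic_on S"
  shows "(\<lambda>w. f (c w) $ j) holomorphic_on S"
proof (rule holomorphic_onI)
  fix w assume w: "w \<in> S"
  obtain D where D: "(f has_derivative D) (at (c w))" "\<And>c v. D (c *s v) = c *s D v"
    using f S w unfolding holo_on_def by blast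
  define c' where "c' = (\<chi> j. deriv (\<lambda>w. c w $ j) w)"
  have "(c has_derivative (\<lambda>h. h *s c')) (at w)"
  proof (rule has_derivative_vecI)
    fix j
    have "((\<lambda>w. c w $ j) has_field_derivative c' $ j) (at w)"
      using holomorphic_derivI[OF c S(1) w] by (simp add: c'_def)
    then show "((\<lambda>x. c x $ j) has_derivative (\<lambda>h. (h *s c') $ j)) (at w)"
      by (simp add: has_field_derivative_def mult.commute[of _ "c' $ j"])
  qed
  from has_derivative_compose[OF this D(1)]
  have "((\<lambda>w. f (c w)) has_derivative (\<lambda>h. h *s D c')) (at w)" by (simp add: D(2))
  from bounded_linear.has_derivative[OF bounded_linear_vec_nth[of j] this]
  have "((\<lambda>w. f (c w) $ j) has_field_derivative D c' $ j) (at w)"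
    by (simp add: has_field_derivative_def mult.commute[of _ "D c' $ j"])
  then show "(\<lambda>w. f (c w) $ j) field_differentiable at w within S"
    using field_differentiable_def field_differentiable_at_within by blast
qed

lemma holo_on_imp_line_holo:
  assumes "open U" "holo_on U f"
  shows "line_holo U (\<lambda>z. f z $ j)"
  unfolding line_holo_def
proof (intro conjI allI)
  show "continuous_on U (\<lambda>z. f z $ j)"
    using holo_on_imp_continuous_on[OF assms(2)] by (intro continuous_intros)
  show "(\<lambda>\<zeta>. f (z + \<zeta> *s v) $ j) holomorphic_on {\<zeta>. z + \<zeta> *s v \<in> U}" for z v
    using assms by (intro holo_on_curve[OF assms(2) open_line]) (auto intro!: holomorphic_intros)
qed

lemma holo_on_frechet:
  assumes "holo_on U f" "z \<in> U"
  shows "(f has_derivative frechet_derivative f (at z)) (at z)"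
    and "frechet_derivative f (at z) (c *s v) = c *s frechet_derivative f (at z) v"
proof -
  obtain D where D: "(f has_derivative D) (at z)" "\<forall>c v. D (c *s v) = c *s D v"
    using assms unfolding holo_on_def by blast
  then have "frechet_derivative f (at z) = D" using frechet_derivative_at by metis
  with D show "(f has_derivative frechet_derivative f (at z)) (at z)"
    and "frechet_derivative f (at z) (c *s v) = c *s frechet_derivative f (at z) v" by auto
qed

lemma frechet_line_deriv:
  assumes "open U" "holo_on U f" "z \<in> U"
  shows "frechet_derivative f (at z) v $ j = line_deriv (\<lambda>z. f z $ j) z v"
proof -
  have "((\<lambda>z. f z $ j) has_derivative (\<lambda>h. frechet_derivative f (at z) h $ j)) (at z)"
    by (intro bounded_linear.has_derivative[OF bounded_linear_vec_nth] holo_on_frechet[OF assms(2,3)])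
  from has_derivative_unique[OF this line_holo_has_derivative[OF assms(1) holo_on_imp_line_holo assms(3)]] assms
  show ?thesis by metis
qed

lemma norm_le_components:
  assumes "\<And>j. cmod (x $ j) \<le> B"
  shows "norm (x :: complex ^ 'n) \<le> real CARD('n) * B"
proof -
  have "norm x \<le> (\<Sum>j\<in>UNIV. cmod (x $ j))" by (simp add: norm_vec_def L2_set_le_sum)
  also have "\<dots> \<le> (\<Sum>j\<in>(UNIV :: 'n set). B)" by (intro sum_mono assms)
  finally show ?thesis by simp
qed

text \<open>Cauchy estimates for the first and second order Taylor remainders.\<close>

lemma holo_bounds:
  fixes f :: "complex ^ 'n \<Rightarrow> complex ^ 'n"
  assumes U: "open U" "holo_on U f" and r: "0 < r" "cball z r \<subseteq> U"
    and M: "\<And>y. y \<in> cball z r \<Longrightarrow> norm (f y) \<le> M"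
  shows "norm (frechet_derivative f (at z) v) \<le> real CARD('n) * (M / r) * norm v"
    and "norm v \<le> r / 2 \<Longrightarrow>
      norm (f (z + v) - f z - frechet_derivative f (at z) v) \<le> real CARD('n) * (8 * M / r\<^sup>2) * (norm v)\<^sup>2"
proof -
  have z: "z \<in> U" using r by auto
  have Mj: "cmod (f y $ j) \<le> M" if "y \<in> cball z r" for y j
    using M[OF that] Finite_Cartesian_Product.norm_nth_le[of "f y" j] by linarith
  note b = line_bounds[OF U(1) holo_on_imp_line_holo[OF U] r Mj]
  have "norm (frechet_derivative f (at z) v) \<le> real CARD('n) * (M / r * norm v)"
    using b(1) by (intro norm_le_components) (simp add: frechet_line_deriv[OF U z])
  then show "norm (frechet_derivative f (at z) v) \<le> real CARD('n) * (M / r) * norm v"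
    by (simp add: mult.assoc)
  assume "norm v \<le> r / 2"
  then have "norm (f (z + v) - f z - frechet_derivative f (at z) v) \<le> real CARD('n) * (8 * M / r\<^sup>2 * (norm v)\<^sup>2)"
    using b(2) by (intro norm_le_components) (simp add: frechet_line_deriv[OF U z])
  then show "norm (f (z + v) - f z - frechet_derivative f (at z) v) \<le> real CARD('n) * (8 * M / r\<^sup>2) * (norm v)\<^sup>2"
    by (simp add: mult.assoc)
qed

lemma holo_lipschitz:
  fixes f :: "complex ^ 'n \<Rightarrow> complex ^ 'n"
  assumes U: "open U" "holo_on U f" and r: "0 < r" "cball z (2 * r) \<subseteq> U"
    and M: "\<And>y. y \<in> cball z (2 * r) \<Longrightarrow> norm (f y) \<le> M"
    and xy: "x \<in> cball z r" "y \<in> cball z r"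
  shows "norm (f x - f y) \<le> real CARD('n) * (M / r) * norm (x - y)"
proof (rule differentiable_bound[where S = "cball z r" and f' = "\<lambda>x. frechet_derivative f (at x)"])
  fix x assume x: "x \<in> cball z r"
  have sub: "cball x r \<subseteq> cball z (2 * r)"
    using x by (simp add: cball_subset_cball_iff dist_commute)
  have xU: "x \<in> U" using sub r by force
  show "(f has_derivative frechet_derivative f (at x)) (at x within cball z r)"
    using holo_on_frechet(1)[OF U(2) xU] has_derivative_at_withinI by blast
  show "onorm (frechet_derivative f (at x)) \<le> real CARD('n) * (M / r)"
    using sub M r(2) by (intro onorm_bound holo_bounds(1)[OF U r(1)])
      (auto intro!: mult_nonneg_nonneg divide_nonneg_pos r(1) order_trans[OF norm_ge_zero M[of z]] simp: less_imp_le r(1))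
qed (use xy in auto)

text \<open>
  On each complex line this is the theorem of Weierstrass in one variable.
\<close>

lemma holo_on_uniform_limit:
  assumes U: "open U" "\<And>k. holo_on U (f k)" and lim: "uniform_limit U f g sequentially"
  shows "holo_on U g"
proof (rule holo_onI_lines[OF U(1)])
  fix j
  have limj: "uniform_limit U (\<lambda>k z. f k z $ j) (\<lambda>z. g z $ j) sequentially"
    by (rule bounded_linear.uniform_limit[OF bounded_linear_vec_nth lim])
  have cont: "continuous_on U (\<lambda>z. g z $ j)"
    by (rule uniform_limit_theorem[OF _ limj])
      (auto intro!: always_eventually continuous_on_component holo_on_imp_continuous_on U(2))
  moreover have "(\<lambda>\<zeta>. g (z + \<zeta> *s v) $ j) holomorphic_on {\<zeta>. z + \<zeta> *s v \<in> U}" (is "_ holomorphic_on ?S") for z v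
  proof (rule holomorphic_uniform_sequence[OF open_line[OF U(1)]])
    show "(\<lambda>\<zeta>. f k (z + \<zeta> *s v) $ j) holomorphic_on ?S" for k
      using holo_on_imp_line_holo[OF U(1) U(2)[of k], of j] by (simp add: line_holo_def)
    fix x assume "x \<in> ?S"
    then obtain d where d: "0 < d" "cball x d \<subseteq> ?S"
      using open_line[OF U(1)] open_contains_cball by blast
    have "uniform_limit (cball x d) (\<lambda>k \<zeta>. f k (z + \<zeta> *s v) $ j) (\<lambda>\<zeta>. g (z + \<zeta> *s v) $ j) sequentially"
      using limj d(2) unfolding uniform_limit_iff by (force elim!: eventually_mono)
    with d show "\<exists>d>0. cball x d \<subseteq> ?S \<and>
        uniform_limit (cball x d) (\<lambda>k \<zeta>. f k (z + \<zeta> *s v) $ j) (\<lambda>\<zeta>. g (z + \<zeta> *s v) $ j) sequentially"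
      by blast
  qed
  ultimately show "line_holo U (\<lambda>z. g z $ j)" by (simp add: line_holo_def)
qed

text \<open>
  A complex line meets the exceptional point at most once, and continuity makes the singularity
  on the line removable.
\<close>

lemma holo_on_removable:
  fixes f :: "complex ^ 'n \<Rightarrow> complex ^ 'n"
  assumes U: "open U" "continuous_on U f" "holo_on (U - {a}) f"
  shows "holo_on U f"
proof (rule holo_onI_lines[OF U(1)])
  fix j
  have "(\<lambda>\<zeta>. f (z + \<zeta> *s v) $ j) holomorphic_on {\<zeta>. z + \<zeta> *s v \<in> U}" (is "_ holomorphic_on ?S") for z v
  proof (cases "v = 0")
    case False
    define K where "K = {\<zeta>. z + \<zeta> *s v = a}"
    have uniq: "\<zeta> = \<zeta>'" if "\<zeta> \<in> K" "\<zeta>' \<in> K" for \<zeta> \<zeta>'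
    proof -
      have "(\<zeta> - \<zeta>') *s v = 0" using that by (auto simp: K_def algebra_simps smult.diff_left)
      then show ?thesis using False by (metis norm_eq_zero norm_smult mult_eq_0_iff right_minus_eq)
    qed
    have "finite K"
    proof (cases "K = {}")
      case False
      then obtain \<zeta> where "\<zeta> \<in> K" by blast
      with uniq have "K \<subseteq> {\<zeta>}" by blast
      then show ?thesis by (rule finite_subset) simp
    qed simp
    moreover have "continuous_on ?S (\<lambda>\<zeta>. f (z + \<zeta> *s v) $ j)"
      by (intro continuous_on_component continuous_on_compose2[OF U(2)] continuous_intros) auto
    moreover have "(\<lambda>\<zeta>. f (z + \<zeta> *s v) $ j) holomorphic_on (?S - K)"
    proof (rule holo_on_curve[OF U(3)])
      show "open (?S - K)" using open_line[OF U(1)] \<open>finite K\<close> by (simp add: finite_imp_closed open_Diff)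
    qed (auto simp: K_def intro!: holomorphic_intros)
    ultimately show ?thesis
      using no_isolated_singularity[OF _ _ open_line[OF U(1)]] by blast
  qed simp
  moreover have "continuous_on U (\<lambda>z. f z $ j)" using U by (intro continuous_intros)
  ultimately show "line_holo U (\<lambda>z. f z $ j)" by (simp add: line_holo_def)
qed

section \<open>Ordinary differential equations\<close>

definition solves :: "('a::real_normed_vector \<Rightarrow> 'a) \<Rightarrow> 'a set \<Rightarrow> real set \<Rightarrow> (real \<Rightarrow> 'a) \<Rightarrow> bool" where
  "solves X U I c \<longleftrightarrow> (\<forall>t\<in>I. c t \<in> U \<and> (c has_vector_derivative X (c t)) (at t))"

definition locally_lipschitz :: "('a::real_normed_vector \<Rightarrow> 'a) \<Rightarrow> 'a set \<Rightarrow> bool" where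
  "locally_lipschitz X U \<longleftrightarrow>
     (\<forall>z\<in>U. \<exists>r>0. \<exists>L. cball z r \<subseteq> U \<and>
        (\<forall>x\<in>cball z r. \<forall>y\<in>cball z r. norm (X x - X y) \<le> L * norm (x - y)))"

lemma solves_subset: "solves X U I c \<Longrightarrow> J \<subseteq> I \<Longrightarrow> solves X U J c"
  by (auto simp: solves_def)

lemma solves_imp_continuous_on: "solves X U I c \<Longrightarrow> continuous_on I c"
  unfolding solves_def
  by (meson continuous_at_imp_continuous_on has_vector_derivative_continuous)

lemma solves_reverse:
  assumes "solves X U I c"
  shows "solves (\<lambda>x. - X x) U (uminus ` I) (\<lambda>t. c (- t))"
  unfolding solves_def
proof (intro ballI conjI)
  fix t assume "t \<in> uminus ` I"
  then have "- t \<in> I" by auto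
  then have c: "c (- t) \<in> U" "(c has_vector_derivative X (c (- t))) (at (- t))"
    using assms by (auto simp: solves_def)
  show "c (- t) \<in> U" by fact
  have "((c \<circ> uminus) has_vector_derivative (- 1) *\<^sub>R X (c (- t))) (at t)"
    by (rule vector_diff_chain_at) (use c in \<open>auto intro!: derivative_eq_intros\<close>)
  then show "((\<lambda>t. c (- t)) has_vector_derivative - X (c (- t))) (at t)" by (simp add: o_def)
qed

lemma solves_shift:
  assumes "solves X U I c"
  shows "solves X U {t. t + s \<in> I} (\<lambda>t. c (t + s))"
  unfolding solves_def
proof (intro ballI conjI)
  fix t assume "t \<in> {t. t + s \<in> I}"
  then have c: "c (t + s) \<in> U" "(c has_vector_derivative X (c (t + s))) (at (t + s))"
    using assms by (auto simp: solves_def)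
  show "c (t + s) \<in> U" by fact
  have "((c \<circ> (\<lambda>t. t + s)) has_vector_derivative 1 *\<^sub>R X (c (t + s))) (at t)"
    by (rule vector_diff_chain_at) (use c in \<open>auto intro!: derivative_eq_intros\<close>)
  then show "((\<lambda>t. c (t + s)) has_vector_derivative X (c (t + s))) (at t)" by (simp add: o_def)
qed

text \<open>
  Gronwall's estimate: \<open>exp (- 2 L t)\<close> times the squared distance of two solutions does not
  increase.
\<close>

lemma solutions_dist_forward:
  fixes c1 c2 :: "real \<Rightarrow> 'a::real_inner"
  assumes ab: "a \<le> b" and c: "solves X S {a..b} c1" "solves X S {a..b} c2"
    and L: "\<And>x y. x \<in> S \<Longrightarrow> y \<in> S \<Longrightarrow> norm (X x - X y) \<le> L * norm (x - y)"
  shows "norm (c1 b - c2 b) \<le> exp (L * (b - a)) * norm (c1 a - c2 a)"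
proof -
  define d where "d t = c1 t - c2 t" for t
  define \<phi> where "\<phi> t = exp (- 2 * L * (t - a)) * (d t \<bullet> d t)" for t
  have "\<phi> b \<le> \<phi> a"
  proof (rule DERIV_nonpos_imp_nonincreasing[OF ab])
    fix t assume t: "a \<le> t" "t \<le> b"
    define d' where "d' = X (c1 t) - X (c2 t)"
    have "(d has_vector_derivative d') (at t)"
      unfolding d_def d'_def using c t
      by (intro has_vector_derivative_diff) (auto simp: solves_def)
    then have "(d has_derivative (\<lambda>h. h *\<^sub>R d')) (at t)" by (simp add: has_vector_derivative_def)
    then have dd: "((\<lambda>t. d t \<bullet> d t) has_field_derivative 2 * (d t \<bullet> d')) (at t)"
      unfolding has_field_derivative_def
      by (rule has_derivative_eq_rhs[OF has_derivative_inner[OF _ \<open>(d has_derivative _) _\<close>]])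
         (auto simp: inner_commute algebra_simps)
    have "(\<phi> has_field_derivative
        exp (- 2 * L * (t - a)) * (- 2 * L) * (d t \<bullet> d t) + exp (- 2 * L * (t - a)) * (2 * (d t \<bullet> d'))) (at t)"
      unfolding \<phi>_def by (rule derivative_eq_intros dd refl | simp)+
    moreover have "exp (- 2 * L * (t - a)) * (- 2 * L) * (d t \<bullet> d t) + exp (- 2 * L * (t - a)) * (2 * (d t \<bullet> d')) \<le> 0"
    proof -
      have "d t \<bullet> d' \<le> norm (d t) * norm d'" by (rule norm_cauchy_schwarz)
      also have "\<dots> \<le> norm (d t) * (L * norm (d t))"
        unfolding d'_def d_def using c t by (intro mult_left_mono L) (auto simp: solves_def)
      also have "\<dots> = L * (d t \<bullet> d t)"
        by (simp add: power2_norm_eq_inner[symmetric] power2_eq_square)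
      finally have "d t \<bullet> d' - L * (d t \<bullet> d t) \<le> 0" by simp
      then have "exp (- 2 * L * (t - a)) * 2 * (d t \<bullet> d' - L * (d t \<bullet> d t)) \<le> 0"
        by (intro mult_nonneg_nonpos) auto
      then show ?thesis by (simp add: algebra_simps)
    qed
    ultimately show "\<exists>y. (\<phi> has_field_derivative y) (at t) \<and> y \<le> 0" by blast
  qed
  then have "exp (- 2 * L * (b - a)) * (norm (d b))\<^sup>2 \<le> (norm (d a))\<^sup>2"
    by (simp add: \<phi>_def power2_norm_eq_inner)
  then have "(norm (d b))\<^sup>2 \<le> exp (2 * L * (b - a)) * (norm (d a))\<^sup>2"
  proof -
    assume *: "exp (- 2 * L * (b - a)) * (norm (d b))\<^sup>2 \<le> (norm (d a))\<^sup>2"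
    have "exp (2 * L * (b - a)) * (exp (- 2 * L * (b - a)) * (norm (d b))\<^sup>2) = (norm (d b))\<^sup>2"
      by (simp add: exp_minus)
    then have "(norm (d b))\<^sup>2 = exp (2 * L * (b - a)) * (exp (- 2 * L * (b - a)) * (norm (d b))\<^sup>2)" ..
    also have "\<dots> \<le> exp (2 * L * (b - a)) * (norm (d a))\<^sup>2" by (rule mult_left_mono[OF *]) simp
    finally show ?thesis .
  qed
  also have "\<dots> = (exp (L * (b - a)) * norm (d a))\<^sup>2"
    by (simp add: power_mult_distrib exp_double[symmetric] mult.assoc)
  finally have "norm (d b) \<le> exp (L * (b - a)) * norm (d a)"
    by (rule power2_le_imp_le) simp
  then show ?thesis by (simp only: d_def)
qed

lemma solutions_dist:
  fixes c1 c2 :: "real \<Rightarrow> 'a::real_inner"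
  assumes c: "solves X S I c1" "solves X S I c2" and I: "closed_segment a b \<subseteq> I"
    and L: "\<And>x y. x \<in> S \<Longrightarrow> y \<in> S \<Longrightarrow> norm (X x - X y) \<le> L * norm (x - y)"
  shows "norm (c1 b - c2 b) \<le> exp (L * \<bar>b - a\<bar>) * norm (c1 a - c2 a)"
proof (cases "a \<le> b")
  case True
  then show ?thesis
    using solutions_dist_forward[OF True _ _ L] c I
    by (auto simp: closed_segment_eq_real_ivl intro: solves_subset)
next
  case False
  then have sub: "{- a..- b} \<subseteq> uminus ` I"
    using I by (auto simp: closed_segment_eq_real_ivl subset_iff image_iff) (metis minus_le_iff neg_le_iff_le minus_minus le_minus_iff)
  have "norm (c1 (- (- b)) - c2 (- (- b))) \<le> exp (L * (- b - - a)) * norm (c1 (- (- a)) - c2 (- (- a)))"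
    using False L
    by (intro solutions_dist_forward[OF _ solves_subset[OF solves_reverse[OF c(1)] sub] solves_subset[OF solves_reverse[OF c(2)] sub]])
       (auto simp: norm_minus_commute)
  with False show ?thesis by (simp add: abs_if)
qed

text \<open>
  The set of times at which the solutions agree is closed, and it is open by Gronwall's
  estimate in a ball on which the field is Lipschitz.
\<close>

lemma solution_unique:
  fixes c1 c2 :: "real \<Rightarrow> 'a::real_inner"
  assumes lip: "locally_lipschitz X U" and I: "open I" "connected I"
    and c: "solves X U I c1" "solves X U I c2" and t: "t0 \<in> I" "c1 t0 = c2 t0" "t \<in> I"
  shows "c1 t = c2 t"
proof -
  let ?S = "{t\<in>I. c1 t - c2 t = 0}"
  have cont: "continuous_on I c1" "continuous_on I c2"
    using c by (auto intro: solves_imp_continuous_on)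
  have "closedin (top_of_set I) ?S"
    by (intro continuous_closedin_preimage_constant continuous_intros cont)
  moreover have "open ?S"
    unfolding open_contains_ball
  proof
    fix s assume s: "s \<in> ?S"
    then have "c1 s \<in> U" using c by (auto simp: solves_def)
    then obtain r L where r: "0 < r" and L: "\<And>x y. x \<in> cball (c1 s) r \<Longrightarrow> y \<in> cball (c1 s) r \<Longrightarrow>
        norm (X x - X y) \<le> L * norm (x - y)"
      using lip unfolding locally_lipschitz_def by meson
    have near: "\<exists>e>0. \<forall>t\<in>ball s e. t \<in> I \<and> c t \<in> cball (c1 s) r"
      if "continuous_on I c" "c s = c1 s" for c
    proof -
      have "open (I \<inter> c -` ball (c1 s) r)" using that I by (simp add: continuous_open_preimage)
      moreover have "s \<in> I \<inter> c -` ball (c1 s) r" using s that r by auto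
      ultimately obtain e where "0 < e" "ball s e \<subseteq> I \<inter> c -` ball (c1 s) r"
        unfolding open_contains_ball by blast
      then show ?thesis by (intro exI[of _ e]) (auto simp: subset_iff less_imp_le)
    qed
    from near[OF cont(1)] near[OF cont(2)] s obtain e1 e2 where e: "0 < e1" "0 < e2"
      "\<forall>t\<in>ball s e1. t \<in> I \<and> c1 t \<in> cball (c1 s) r" "\<forall>t\<in>ball s e2. t \<in> I \<and> c2 t \<in> cball (c1 s) r"
      by auto
    define e where "e = min e1 e2"
    have sol: "solves X (cball (c1 s) r) (ball s e) c1" "solves X (cball (c1 s) r) (ball s e) c2"
      using c e unfolding solves_def e_def by auto
    have "ball s e \<subseteq> ?S"
    proof
      fix t assume t: "t \<in> ball s e"
      have "closed_segment s t \<subseteq> ball s e"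
        using t e by (intro closed_segment_subset) (auto simp: e_def)
      from solutions_dist[OF sol this L] s have "norm (c1 t - c2 t) \<le> 0" by auto
      then show "t \<in> ?S" using t e by (auto simp: e_def)
    qed
    then show "\<exists>e>0. ball s e \<subseteq> ?S" using e by (intro exI[of _ e]) (auto simp: e_def)
  qed
  then have "openin (top_of_set I) ?S" by (intro open_openin_trans) (use I in auto)
  ultimately have "?S = {} \<or> ?S = I" using I(2) by (auto simp: connected_clopen)
  then show ?thesis using t by auto
qed

text \<open>
  The theorem of Picard and Lindeloef. Composing the field with the nearest-point projection
  onto the ball makes it globally Lipschitz, so that the Picard operator is a contraction of
  the space of all bounded continuous curves.
\<close>

lemma local_solution:
  fixes X :: "'a::euclidean_space \<Rightarrow> 'a"
  assumes r: "0 < r" and M: "\<And>x. x \<in> cball z r \<Longrightarrow> norm (X x) \<le> M"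
    and L: "\<And>x y. x \<in> cball z r \<Longrightarrow> y \<in> cball z r \<Longrightarrow> norm (X x - X y) \<le> L * norm (x - y)"
    and e: "0 < e" "M * e \<le> r" "0 \<le> L" "L * e < 1"
  shows "\<exists>c. c 0 = z \<and> solves X (cball z r) {-e<..<e} c"
proof -
  define P where "P x = X (closest_point (cball z r) x)" for x
  have ball: "convex (cball z r)" "closed (cball z r)" "cball z r \<noteq> {}" using r by auto
  have mem: "closest_point (cball z r) x \<in> cball z r" for x
    using ball(2,3) by (rule closest_point_in_set)
  have P_lip: "norm (P x - P y) \<le> L * norm (x - y)" for x y
  proof -
    have "norm (P x - P y) \<le> L * norm (closest_point (cball z r) x - closest_point (cball z r) y)"
      unfolding P_def by (intro L mem)
    also have "\<dots> \<le> L * norm (x - y)"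
      using closest_point_lipschitz[OF ball, of x y] e by (intro mult_left_mono) (auto simp: dist_norm)
    finally show ?thesis .
  qed
  have P_M: "norm (P x) \<le> M" for x unfolding P_def by (intro M mem)
  have P_cont: "continuous_on UNIV P"
  proof (rule continuous_on_iff[THEN iffD2], intro ballI allI impI)
    fix x d :: "'a" and \<epsilon> :: real assume "0 < \<epsilon>"
    then have "dist y x < \<epsilon> / (L + 1) \<longrightarrow> dist (P y) (P x) < \<epsilon>" for y
    proof (intro impI)
      assume "dist y x < \<epsilon> / (L + 1)"
      then have "(L + 1) * norm (y - x) < \<epsilon>" using e by (simp add: field_simps dist_norm)
      moreover have "L * norm (y - x) \<le> (L + 1) * norm (y - x)" by (intro mult_right_mono) auto
      ultimately show "dist (P y) (P x) < \<epsilon>" using P_lip[of y x] by (simp add: dist_norm)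
    qed
    then show "\<exists>d>0. \<forall>x'\<in>UNIV. dist x' x < d \<longrightarrow> dist (P x') (P x) < \<epsilon>"
      using \<open>0 < \<epsilon>\<close> e by (intro exI[of _ "\<epsilon> / (L + 1)"]) auto
  qed
  define G where "G f t = integral {-e..t} f - integral {-e..0} f" for f :: "real \<Rightarrow> 'a" and t
  have G_bound: "norm (G f t) \<le> B * e"
    if f: "continuous_on UNIV f" "\<And>s. norm (f s) \<le> B" and t: "- e \<le> t" "t \<le> e" for f B t
  proof -
    have int: "f integrable_on {a..b}" for a b
      using f by (intro integrable_continuous_interval continuous_on_subset[OF f(1)]) auto
    have ib: "norm (integral {a..b} f) \<le> B * (b - a)" if "a \<le> b" for a b
      using that f by (intro integral_bound continuous_on_subset[OF f(1)]) auto
    have B: "0 \<le> B" using f(2)[of 0] norm_ge_zero order_trans by blast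
    show ?thesis
    proof (cases "0 \<le> t")
      case True
      then have "G f t = integral {0..t} f"
        unfolding G_def using Henstock_Kurzweil_Integration.integral_combine[of "-e" 0 t f] int e by (simp add: algebra_simps)
      moreover have "B * (t - 0) \<le> B * e" using B t by (intro mult_left_mono) auto
      ultimately show ?thesis using ib[OF True] by simp
    next
      case False
      then have "G f t = - integral {t..0} f"
        unfolding G_def using Henstock_Kurzweil_Integration.integral_combine[of "-e" t 0 f] int t by (simp add: algebra_simps)
      moreover have "B * (0 - t) \<le> B * e" using B t by (intro mult_left_mono) auto
      ultimately show ?thesis using ib[of t 0] False by simp
    qed
  qed
  define cl where "cl t = max (- e) (min e t)" for t :: real
  have cl: "- e \<le> cl t" "cl t \<le> e" for t using e by (auto simp: cl_def)
  define T where "T c t = z + G (\<lambda>s. P (apply_bcontfun c s)) (cl t)" for c :: "real \<Rightarrow>\<^sub>C 'a" and t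
  have Pc: "continuous_on UNIV (\<lambda>s. P (apply_bcontfun c s))" for c :: "real \<Rightarrow>\<^sub>C 'a"
    by (rule continuous_on_compose2[OF P_cont]) auto
  have T_z: "norm (T c t - z) \<le> r" for c t
    using G_bound[OF Pc P_M cl] e(2) order_trans by (fastforce simp: T_def)
  have T_bcont: "T c \<in> bcontfun" for c
  proof -
    have "continuous_on {-e..e} (\<lambda>t. G (\<lambda>s. P (apply_bcontfun c s)) t)"
      unfolding G_def
      by (intro continuous_intros indefinite_integral_continuous_1 integrable_continuous_interval
            continuous_on_subset[OF Pc]) auto
    then have "continuous_on UNIV (\<lambda>t. G (\<lambda>s. P (apply_bcontfun c s)) (cl t))"
    proof (rule continuous_on_compose2)
      show "continuous_on UNIV cl" unfolding cl_def by (intro continuous_intros)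
    qed (use cl in auto)
    then have "continuous_on UNIV (T c)"
      unfolding T_def by (intro continuous_on_add continuous_on_const)
    moreover have "bounded (range (T c))"
      unfolding bounded_def using T_z[of c]
      by (intro exI[of _ z] exI[of _ r]) (simp add: dist_norm norm_minus_commute)
    ultimately show ?thesis by (simp add: bcontfun_def)
  qed
  define TT where "TT c = Bcontfun (T c)" for c
  have TT: "apply_bcontfun (TT c) = T c" for c by (simp add: TT_def Bcontfun_inverse[OF T_bcont])
  have "dist (TT c) (TT c') \<le> (L * e) * dist c c'" for c c'
  proof (rule dist_bound)
    fix t
    have "T c t - T c' t = G (\<lambda>s. P (apply_bcontfun c s) - P (apply_bcontfun c' s)) (cl t)"
    proof -
      have "(\<lambda>s. P (apply_bcontfun c s)) integrable_on {a..b}" for c :: "real \<Rightarrow>\<^sub>C 'a" and a b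
        by (intro integrable_continuous_interval continuous_on_subset[OF Pc]) auto
      then show ?thesis by (simp add: T_def G_def Henstock_Kurzweil_Integration.integral_diff)
    qed
    also have "norm \<dots> \<le> (L * dist c c') * e"
    proof (intro G_bound cl)
      show "continuous_on UNIV (\<lambda>s. P (apply_bcontfun c s) - P (apply_bcontfun c' s))"
        by (intro continuous_intros Pc)
      fix s
      have "norm (P (apply_bcontfun c s) - P (apply_bcontfun c' s)) \<le> L * dist (apply_bcontfun c s) (apply_bcontfun c' s)"
        using P_lip by (simp add: dist_norm)
      also have "\<dots> \<le> L * dist c c'" using e by (intro mult_left_mono dist_bounded)
      finally show "norm (P (apply_bcontfun c s) - P (apply_bcontfun c' s)) \<le> L * dist c c'" .
    qed
    finally show "dist (apply_bcontfun (TT c) t) (apply_bcontfun (TT c') t) \<le> (L * e) * dist c c'"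
      by (simp add: TT dist_norm mult_ac)
  qed
  then have TT_lip: "\<forall>c c'. dist (TT c) (TT c') \<le> (L * e) * dist c c'" by blast
  have "0 \<le> L * e" using e by simp
  from banach_fix_type[OF this e(4) TT_lip] have "\<exists>!c. TT c = c" .
  then obtain c where "TT c = c" by blast
  have c: "apply_bcontfun c t = z + G (\<lambda>s. P (apply_bcontfun c s)) (cl t)" for t
    unfolding T_def[symmetric] TT[symmetric] \<open>TT c = c\<close> by (rule refl)
  have cz: "apply_bcontfun c t \<in> cball z r" for t
    using T_z[of c t] unfolding TT[symmetric] \<open>TT c = c\<close> by (simp add: dist_norm norm_minus_commute)
  have "solves X (cball z r) {-e<..<e} (apply_bcontfun c)"
    unfolding solves_def
  proof (intro ballI conjI cz)
    fix t assume t: "t \<in> {-e<..<e}"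
    have "((\<lambda>t. integral {-e..t} (\<lambda>s. P (apply_bcontfun c s))) has_vector_derivative P (apply_bcontfun c t))
        (at t within {-e..e})"
      using t by (intro integral_has_vector_derivative continuous_on_subset[OF Pc]) auto
    then have "((\<lambda>t. integral {-e..t} (\<lambda>s. P (apply_bcontfun c s))) has_vector_derivative P (apply_bcontfun c t)) (at t)"
      using at_within_Icc_at[of "-e" t e] t by auto
    then have "((\<lambda>t. z + G (\<lambda>s. P (apply_bcontfun c s)) t) has_vector_derivative P (apply_bcontfun c t)) (at t)"
      unfolding G_def by (auto intro!: derivative_eq_intros)
    moreover have "P (apply_bcontfun c t) = X (apply_bcontfun c t)"
      using cz by (simp add: P_def closest_point_self)
    ultimately have der: "((\<lambda>t. z + G (\<lambda>s. P (apply_bcontfun c s)) t) has_vector_derivative X (apply_bcontfun c t)) (at t)"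
      by (simp only:)
    have "z + G (\<lambda>s. P (apply_bcontfun c s)) x = apply_bcontfun c x" if "x \<in> {-e<..<e}" for x
    proof -
      have "cl x = x" using that by (auto simp: cl_def)
      then show ?thesis using c[of x] by (simp only:)
    qed
    with has_vector_derivative_transform_within_open[OF der open_greaterThanLessThan t]
    show "(apply_bcontfun c has_vector_derivative X (apply_bcontfun c t)) (at t)" by blast
  qed
  moreover have "apply_bcontfun c 0 = z"
  proof -
    have "cl 0 = 0" using e by (auto simp: cl_def)
    with c[of 0] show ?thesis by (simp only: G_def) simp
  qed
  ultimately show ?thesis by blast
qed

text \<open>
  If every point admits a solution of the same life time, solutions can be prolonged by a
  fixed amount again and again.
\<close>

lemma extend_solution:
  fixes X :: "'a::euclidean_space \<Rightarrow> 'a"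
  assumes lip: "locally_lipschitz X U" and e: "0 < e"
    and loc: "\<And>z. z \<in> U \<Longrightarrow> \<exists>c. c 0 = z \<and> solves X U {-e<..<e} c"
    and c: "solves X U {-e<..<b} c" and b: "0 < b"
  shows "\<exists>c'. solves X U {-e<..<b + e / 2} c' \<and> (\<forall>t<b. c' t = c t)"
proof -
  define s where "s = b - e / 2"
  have s: "- e < s" "s < b" using e b by (auto simp: s_def)
  then have "c s \<in> U" using c by (auto simp: solves_def)
  from loc[OF this] obtain d where d: "d 0 = c s" "solves X U {-e<..<e} d" by blast
  define d' where "d' t = d (t - s)" for t
  have d': "solves X U {s - e<..<s + e} d'"
    using solves_subset[OF solves_shift[OF d(2), of "- s"], of "{s - e<..<s + e}"]
    unfolding d'_def by (auto simp: subset_iff)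
  have eq: "c t = d' t" if "max (- e) (s - e) < t" "t < b" for t
  proof (rule solution_unique[OF lip])
    let ?I = "{max (- e) (s - e)<..<b}"
    show "solves X U ?I c" "solves X U ?I d'"
      using c d' e by (auto simp: s_def intro: solves_subset)
    show "s \<in> ?I" using s e by auto
  qed (use that d in \<open>auto simp: d'_def\<close>)
  define c' where "c' t = (if t < b then c t else d' t)" for t
  have "solves X U {-e<..<b + e / 2} c'"
    unfolding solves_def
  proof
    fix t assume t: "t \<in> {-e<..<b + e / 2}"
    show "c' t \<in> U \<and> (c' has_vector_derivative X (c' t)) (at t)"
    proof (cases "t < b")
      case True
      then have "c t \<in> U" "(c has_vector_derivative X (c t)) (at t)" using c t by (auto simp: solves_def)
      then show ?thesis
        using True by (auto simp: c'_def intro!: has_vector_derivative_transform_within_open[where S = "{..<b}" and f = c])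
    next
      case False
      with t e have t': "t \<in> {max (- e) (s - e)<..<s + e}" by (auto simp: s_def)
      have eq': "d' x = c' x" if "x \<in> {max (- e) (s - e)<..<s + e}" for x
        using that eq[of x] by (auto simp: c'_def)
      have "d' t \<in> U" "(d' has_vector_derivative X (d' t)) (at t)" using d' t' by (auto simp: solves_def)
      then show ?thesis
        using eq' t' has_vector_derivative_transform_within_open[of d' _ t "{max (- e) (s - e)<..<s + e}" c'] by auto
    qed
  qed
  then show ?thesis by (auto simp: c'_def)
qed

lemma forward_solution:
  fixes X :: "'a::euclidean_space \<Rightarrow> 'a"
  assumes lip: "locally_lipschitz X U" and e: "0 < e"
    and loc: "\<And>z. z \<in> U \<Longrightarrow> \<exists>c. c 0 = z \<and> solves X U {-e<..<e} c" and z: "z \<in> U"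
  shows "\<exists>c. c 0 = z \<and> solves X U {-e<..} c"
proof -
  define b where "b k = e + real k * (e / 2)" for k :: nat
  have b: "e \<le> b k" "b (Suc k) = b k + e / 2" for k using e by (auto simp: b_def algebra_simps add_divide_distrib)
  have "\<exists>c. c 0 = z \<and> solves X U {-e<..<b k} c" for k
  proof (induction k)
    case 0
    then show ?case using loc[OF z] by (simp add: b_def)
  next
    case (Suc k)
    then obtain c where c: "c 0 = z" "solves X U {-e<..<b k} c" by blast
    have "0 < b k" using e b(1)[of k] by linarith
    from extend_solution[OF lip e loc c(2) this] c(1) this show ?case
      unfolding b(2) by metis
  qed
  then obtain C where C: "\<And>k. C k 0 = z" "\<And>k. solves X U {-e<..<b k} (C k)" by metis
  have agree: "C k t = C l t" if "-e < t" "t < b k" "t < b l" for k l t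
  proof (rule solution_unique[OF lip])
    let ?I = "{-e<..<min (b k) (b l)}"
    show "solves X U ?I (C k)" "solves X U ?I (C l)"
      by (rule solves_subset[OF C(2)], force)+
    show "0 \<in> ?I" using e b(1)[of k] b(1)[of l] by auto
  qed (use that C in auto)
  have ex: "\<exists>k. t < b k" for t
  proof -
    obtain k where "t / (e / 2) < real k" using reals_Archimedean2 by blast
    then have "t < b k" using e by (simp add: b_def field_simps)
    then show ?thesis ..
  qed
  define c where "c t = C (SOME k. t < b k) t" for t
  have cC: "c t = C k t" if "-e < t" "t < b k" for t k
    unfolding c_def using someI_ex[OF ex[of t]] that by (intro agree) auto
  have "solves X U {-e<..} c"
    unfolding solves_def
  proof
    fix t assume t: "t \<in> {-e<..}"
    obtain k where k: "t < b k" using ex by blast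
    have "C k t \<in> U" "(C k has_vector_derivative X (C k t)) (at t)" using C(2)[of k] t k by (auto simp: solves_def)
    then show "c t \<in> U \<and> (c has_vector_derivative X (c t)) (at t)"
      using cC t k has_vector_derivative_transform_within_open[of "C k" _ t "{-e<..<b k}" c] by force
  qed
  moreover have "c 0 = z" using cC[of 0 0] C e b(1)[of 0] by auto
  ultimately show ?thesis by blast
qed

text \<open>
  Backward solutions are forward solutions of the opposite field; the two halves agree on an
  interval around \<open>0\<close> by uniqueness.
\<close>

lemma global_solution:
  fixes X :: "'a::euclidean_space \<Rightarrow> 'a"
  assumes lip: "locally_lipschitz X U" and e: "0 < e"
    and loc: "\<And>z. z \<in> U \<Longrightarrow> \<exists>c. c 0 = z \<and> solves X U {-e<..<e} c" and z: "z \<in> U"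
  shows "\<exists>c. c 0 = z \<and> solves X U UNIV c"
proof -
  obtain c where c: "c 0 = z" "solves X U {-e<..} c"
    using forward_solution[OF lip e loc z] by blast
  have lip': "locally_lipschitz (\<lambda>x. - X x) U"
    using lip unfolding locally_lipschitz_def by (simp add: norm_minus_commute)
  have "\<exists>c. c 0 = z \<and> solves (\<lambda>x. - X x) U {-e<..<e} c" if z: "z \<in> U" for z
  proof -
    obtain c where "c 0 = z" "solves X U {-e<..<e} c" using loc[OF z] by blast
    then show ?thesis
      using solves_reverse[of X U "{-e<..<e}" c] by (intro exI[of _ "\<lambda>t. c (- t)"]) auto
  qed
  from forward_solution[OF lip' e this z]
  obtain d where d: "d 0 = z" "solves (\<lambda>x. - X x) U {-e<..} d" by blast
  define d' where "d' t = d (- t)" for t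
  have d': "solves X U {..<e} d'"
    using solves_reverse[OF d(2)] unfolding d'_def[abs_def] by simp
  have eq: "c t = d' t" if "- e < t" "t < e" for t
  proof (rule solution_unique[OF lip])
    show "solves X U {-e<..<e} c" "solves X U {-e<..<e} d'" using c d' by (auto intro: solves_subset)
    show "0 \<in> {-e<..<e}" using e by auto
  qed (use that c d in \<open>auto simp: d'_def\<close>)
  define f where "f t = (if t < e then d' t else c t)" for t
  have fc: "f t = c t" if "- e < t" for t using eq that by (auto simp: f_def)
  have "solves X U UNIV f"
    unfolding solves_def
  proof
    fix t
    show "f t \<in> U \<and> (f has_vector_derivative X (f t)) (at t)"
    proof (cases "t < e")
      case True
      then have "d' t \<in> U" "(d' has_vector_derivative X (d' t)) (at t)" using d' by (auto simp: solves_def)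
      then show ?thesis
        using True has_vector_derivative_transform_within_open[of d' _ t "{..<e}" f] by (auto simp: f_def)
    next
      case False
      then have t: "t \<in> {-e<..}" using e by auto
      then have "c t \<in> U" "(c has_vector_derivative X (c t)) (at t)" using c by (auto simp: solves_def)
      then show ?thesis
        using t fc has_vector_derivative_transform_within_open[of c _ t "{-e<..}" f] by force
    qed
  qed
  moreover have "f 0 = z" using fc[of 0] c e by simp
  ultimately show ?thesis by blast
qed

section \<open>The orbits of a contraction\<close>

locale hopf_contraction =
  fixes \<gamma> :: "complex ^ 'n \<Rightarrow> complex ^ 'n"
  assumes contraction: "contraction \<gamma>"
begin

abbreviation \<gamma>i where "\<gamma>i \<equiv> inv_into UNIV \<gamma>"

lemma Aut: "\<gamma> \<in> Aut0" using contraction by (simp add: contraction_def)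

lemma bij: "bij \<gamma>" and holo_\<gamma>: "holo_on UNIV \<gamma>" and holo_\<gamma>i: "holo_on UNIV \<gamma>i"
  and \<gamma>_0 [simp]: "\<gamma> 0 = 0"
  using Aut by (auto simp: Aut0_def)

lemma \<gamma>i_\<gamma> [simp]: "\<gamma>i (\<gamma> z) = z" and \<gamma>_\<gamma>i [simp]: "\<gamma> (\<gamma>i z) = z"
  using bij by (simp_all add: bij_is_inj bij_is_surj surj_f_inv_f)

lemma \<gamma>i_0 [simp]: "\<gamma>i 0 = 0"
  by (metis \<gamma>_0 \<gamma>i_\<gamma>)

lemma funpow_holo: "holo_on UNIV f \<Longrightarrow> holo_on UNIV (f ^^ k)"
proof (induction k)
  case 0
  then show ?case
    unfolding holo_on_def by (auto intro!: exI[of _ "\<lambda>x. x"] simp: id_def)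
next
  case (Suc k)
  then show ?case using holo_on_compose[of UNIV "f ^^ k" UNIV f] by (simp add: o_def)
qed

lemma funpow_cancel [simp]: "(\<gamma>i ^^ k) ((\<gamma> ^^ k) z) = z" "(\<gamma> ^^ k) ((\<gamma>i ^^ k) z) = z"
  by (induction k arbitrary: z) (simp_all add: funpow_swap1)

definition it :: "int \<Rightarrow> complex ^ 'n \<Rightarrow> complex ^ 'n" where
  "it k = (if 0 \<le> k then \<gamma> ^^ nat k else \<gamma>i ^^ nat (- k))"

lemma it_of_nat: "it (int k) = \<gamma> ^^ k" and it_uminus_of_nat: "it (- int k) = \<gamma>i ^^ k"
  by (auto simp: it_def)

lemma it_0 [simp]: "it 0 z = z" and it_1 [simp]: "it 1 = \<gamma>" and it_minus_1: "it (- 1) = \<gamma>i"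
  by (auto simp: it_def)

lemma it_at_0 [simp]: "it k 0 = 0"
proof -
  have "(\<gamma> ^^ m) 0 = 0" "(\<gamma>i ^^ m) 0 = 0" for m by (induction m) auto
  then show ?thesis by (simp add: it_def)
qed

lemma it_plus_1: "it (k + 1) z = \<gamma> (it k z)"
proof (cases "0 \<le> k")
  case True
  then show ?thesis by (simp add: it_def nat_add_distrib)
next
  case False
  then have "nat (- k) = Suc (nat (- (k + 1)))" by linarith
  with False show ?thesis by (auto simp: it_def) 
qed

lemma it_add: "it (k + l) z = it k (it l z)"
proof (induction k rule: int_induct[where k = 0])
  case (step1 i)
  then show ?case using it_plus_1[of "i + l"] it_plus_1[of i] by (simp add: algebra_simps)
next
  case (step2 i)
  have "\<gamma> (it (i - 1 + l) z) = it (i + l) z" "\<gamma> (it (i - 1) (it l z)) = it i (it l z)"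
    using it_plus_1[of "i - 1 + l" z] it_plus_1[of "i - 1" "it l z"] by simp_all
  then have "\<gamma> (it (i - 1 + l) z) = \<gamma> (it (i - 1) (it l z))" using step2 by simp
  then show ?case by (metis \<gamma>i_\<gamma>)
qed simp

lemma it_cancel [simp]: "it (- k) (it k z) = z" "it k (it (- k) z) = z"
  using it_add[of "- k" k z] it_add[of k "- k" z] by simp_all

lemma it_eq_0_iff [simp]: "it k z = 0 \<longleftrightarrow> z = 0"
  by (metis it_at_0 it_cancel(1))

lemma holo_it: "holo_on UNIV (it k)"
  by (simp add: it_def funpow_holo holo_\<gamma> holo_\<gamma>i)

lemma cont_it: "continuous_on S (it k)"
  using holo_on_imp_continuous_on[OF holo_it] continuous_on_subset by blast

lemma hopf_class_it: "hopf_class \<gamma> z = range (\<lambda>k. it k z)"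
proof
  show "hopf_class \<gamma> z \<subseteq> range (\<lambda>k. it k z)"
    unfolding hopf_class_def
    using it_of_nat[THEN fun_cong, symmetric] it_uminus_of_nat[THEN fun_cong, symmetric] by auto
  show "range (\<lambda>k. it k z) \<subseteq> hopf_class \<gamma> z"
    unfolding hopf_class_def it_def by auto
qed

lemma hopf_class_self: "z \<in> hopf_class \<gamma> z"
  unfolding hopf_class_it by (rule image_eqI[of _ _ 0]) simp_all

lemma hopf_class_it_eq [simp]: "hopf_class \<gamma> (it k z) = hopf_class \<gamma> z"
  unfolding hopf_class_it
proof safe
  fix l show "it l (it k z) \<in> range (\<lambda>k. it k z)"
    unfolding it_add[symmetric] by blast
  show "it l z \<in> range (\<lambda>l. it l (it k z))"
    using it_add[of "l - k" k z] by (intro image_eqI[of _ _ "l - k"]) auto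
qed

lemma hopf_class_eq_iff: "hopf_class \<gamma> y = hopf_class \<gamma> z \<longleftrightarrow> (\<exists>k. y = it k z)"
proof
  assume "hopf_class \<gamma> y = hopf_class \<gamma> z"
  then have "y \<in> range (\<lambda>k. it k z)" using hopf_class_self[of y] by (simp add: hopf_class_it)
  then show "\<exists>k. y = it k z" by blast
qed auto

lemma hopf_class_in [simp]: "z \<noteq> 0 \<Longrightarrow> hopf_class \<gamma> z \<in> hopf \<gamma>"
  by (auto simp: hopf_def)

lemma hopf_cases:
  assumes "p \<in> hopf \<gamma>" obtains z where "z \<noteq> 0" "p = hopf_class \<gamma> z"
  using assms by (auto simp: hopf_def)

subsection \<open>A height function\<close>

lemma iterates_small:
  assumes "0 < e"
  shows "\<exists>N. \<forall>m\<ge>N. \<forall>z. norm z \<le> R \<longrightarrow> norm ((\<gamma> ^^ m) z) < e"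
proof -
  define K :: "(complex ^ 'n) set" where "K = cball 0 (max R 1)"
  have "compact K" "0 \<in> interior K" by (auto simp: K_def)
  then have "uniform_limit K (\<lambda>m z. (\<gamma> ^^ m) z) (\<lambda>z. 0) sequentially"
    using contraction by (auto simp: contraction_def)
  then have "\<forall>\<^sub>F m in sequentially. \<forall>z\<in>K. dist ((\<gamma> ^^ m) z) 0 < e"
    using assms by (simp add: uniform_limit_iff)
  then obtain N where "\<And>m z. N \<le> m \<Longrightarrow> z \<in> K \<Longrightarrow> norm ((\<gamma> ^^ m) z) < e"
    unfolding eventually_sequentially by auto
  then show ?thesis by (intro exI[of _ N]) (simp add: K_def)
qed

text \<open>
  A cut-off function: \<open>0\<close> on the unit ball and \<open>1\<close> outside the ball of radius \<open>2\<close>.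
\<close>

definition bump :: "complex ^ 'n \<Rightarrow> real" where
  "bump z = max 0 (min 1 (norm z - 1))"

lemma bump_bounds: "0 \<le> bump z" "bump z \<le> 1"
  and bump_0: "norm z \<le> 1 \<Longrightarrow> bump z = 0" and bump_1: "2 \<le> norm z \<Longrightarrow> bump z = 1"
  by (auto simp: bump_def)

lemma cont_bump: "continuous_on S bump"
  unfolding bump_def by (intro continuous_intros)

text \<open>
  The height counts how many backward iterates of \<open>z\<close> lie in the unit ball, minus how many
  forward iterates lie outside, with continuous weights.
\<close>

definition height :: "complex ^ 'n \<Rightarrow> real" where
  "height z = (\<Sum>m. 1 - bump ((\<gamma>i ^^ Suc m) z)) - (\<Sum>m. bump ((\<gamma> ^^ m) z))"

lemma backward_weights_finite:
  assumes "0 < d"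
  shows "\<exists>N. \<forall>m\<ge>N. \<forall>z. d \<le> norm z \<longrightarrow> 1 - bump ((\<gamma>i ^^ Suc m) z) = 0"
proof -
  obtain N where N: "\<And>m z. N \<le> m \<Longrightarrow> norm z \<le> 2 \<Longrightarrow> norm ((\<gamma> ^^ m) z) < d"
    using iterates_small[OF assms, of 2] by blast
  have "1 - bump ((\<gamma>i ^^ Suc m) z) = 0" if "N \<le> m" "d \<le> norm z" for m z
  proof -
    have "\<not> norm ((\<gamma>i ^^ Suc m) z) \<le> 2"
    proof
      assume "norm ((\<gamma>i ^^ Suc m) z) \<le> 2"
      from N[OF _ this, of "Suc m"] that have "norm z < d" by (simp del: funpow.simps)
      with that show False by simp
    qed
    then show ?thesis by (simp add: bump_1)
  qed
  then show ?thesis by blast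
qed

lemma forward_weights_finite: "\<exists>N. \<forall>m\<ge>N. \<forall>z. norm z \<le> R \<longrightarrow> bump ((\<gamma> ^^ m) z) = 0"
  using iterates_small[of 1 R] bump_0 by (meson less_imp_le zero_less_one)

text \<open>
  On a compact part of the punctured space all but finitely many weights vanish, uniformly in
  the point. This gives the continuity of the height.
\<close>

lemma height_finite:
  assumes "0 < d"
  shows "\<exists>N. \<forall>z. d \<le> norm z \<and> norm z \<le> R \<longrightarrow>
    height z = (\<Sum>m<N. 1 - bump ((\<gamma>i ^^ Suc m) z)) - (\<Sum>m<N. bump ((\<gamma> ^^ m) z)) \<and>
    summable (\<lambda>m. 1 - bump ((\<gamma>i ^^ Suc m) z)) \<and> summable (\<lambda>m. bump ((\<gamma> ^^ m) z))"
proof -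
  obtain N1 where N1: "\<And>m z. N1 \<le> m \<Longrightarrow> d \<le> norm z \<Longrightarrow> 1 - bump ((\<gamma>i ^^ Suc m) z) = 0"
    using backward_weights_finite[OF assms] by blast
  obtain N2 where N2: "\<And>m z. N2 \<le> m \<Longrightarrow> norm z \<le> R \<Longrightarrow> bump ((\<gamma> ^^ m) z) = 0"
    using forward_weights_finite by blast
  define N where "N = max N1 N2"
  have "height z = (\<Sum>m<N. 1 - bump ((\<gamma>i ^^ Suc m) z)) - (\<Sum>m<N. bump ((\<gamma> ^^ m) z)) \<and>
    summable (\<lambda>m. 1 - bump ((\<gamma>i ^^ Suc m) z)) \<and> summable (\<lambda>m. bump ((\<gamma> ^^ m) z))"
    if z: "d \<le> norm z" "norm z \<le> R" for z
  proof (intro conjI)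
    have 1: "\<And>m. m \<notin> {..<N} \<Longrightarrow> 1 - bump ((\<gamma>i ^^ Suc m) z) = 0"
      using N1 z by (auto simp: N_def simp del: funpow.simps)
    have 2: "\<And>m. m \<notin> {..<N} \<Longrightarrow> bump ((\<gamma> ^^ m) z) = 0"
      using N2 z by (auto simp: N_def)
    show "summable (\<lambda>m. 1 - bump ((\<gamma>i ^^ Suc m) z))" "summable (\<lambda>m. bump ((\<gamma> ^^ m) z))"
      by ((rule summable_finite[OF finite_lessThan 1] summable_finite[OF finite_lessThan 2], assumption)+)
    show "height z = (\<Sum>m<N. 1 - bump ((\<gamma>i ^^ Suc m) z)) - (\<Sum>m<N. bump ((\<gamma> ^^ m) z))"
      unfolding height_def
      by (intro arg_cong2[of _ _ _ _ minus]; intro suminf_finite finite_lessThan; erule 1 2)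
  qed
  then show ?thesis by blast
qed

lemma summable_weights:
  assumes "z \<noteq> 0"
  shows "summable (\<lambda>m. 1 - bump ((\<gamma>i ^^ Suc m) z))" "summable (\<lambda>m. bump ((\<gamma> ^^ m) z))"
  using height_finite[of "norm z" "norm z"] assms by auto

lemma cont_height: "continuous_on (- {0}) height"
proof (rule continuous_at_imp_continuous_on, rule ballI)
  fix z0 :: "complex ^ 'n" assume "z0 \<in> - {0}"
  define S where "S = {z :: complex ^ 'n. norm z0 / 2 < norm z \<and> norm z < norm z0 + 1}"
  have S: "open S" "z0 \<in> S"
    unfolding S_def using \<open>z0 \<in> - {0}\<close> by (auto intro!: open_Collect_conj open_Collect_less continuous_intros)
  obtain N where N: "\<And>z. norm z0 / 2 \<le> norm z \<Longrightarrow> norm z \<le> norm z0 + 1 \<Longrightarrow>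
      height z = (\<Sum>m<N. 1 - bump ((\<gamma>i ^^ Suc m) z)) - (\<Sum>m<N. bump ((\<gamma> ^^ m) z))"
    using height_finite[of "norm z0 / 2" "norm z0 + 1"] \<open>z0 \<in> - {0}\<close> by auto
  have "continuous_on S (\<gamma>i ^^ m)" "continuous_on S (\<gamma> ^^ m)" for m
    using cont_it[of S "int m"] cont_it[of S "- int m"] by (simp_all add: it_of_nat it_uminus_of_nat)
  then have "continuous_on S (\<lambda>z. (\<Sum>m<N. 1 - bump ((\<gamma>i ^^ Suc m) z)) - (\<Sum>m<N. bump ((\<gamma> ^^ m) z)))"
    by (intro continuous_intros continuous_on_compose2[OF cont_bump[of UNIV]]) (auto simp del: funpow.simps)
  then have "continuous_on S height"
    by (rule continuous_on_eq) (use N in \<open>auto simp: S_def\<close>)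
  then show "isCont height z0" using S continuous_on_eq_continuous_at by blast
qed

lemma height_\<gamma>:
  assumes "z \<noteq> 0"
  shows "height (\<gamma> z) = height z + 1"
proof -
  have gz: "\<gamma> z \<noteq> 0" using assms it_eq_0_iff[of 1 z] by simp
  have "(\<Sum>m. 1 - bump ((\<gamma>i ^^ Suc m) (\<gamma> z))) = (\<Sum>m. 1 - bump ((\<gamma>i ^^ Suc m) z)) + (1 - bump z)"
    using suminf_split_head[OF summable_weights(1)[OF gz]] by (simp add: funpow_swap1)
  moreover have "(\<Sum>m. bump ((\<gamma> ^^ m) (\<gamma> z))) = (\<Sum>m. bump ((\<gamma> ^^ m) z)) - bump z"
    using suminf_split_head[OF summable_weights(2)[OF assms]] by (simp add: funpow_swap1)
  ultimately show ?thesis by (simp add: height_def)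
qed

lemma height_it: "z \<noteq> 0 \<Longrightarrow> height (it k z) = height z + of_int k"
proof (induction k rule: int_induct[where k = 0])
  case (step1 i)
  then show ?case using height_\<gamma>[of "it i z"] by (simp add: it_plus_1)
next
  case (step2 i)
  then show ?case using height_\<gamma>[of "it (i - 1) z"] it_plus_1[of "i - 1" z] by simp
qed simp

text \<open>
  Uniform convergence controls all late iterates, continuity at the origin the finitely many
  early ones.
\<close>

lemma iterates_stay:
  assumes "0 < e"
  shows "\<exists>d>0. \<forall>m. \<forall>z. norm z < d \<longrightarrow> norm ((\<gamma> ^^ m) z) < e"
proof -
  obtain N where N: "\<And>m z. N \<le> m \<Longrightarrow> norm z \<le> 1 \<Longrightarrow> norm ((\<gamma> ^^ m) z) < e"
    using iterates_small[OF assms, of 1] by blast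
  have init: "\<exists>d>0. \<forall>m<n. \<forall>z. norm z < d \<longrightarrow> norm ((\<gamma> ^^ m) z) < e" for n
  proof (induction n)
    case (Suc n)
    then obtain d where d: "0 < d" "\<And>m z. m < n \<Longrightarrow> norm z < d \<Longrightarrow> norm ((\<gamma> ^^ m) z) < e" by blast
    have "continuous (at 0) (it (int n))" using cont_it[of UNIV] continuous_on_eq_continuous_at by blast
    then obtain d' where d': "0 < d'" "\<And>z. norm z < d' \<Longrightarrow> norm (it (int n) z) < e"
      using assms unfolding continuous_at_eps_delta by (auto simp: dist_norm)
    have "norm ((\<gamma> ^^ m) z) < e" if "m < Suc n" "norm z < min d d'" for m z
      using that d d' by (cases "m = n") (auto simp: it_of_nat)
    then show ?case using d(1) d'(1) by (intro exI[of _ "min d d'"]) auto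
  qed (auto intro: exI[of _ 1])
  from init[of N] obtain d where d: "0 < d" "\<And>m z. m < N \<Longrightarrow> norm z < d \<Longrightarrow> norm ((\<gamma> ^^ m) z) < e"
    by metis
  have "norm ((\<gamma> ^^ m) z) < e" if "norm z < min d 1" for m z
  proof (cases "m < N")
    case True
    show ?thesis by (rule d(2)[OF True]) (use that in simp)
  next
    case False
    show ?thesis by (rule N) (use that False in simp_all)
  qed
  then show ?thesis using d(1) by (intro exI[of _ "min d 1"]) auto
qed

text \<open>
  Near the origin all forward iterates stay in the unit ball, while the first \<open>N\<close> backward
  iterates are still inside as well and contribute one each.
\<close>

lemma height_near_0: "\<exists>d>0. \<forall>z. z \<noteq> 0 \<and> norm z < d \<longrightarrow> c < height z"
proof -
  obtain d1 where d1: "0 < d1" "\<And>m z. norm z < d1 \<Longrightarrow> norm ((\<gamma> ^^ m) z) < 1"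
    using iterates_stay[of 1] by auto
  obtain N where N: "c < real N" using reals_Archimedean2 by blast
  define d2 where "d2 k = (SOME d. 0 < d \<and> (\<forall>z. norm z < d \<longrightarrow> norm (it (- int k) z) < 1))" for k
  have d2: "0 < d2 k \<and> (\<forall>z. norm z < d2 k \<longrightarrow> norm (it (- int k) z) < 1)" for k
  proof -
    have "continuous (at 0) (it (- int k))" using cont_it[of UNIV] continuous_on_eq_continuous_at by blast
    then have "\<exists>d>0. \<forall>z. norm z < d \<longrightarrow> norm (it (- int k) z) < 1"
      unfolding continuous_at_eps_delta by (auto simp: dist_norm dest: spec[of _ 1])
    then show ?thesis unfolding d2_def by (rule someI_ex)
  qed
  define d where "d = Min (insert d1 (d2 ` {..N}))"
  have d: "0 < d" "d \<le> d1" "\<And>k. k \<le> N \<Longrightarrow> d \<le> d2 k"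
    unfolding d_def using d1(1) d2 by (auto simp: Min_gr_iff simp del: Min_insert intro!: Min_le)
  have "c < height z" if z: "z \<noteq> 0" "norm z < d" for z
  proof -
    have "(\<lambda>m. bump ((\<gamma> ^^ m) z)) = (\<lambda>m. 0)"
      using d1(2)[of z] z d bump_0 by (auto simp: less_imp_le)
    then have "height z = (\<Sum>m. 1 - bump ((\<gamma>i ^^ Suc m) z))" by (simp add: height_def)
    also have "\<dots> \<ge> (\<Sum>m<N. 1 - bump ((\<gamma>i ^^ Suc m) z))"
      using bump_bounds summable_weights(1)[OF z(1)] by (intro sum_le_suminf) auto
    also (xtrans) have "(\<Sum>m<N. 1 - bump ((\<gamma>i ^^ Suc m) z)) = (\<Sum>m<N. 1)"
    proof (rule sum.cong[OF refl])
      fix m assume "m \<in> {..<N}"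
      then have "norm z < d2 (Suc m)" using z d(3)[of "Suc m"] by simp
      then have "norm ((\<gamma>i ^^ Suc m) z) < 1" using d2[of "Suc m"] it_uminus_of_nat[of "Suc m"] by metis
      then show "1 - bump ((\<gamma>i ^^ Suc m) z) = 1" by (simp only: bump_0 less_imp_le)
    qed
    finally show ?thesis using N by simp
  qed
  then show ?thesis using d(1) by blast
qed

text \<open>
  Far from the origin all backward iterates and the first \<open>N\<close> forward iterates lie outside the
  ball of radius \<open>2\<close>, so that the height is at most \<open>- N\<close>.
\<close>

lemma height_bounded: "\<exists>R>0. \<forall>z. z \<noteq> 0 \<and> c \<le> height z \<longrightarrow> norm z \<le> R"
proof -
  obtain N where N: "- c < real N" using reals_Archimedean2 by blast
  have ball: "\<exists>R. \<forall>z. norm (it l z) \<le> 2 \<longrightarrow> norm z \<le> R" for l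
  proof -
    have "bounded (it (- l) ` cball 0 2)"
      by (intro compact_imp_bounded compact_continuous_image cont_it compact_cball)
    then obtain R where R: "\<And>y. norm y \<le> 2 \<Longrightarrow> norm (it (- l) y) \<le> R"
      unfolding bounded_iff by (force simp: image_iff)
    have "norm z \<le> R" if "norm (it l z) \<le> 2" for z using R[OF that] by simp
    then show ?thesis by blast
  qed
  then obtain R where R: "\<And>l z. norm (it l z) \<le> 2 \<Longrightarrow> norm z \<le> R l" by metis
  obtain M where M: "\<And>m z. M \<le> m \<Longrightarrow> norm z \<le> 2 \<Longrightarrow> norm ((\<gamma> ^^ m) z) < 1"
    using iterates_small[of 1 2] by auto
  define B where "B = Max (insert 1 (R ` ({- int M..int N})))"
  have B: "1 \<le> B" "\<And>l. - int M \<le> l \<Longrightarrow> l \<le> int N \<Longrightarrow> R l \<le> B"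
    unfolding B_def by (auto intro!: Max_ge simp del: Max_insert)
  have "height z < c" if z: "B < norm z" for z
  proof -
    have out: "2 < norm (it l z)" if "l \<le> int N" for l
    proof (cases "- int M \<le> l")
      case True
      then show ?thesis using R[of l z] B(2)[of l] that z by force
    next
      case False
      show ?thesis
      proof (rule ccontr)
        assume "\<not> 2 < norm (it l z)"
        then have "norm ((\<gamma> ^^ nat (- l)) (it l z)) < 1" using False by (intro M) auto
        then have "norm (it (- l) (it l z)) < 1" using False by (simp add: it_def)
        then show False using z B(1) by simp
      qed
    qed
    have z0: "z \<noteq> 0" using z B(1) by auto
    have "bump ((\<gamma>i ^^ Suc m) z) = 1" for m
      using out[of "- int (Suc m)"] by (simp only: it_uminus_of_nat bump_1 less_imp_le)
    then have "height z = - (\<Sum>m. bump ((\<gamma> ^^ m) z))" by (simp add: height_def del: funpow.simps)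
    moreover have "(\<Sum>m<N. bump ((\<gamma> ^^ m) z)) \<le> (\<Sum>m. bump ((\<gamma> ^^ m) z))"
      using bump_bounds summable_weights(2)[OF z0] by (intro sum_le_suminf) auto
    moreover have "(\<Sum>m<N. bump ((\<gamma> ^^ m) z)) = (\<Sum>m<N. 1)"
    proof (rule sum.cong[OF refl])
      fix m assume "m \<in> {..<N}"
      then show "bump ((\<gamma> ^^ m) z) = 1" using out[of "int m"] by (simp add: it_of_nat bump_1)
    qed
    ultimately show ?thesis using N by simp
  qed
  with B(1) show ?thesis
    by (intro exI[of _ B] conjI allI impI) (linarith, meson linorder_not_less)
qed

lemma compact_height: "compact {z. z \<noteq> 0 \<and> a \<le> height z \<and> height z \<le> b}"
proof -
  obtain d where d: "0 < d" "\<And>z. z \<noteq> 0 \<Longrightarrow> norm z < d \<Longrightarrow> b < height z"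
    using height_near_0 by blast
  obtain R where R: "\<And>z. z \<noteq> 0 \<Longrightarrow> a \<le> height z \<Longrightarrow> norm z \<le> R"
    using height_bounded by blast
  have eq: "{z. z \<noteq> 0 \<and> a \<le> height z \<and> height z \<le> b} =
      (cball 0 R \<inter> {z. d \<le> norm z}) \<inter> height -` {a..b}"
    using d R by force
  have K: "compact (cball 0 R \<inter> {z :: complex ^ 'n. d \<le> norm z})"
    by (intro compact_Int_closed compact_cball closed_Collect_le continuous_intros)
  have "continuous_on (cball 0 R \<inter> {z. d \<le> norm z}) height"
    using d(1) by (intro continuous_on_subset[OF cont_height]) auto
  from continuous_closed_preimage[OF this compact_imp_closed[OF K], of "{a..b}"]
  have "closed ((cball 0 R \<inter> {z. d \<le> norm z}) \<inter> height -` {a..b})" by simp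
  from compact_Int_closed[OF K this] show ?thesis unfolding eq by (simp add: Int_absorb1 Int_ac)
qed

lemma normalize_height:
  assumes "z \<noteq> 0"
  obtains k where "0 \<le> height (it k z)" "height (it k z) < 1"
proof
  show "0 \<le> height (it (- \<lfloor>height z\<rfloor>) z)" "height (it (- \<lfloor>height z\<rfloor>) z) < 1"
    using height_it[OF assms, of "- \<lfloor>height z\<rfloor>"] by (simp_all add: algebra_simps) linarith+
qed

end

section \<open>Flows of invariant vector fields\<close>

lemma holo_locally_lipschitz:
  fixes X :: "complex ^ 'n \<Rightarrow> complex ^ 'n"
  assumes U: "open U" "holo_on U X"
  shows "locally_lipschitz X U"
  unfolding locally_lipschitz_def
proof
  fix z assume "z \<in> U"
  then obtain r where r: "0 < r" "cball z (2 * r) \<subseteq> U"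
  proof -
    obtain r' where "0 < r'" "cball z r' \<subseteq> U" using \<open>z \<in> U\<close> U open_contains_cball by blast
    then show thesis by (intro that[of "r' / 2"]) auto
  qed
  have "bounded (X ` cball z (2 * r))"
    using r holo_on_imp_continuous_on[OF U(2)]
    by (intro compact_imp_bounded compact_continuous_image) (auto intro: continuous_on_subset)
  then obtain M where "\<And>y. y \<in> cball z (2 * r) \<Longrightarrow> norm (X y) \<le> M" unfolding bounded_iff by blast
  from holo_lipschitz[OF U r this]
  have "\<forall>x\<in>cball z r. \<forall>y\<in>cball z r. norm (X x - X y) \<le> real CARD('n) * (M / r) * norm (x - y)" by blast
  moreover have "cball z r \<subseteq> U" using r by (auto simp: subset_iff)
  ultimately show "\<exists>r>0. \<exists>L. cball z r \<subseteq> U \<and> (\<forall>x\<in>cball z r. \<forall>y\<in>cball z r. norm (X x - X y) \<le> L * norm (x - y))"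
    using r(1) by blast
qed

lemma frechet_compose:
  assumes "holo_on U f" "holo_on V g" "z \<in> U" "f z \<in> V"
  shows "frechet_derivative (\<lambda>x. g (f x)) (at z) v = frechet_derivative g (at (f z)) (frechet_derivative f (at z) v)"
  using has_derivative_compose[OF holo_on_frechet(1)[OF assms(1,3)] holo_on_frechet(1)[OF assms(2,4)]]
    frechet_derivative_at by metis

definition flow :: "(complex ^ 'n \<Rightarrow> complex ^ 'n) \<Rightarrow> real \<Rightarrow> complex ^ 'n \<Rightarrow> complex ^ 'n" where
  "flow X t z = (SOME c. c 0 = z \<and> solves X (- {0}) UNIV c) t"

lemma integral_curve_iff: "integral_curve X c \<longleftrightarrow> solves X (- {0}) UNIV c"
  by (auto simp: integral_curve_def solves_def)

lemma scale_vf_scale: "scale_vf a (scale_vf b X) = scale_vf (a * b) X"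
  by (simp add: scale_vf_def vector_smult_assoc)

lemma scale_vf_1 [simp]: "scale_vf 1 X = X"
  by (simp add: scale_vf_def)

context hopf_contraction
begin

lemma vf_holo: "X \<in> hopf_vf \<gamma> \<Longrightarrow> holo_on (- {0}) X"
  and vf_0: "X \<in> hopf_vf \<gamma> \<Longrightarrow> X 0 = 0"
  and vf_\<gamma>: "X \<in> hopf_vf \<gamma> \<Longrightarrow> z \<noteq> 0 \<Longrightarrow> X (\<gamma> z) = frechet_derivative \<gamma> (at z) (X z)"
  by (auto simp: hopf_vf_def Compl_eq_Diff_UNIV)

lemma scale_vf_in:
  assumes X: "X \<in> hopf_vf \<gamma>"
  shows "scale_vf a X \<in> hopf_vf \<gamma>"
proof -
  have "holo_on (UNIV - {0}) (scale_vf a X)"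
    unfolding holo_on_def
  proof
    fix z :: "complex ^ 'n" assume "z \<in> UNIV - {0}"
    then have z: "z \<in> - {0}" by auto
    note D = holo_on_frechet[OF vf_holo[OF X] z]
    have "((\<lambda>z. a *s X z) has_derivative (\<lambda>h. a *s frechet_derivative X (at z) h)) (at z)"
      by (rule bounded_linear.has_derivative[OF smult.bounded_linear_right D(1)])
    then show "\<exists>D. (scale_vf a X has_derivative D) (at z) \<and> (\<forall>c v. D (c *s v) = c *s D v)"
      unfolding scale_vf_def by (intro exI conjI) (auto simp: D(2) vector_smult_assoc mult.commute)
  qed
  then show ?thesis
    using vf_0[OF X] vf_\<gamma>[OF X] by (auto simp: hopf_vf_def scale_vf_def holo_on_frechet(2)[OF holo_\<gamma>])
qed

lemma zero_vf: "(\<lambda>z. 0) \<in> hopf_vf \<gamma>"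
proof -
  have "linear (frechet_derivative \<gamma> (at z))" for z
    using holo_on_frechet(1)[OF holo_\<gamma>, of z] by (simp add: bounded_linear.linear has_derivative_bounded_linear)
  then show ?thesis
    unfolding hopf_vf_def holo_on_def by (auto intro!: exI[of _ "\<lambda>v. 0"] simp: linear_0)
qed

lemma vf_it:
  assumes X: "X \<in> hopf_vf \<gamma>" and z: "z \<noteq> 0"
  shows "X (it k z) = frechet_derivative (it k) (at z) (X z)"
proof (induction k rule: int_induct[where k = 0])
  case base
  have "it 0 = (\<lambda>z. z)" by (simp add: fun_eq_iff)
  then show ?case by simp
next
  case (step1 i)
  have "frechet_derivative (it (i + 1)) (at z) (X z) =
      frechet_derivative \<gamma> (at (it i z)) (frechet_derivative (it i) (at z) (X z))"
    using frechet_compose[OF holo_it holo_\<gamma>, of z i "X z"] by (simp add: it_plus_1[abs_def])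
  moreover have "X (it (i + 1) z) = frechet_derivative \<gamma> (at (it i z)) (X (it i z))"
    using vf_\<gamma>[OF X, of "it i z"] z by (simp add: it_plus_1)
  ultimately show ?case using step1 by (simp only:)
next
  case (step2 i)
  let ?y = "it (i - 1) z"
  have y: "\<gamma> ?y = it i z" using it_plus_1[of "i - 1" z] by simp
  have "it i = (\<lambda>z. \<gamma> (it (i - 1) z))" using it_plus_1[of "i - 1"] by (simp add: fun_eq_iff)
  then have "frechet_derivative (it i) (at z) (X z) =
      frechet_derivative \<gamma> (at ?y) (frechet_derivative (it (i - 1)) (at z) (X z))"
    using frechet_compose[OF holo_it holo_\<gamma>, of z "i - 1" "X z"] by simp
  moreover have "X (it i z) = frechet_derivative \<gamma> (at ?y) (X ?y)"
    using vf_\<gamma>[OF X, of ?y] z y by simp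
  ultimately have eq: "frechet_derivative \<gamma> (at ?y) (X ?y) =
      frechet_derivative \<gamma> (at ?y) (frechet_derivative (it (i - 1)) (at z) (X z))"
    using step2 by simp
  have "frechet_derivative \<gamma>i (at (\<gamma> ?y)) (frechet_derivative \<gamma> (at ?y) v) = v" for v
    using frechet_compose[OF holo_\<gamma> holo_\<gamma>i, of ?y v] by simp
  then show ?case using eq by metis
qed

lemma it_solves:
  assumes X: "X \<in> hopf_vf \<gamma>" and c: "solves X (- {0}) I c"
  shows "solves X (- {0}) I (\<lambda>t. it k (c t))"
  unfolding solves_def
proof (intro ballI conjI)
  fix t assume "t \<in> I"
  then have ct: "c t \<noteq> 0" "(c has_vector_derivative X (c t)) (at t)" using c by (auto simp: solves_def)
  show "it k (c t) \<in> - {0}" using ct by simp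
  have D: "(it k has_derivative frechet_derivative (it k) (at (c t))) (at (c t))"
    by (rule holo_on_frechet[OF holo_it]) simp
  have "((\<lambda>t. it k (c t)) has_derivative (\<lambda>h. frechet_derivative (it k) (at (c t)) (h *\<^sub>R X (c t)))) (at t)"
    using has_derivative_compose[of c "\<lambda>h. h *\<^sub>R X (c t)" t UNIV "it k", OF _ D] ct(2)
    by (simp add: has_vector_derivative_def)
  moreover have "frechet_derivative (it k) (at (c t)) (h *\<^sub>R X (c t)) = h *\<^sub>R X (it k (c t))" for h
    using vf_it[OF X ct(1)] by (simp add: scaleR_smult holo_on_frechet(2)[OF holo_it])
  ultimately show "((\<lambda>t. it k (c t)) has_vector_derivative X (it k (c t))) (at t)"
    by (simp add: has_vector_derivative_def)
qed

lemma vf_lipschitz: "X \<in> hopf_vf \<gamma> \<Longrightarrow> locally_lipschitz X (- {0})"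
  by (intro holo_locally_lipschitz vf_holo) auto

text \<open>
  A compact set of representatives: it contains a point of every orbit in the punctured space.
\<close>

definition shell :: "(complex ^ 'n) set" where
  "shell = {z. z \<noteq> 0 \<and> 0 \<le> height z \<and> height z \<le> 1}"

lemma compact_shell: "compact shell"
  unfolding shell_def by (rule compact_height)

lemma shell_cases:
  assumes "z \<noteq> 0" obtains k where "it k z \<in> shell"
  using normalize_height[OF assms] assms by (metis (mono_tags, lifting) it_eq_0_iff less_imp_le mem_Collect_eq shell_def)

text \<open>
  Uniform constants on the compact fundamental domain; by invariance under \<open>\<gamma>\<close> they control
  the field everywhere.
\<close>

lemma vf_uniform:
  assumes X: "X \<in> hopf_vf \<gamma>"
  obtains r M L where "0 < r" "0 \<le> M" "0 \<le> L"
    "\<And>z. z \<in> shell \<Longrightarrow> cball z r \<subseteq> - {0}"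
    "\<And>z x. z \<in> shell \<Longrightarrow> x \<in> cball z r \<Longrightarrow> norm (X x) \<le> M"
    "\<And>z x y. z \<in> shell \<Longrightarrow> x \<in> cball z r \<Longrightarrow> y \<in> cball z r \<Longrightarrow> norm (X x - X y) \<le> L * norm (x - y)"
    "\<And>z x. z \<in> shell \<Longrightarrow> x \<in> cball z r \<Longrightarrow> \<bar>height x - height z\<bar> \<le> 1"
proof -
  have "open (- {0 :: complex ^ 'n})" by auto
  moreover have "shell \<subseteq> - {0}" by (auto simp: shell_def)
  ultimately obtain e where e: "0 < e" "(\<Union>x\<in>shell. cball x e) \<subseteq> - {0}"
    using compact_subset_open_imp_cball_epsilon_subset[OF compact_shell] by metis
  define K where "K = {x + y | x y. x \<in> shell \<and> y \<in> cball (0 :: complex ^ 'n) e}"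
  have K: "compact K" unfolding K_def by (intro compact_sums compact_shell compact_cball)
  have sub: "cball z e \<subseteq> K" if "z \<in> shell" for z
  proof
    fix x assume "x \<in> cball z e"
    then have "x = z + (x - z)" "x - z \<in> cball 0 e" by (auto simp: dist_norm norm_minus_commute)
    with that show "x \<in> K" unfolding K_def by blast
  qed
  have K0: "K \<subseteq> - {0}"
  proof
    fix x assume "x \<in> K"
    then obtain z y where "x = z + y" "z \<in> shell" "y \<in> cball 0 e" by (auto simp: K_def)
    then have "x \<in> cball z e" by (simp add: dist_norm)
    with e(2) \<open>z \<in> shell\<close> show "x \<in> - {0}" by blast
  qed
  have "continuous_on K X" using holo_on_imp_continuous_on[OF vf_holo[OF X]] K0 continuous_on_subset by blast
  then have "bounded (X ` K)" by (intro compact_imp_bounded compact_continuous_image K)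
  then obtain M where M: "0 < M" "\<And>x. x \<in> K \<Longrightarrow> norm (X x) \<le> M" unfolding bounded_pos by blast
  have "uniformly_continuous_on K height"
    using cont_height K0 K by (intro compact_uniformly_continuous) (auto intro: continuous_on_subset)
  then obtain d where d: "0 < d" "\<And>x y. x \<in> K \<Longrightarrow> y \<in> K \<Longrightarrow> dist y x < d \<Longrightarrow> dist (height y) (height x) < 1"
    unfolding uniformly_continuous_on_def by (metis zero_less_one)
  define r where "r = min (e / 2) (d / 2)"
  have r: "0 < r" "r \<le> e / 2" "r < d" using e d by (auto simp: r_def)
  show thesis
  proof
    show "0 < r" "0 \<le> M" using r M by auto
    show "0 \<le> real CARD('n) * (M / (e / 2))" using M e by simp
    fix z assume z: "z \<in> shell"
    have re: "cball z r \<subseteq> cball z e" using r e by auto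
    show "cball z r \<subseteq> - {0}" using re e z by blast
    have zK: "z \<in> K" using sub[OF z] e by auto
    show "norm (X x) \<le> M" if "x \<in> cball z r" for x using that re sub[OF z] M by blast
    show "\<bar>height x - height z\<bar> \<le> 1" if "x \<in> cball z r" for x
    proof -
      have "x \<in> K" "dist x z < d" using that re sub[OF z] r by (auto simp: dist_commute)
      from d(2)[OF zK this] show ?thesis by (simp add: dist_real_def)
    qed
    show "norm (X x - X y) \<le> real CARD('n) * (M / (e / 2)) * norm (x - y)" if "x \<in> cball z r" "y \<in> cball z r" for x y
    proof (rule holo_lipschitz[OF _ vf_holo[OF X], where z = z])
      have "cball z (2 * (e / 2)) \<subseteq> K" using sub[OF z] by simp
      then show "cball z (2 * (e / 2)) \<subseteq> - {0}" "\<And>y. y \<in> cball z (2 * (e / 2)) \<Longrightarrow> norm (X y) \<le> M"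
        using K0 M by blast+
    qed (use that r e in auto)
  qed
qed

lemma vf_short_solutions:
  assumes X: "X \<in> hopf_vf \<gamma>"
  obtains r L e where "0 < r" "0 \<le> L" "0 < e"
    "\<And>z. z \<in> shell \<Longrightarrow> cball z r \<subseteq> - {0}"
    "\<And>z x y. z \<in> shell \<Longrightarrow> x \<in> cball z r \<Longrightarrow> y \<in> cball z r \<Longrightarrow> norm (X x - X y) \<le> L * norm (x - y)"
    "\<And>z x. z \<in> shell \<Longrightarrow> x \<in> cball z r \<Longrightarrow> \<bar>height x - height z\<bar> \<le> 1"
    "\<And>z y. z \<in> shell \<Longrightarrow> y \<in> cball z (r / 2) \<Longrightarrow> \<exists>c. c 0 = y \<and> solves X (cball z r) {-e<..<e} c"
proof -
  obtain r M L where r: "0 < r" "0 \<le> M" "0 \<le> L"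
    "\<And>z. z \<in> shell \<Longrightarrow> cball z r \<subseteq> - {0}"
    "\<And>z x. z \<in> shell \<Longrightarrow> x \<in> cball z r \<Longrightarrow> norm (X x) \<le> M"
    "\<And>z x y. z \<in> shell \<Longrightarrow> x \<in> cball z r \<Longrightarrow> y \<in> cball z r \<Longrightarrow> norm (X x - X y) \<le> L * norm (x - y)"
    "\<And>z x. z \<in> shell \<Longrightarrow> x \<in> cball z r \<Longrightarrow> \<bar>height x - height z\<bar> \<le> 1"
    using vf_uniform[OF X] by blast
  define e where "e = min (r / (2 * (M + 1))) (1 / (L + 1))"
  have e: "0 < e" using r by (auto simp: e_def)
  have "M * e \<le> (M + 1) * (r / (2 * (M + 1)))"
    using r e by (intro mult_mono) (auto simp: e_def)
  also have "\<dots> = r / 2" using r(2) by (simp add: field_simps add_nonneg_eq_0_iff)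
  finally have Me: "M * e \<le> r / 2" .
  have "L * e \<le> L * (1 / (L + 1))" using r by (intro mult_left_mono) (auto simp: e_def)
  also have "\<dots> < 1" using r by (simp add: field_simps)
  finally have Le: "L * e < 1" .
  have "\<exists>c. c 0 = y \<and> solves X (cball z r) {-e<..<e} c" if z: "z \<in> shell" and y: "y \<in> cball z (r / 2)" for z y
  proof -
    have sub: "cball y (r / 2) \<subseteq> cball z r"
      using y by (simp add: cball_subset_cball_iff dist_commute)
    have "\<exists>c. c 0 = y \<and> solves X (cball y (r / 2)) {-e<..<e} c"
    proof (rule local_solution[where M = M and L = L])
      show "norm (X x) \<le> M" if "x \<in> cball y (r / 2)" for x using r(5)[OF z] sub that by blast
      show "norm (X x - X x') \<le> L * norm (x - x')" if "x \<in> cball y (r / 2)" "x' \<in> cball y (r / 2)" for x x'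
        using r(6)[OF z] sub that by blast
    qed (use r e Me Le in auto)
    then show ?thesis using sub unfolding solves_def by blast
  qed
  with that r e show thesis by blast
qed

text \<open>
  Local solutions exist for a uniform time near the shell, hence everywhere by invariance, so
  that no solution can cease to exist.
\<close>

lemma vf_complete:
  assumes X: "X \<in> hopf_vf \<gamma>" and z: "z \<noteq> 0"
  shows "\<exists>c. c 0 = z \<and> solves X (- {0}) UNIV c"
proof -
  obtain r L e where r: "0 < r" "0 < e" "\<And>z. z \<in> shell \<Longrightarrow> cball z r \<subseteq> - {0}"
    "\<And>z y. z \<in> shell \<Longrightarrow> y \<in> cball z (r / 2) \<Longrightarrow> \<exists>c. c 0 = y \<and> solves X (cball z r) {-e<..<e} c"
    using vf_short_solutions[OF X] by metis
  have "\<exists>c. c 0 = y \<and> solves X (- {0}) {-e<..<e} c" if y: "y \<in> - {0}" for y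
  proof -
    from y have "y \<noteq> 0" by simp
    then obtain k where k: "it k y \<in> shell" by (rule shell_cases)
    then obtain c where "c 0 = it k y" "solves X (cball (it k y) r) {-e<..<e} c"
      using r(4)[OF k, of "it k y"] r(1) by auto
    moreover from this have "solves X (- {0}) {-e<..<e} c" using r(3)[OF k] unfolding solves_def by blast
    ultimately show ?thesis
      using it_solves[OF X, of _ c "- k"] by (intro exI[of _ "\<lambda>t. it (- k) (c t)"]) auto
  qed
  from global_solution[OF vf_lipschitz[OF X] r(2) this] z show ?thesis by auto
qed

lemma flow_solves:
  assumes "X \<in> hopf_vf \<gamma>" "z \<noteq> 0"
  shows "solves X (- {0}) UNIV (\<lambda>t. flow X t z)" and "flow X 0 z = z"
  using someI_ex[OF vf_complete[OF assms]] by (simp_all add: flow_def)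

lemma flow_unique:
  assumes X: "X \<in> hopf_vf \<gamma>" and c: "solves X (- {0}) I c" and I: "open I" "connected I" "0 \<in> I" "t \<in> I"
  shows "c t = flow X t (c 0)"
proof -
  have "c 0 \<noteq> 0" using c I by (auto simp: solves_def)
  note F = flow_solves[OF X this]
  show ?thesis
    by (rule solution_unique[OF vf_lipschitz[OF X] I(1,2) c solves_subset[OF F(1) subset_UNIV] I(3) _ I(4)])
      (simp only: F(2))
qed

lemma flow_unique_UNIV:
  assumes "X \<in> hopf_vf \<gamma>" "solves X (- {0}) UNIV c"
  shows "c t = flow X t (c 0)"
  by (rule flow_unique[OF assms open_UNIV connected_UNIV UNIV_I UNIV_I])

lemma flow_nz: "X \<in> hopf_vf \<gamma> \<Longrightarrow> z \<noteq> 0 \<Longrightarrow> flow X t z \<noteq> 0"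
  using flow_solves(1) by (force simp: solves_def)

lemma flow_derivative:
  "X \<in> hopf_vf \<gamma> \<Longrightarrow> z \<noteq> 0 \<Longrightarrow> ((\<lambda>t. flow X t z) has_vector_derivative X (flow X t z)) (at t)"
  using flow_solves(1) by (force simp: solves_def)

lemma flow_add:
  assumes X: "X \<in> hopf_vf \<gamma>" and z: "z \<noteq> 0"
  shows "flow X (s + t) z = flow X s (flow X t z)"
proof -
  have "solves X (- {0}) UNIV (\<lambda>s. flow X (s + t) z)"
    using solves_shift[OF flow_solves(1)[OF assms], of t] by simp
  from flow_unique_UNIV[OF X this, of s] show ?thesis by simp
qed

lemma flow_it:
  assumes X: "X \<in> hopf_vf \<gamma>" and z: "z \<noteq> 0"
  shows "flow X t (it k z) = it k (flow X t z)"
  using flow_unique_UNIV[OF X it_solves[OF X flow_solves(1)[OF assms]], of k t]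
  by (simp add: flow_solves(2)[OF assms])

lemma flow_scale:
  assumes X: "X \<in> hopf_vf \<gamma>" and z: "z \<noteq> 0"
  shows "flow (scale_vf (of_real s) X) t z = flow X (s * t) z"
proof -
  have "solves (scale_vf (of_real s) X) (- {0}) UNIV (\<lambda>t. flow X (s * t) z)"
    unfolding solves_def
  proof (intro ballI conjI)
    fix t
    show "flow X (s * t) z \<in> - {0}" using flow_nz[OF assms] by simp
    have "((\<lambda>t. flow X t z) \<circ> (\<lambda>t. s * t) has_vector_derivative s *\<^sub>R X (flow X (s * t) z)) (at t)"
      by (rule vector_diff_chain_at) (auto intro!: derivative_eq_intros flow_derivative[OF assms])
    then show "((\<lambda>t. flow X (s * t) z) has_vector_derivative scale_vf (of_real s) X (flow X (s * t) z)) (at t)"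
      by (simp add: o_def scale_vf_def scaleR_smult)
  qed
  from flow_unique_UNIV[OF scale_vf_in[OF X] this, of t] show ?thesis by (simp add: flow_solves(2)[OF assms])
qed

text \<open>Joint continuity, first for short times near the fundamental domain, then everywhere.\<close>

lemma flow_cont_short:
  assumes X: "X \<in> hopf_vf \<gamma>"
  obtains e where "0 < e" "\<And>z t. z \<noteq> 0 \<Longrightarrow> \<bar>t\<bar> < e \<Longrightarrow> isCont (\<lambda>p. flow X (fst p) (snd p)) (t, z)"
proof -
  obtain r L e where r: "0 < r" "0 \<le> L" "0 < e" "\<And>z. z \<in> shell \<Longrightarrow> cball z r \<subseteq> - {0}"
    "\<And>z x y. z \<in> shell \<Longrightarrow> x \<in> cball z r \<Longrightarrow> y \<in> cball z r \<Longrightarrow> norm (X x - X y) \<le> L * norm (x - y)"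
    "\<And>z y. z \<in> shell \<Longrightarrow> y \<in> cball z (r / 2) \<Longrightarrow> \<exists>c. c 0 = y \<and> solves X (cball z r) {-e<..<e} c"
    using vf_short_solutions[OF X] by metis
  have shell_case: "isCont (\<lambda>p. flow X (fst p) (snd p)) (t0, z0)" if z0: "z0 \<in> shell" and t0: "\<bar>t0\<bar> < e" for z0 t0
  proof -
    have fl: "solves X (cball z0 r) {-e<..<e} (\<lambda>t. flow X t y)" if y: "y \<in> cball z0 (r / 2)" for y
    proof -
      obtain c where c: "c 0 = y" "solves X (cball z0 r) {-e<..<e} c" using r(6)[OF z0 y] by blast
      then have c0: "solves X (- {0}) {-e<..<e} c" using r(4)[OF z0] unfolding solves_def by blast
      have eq: "c t = flow X t y" if "t \<in> {-e<..<e}" for t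
        using flow_unique[OF X c0 _ _ _ that] c(1) r(3) by auto
      show ?thesis
        unfolding solves_def
      proof (intro ballI conjI)
        fix t assume t: "t \<in> {-e<..<e}"
        show "flow X t y \<in> cball z0 r" using c(2) t unfolding eq[OF t, symmetric] solves_def by blast
        have "y \<noteq> 0" using r(1) r(4)[OF z0] y by (auto simp: subset_iff)
        then show "((\<lambda>t. flow X t y) has_vector_derivative X (flow X t y)) (at t)"
          by (rule flow_derivative[OF X])
      qed
    qed
    have dist: "norm (flow X t y - flow X t z0) \<le> exp (L * e) * norm (y - z0)"
      if y: "y \<in> cball z0 (r / 2)" and t: "\<bar>t\<bar> < e" for y t
    proof -
      have z0': "z0 \<in> cball z0 (r / 2)" using r by simp
      have nz: "y \<noteq> 0" "z0 \<noteq> 0" using r(1) r(4)[OF z0] y by (auto simp: subset_iff)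
      have "norm (flow X t y - flow X t z0) \<le> exp (L * \<bar>t - 0\<bar>) * norm (flow X 0 y - flow X 0 z0)"
        using t r(3) by (intro solutions_dist[OF fl[OF y] fl[OF z0'] _ r(5)[OF z0]] closed_segment_subset) auto
      also have "\<dots> \<le> exp (L * e) * norm (y - z0)"
        using t r by (intro mult_mono) (auto simp: flow_solves(2)[OF X] nz intro!: mult_left_mono)
      finally show ?thesis .
    qed
    have lim: "((\<lambda>p. flow X (fst p) (snd p) - flow X (fst p) z0) \<longlongrightarrow> 0) (at (t0, z0))"
    proof (rule Lim_null_comparison)
      show "((\<lambda>p. exp (L * e) * norm (snd p - z0)) \<longlongrightarrow> 0) (at (t0, z0))"
        by (rule tendsto_eq_intros | simp)+
      have "\<forall>\<^sub>F p in at (t0, z0). p \<in> {-e<..<e} \<times> ball z0 (r / 2)"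
        using t0 r by (intro eventually_at_in_open' open_Times) auto
      then show "\<forall>\<^sub>F p in at (t0, z0). norm (flow X (fst p) (snd p) - flow X (fst p) z0) \<le> exp (L * e) * norm (snd p - z0)"
        by eventually_elim (use dist in auto)
    qed
    have "((\<lambda>p. flow X (fst p) z0) \<longlongrightarrow> flow X t0 z0) (at (t0, z0))"
    proof (rule isCont_tendsto_compose[of t0 "\<lambda>t. flow X t z0"])
      have "z0 \<noteq> 0" using z0 by (auto simp: shell_def)
      then show "isCont (\<lambda>t. flow X t z0) t0"
        using flow_derivative[OF X] has_vector_derivative_continuous by blast
      show "(fst \<longlongrightarrow> t0) (at (t0, z0))" by (rule tendsto_eq_intros | simp)+
    qed
    from tendsto_add[OF lim this] show ?thesis by (simp add: isCont_def)
  qed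
  have "isCont (\<lambda>p. flow X (fst p) (snd p)) (t, z)" if z: "z \<noteq> 0" and t: "\<bar>t\<bar> < e" for t z
  proof -
    from z obtain k where k: "it k z \<in> shell" by (rule shell_cases)
    have ik: "isCont (it l) x" for l x using cont_it[of UNIV] continuous_on_eq_continuous_at by blast
    have c2: "isCont (\<lambda>p :: real \<times> (complex ^ 'n). (fst p, it k (snd p))) (t, z)"
      by (intro isCont_Pair isCont_o2[OF _ ik] continuous_intros)
    have "isCont (\<lambda>p. it (- k) (flow X (fst (fst p, it k (snd p))) (snd (fst p, it k (snd p))))) (t, z)"
      by (rule isCont_o2[OF isCont_o2[OF c2] ik]) (use shell_case[OF k t] in simp)
    moreover have "\<forall>\<^sub>F p in nhds (t, z). it (- k) (flow X (fst (fst p, it k (snd p))) (snd (fst p, it k (snd p)))) = flow X (fst p) (snd p)"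
    proof -
      have "\<forall>\<^sub>F p in nhds (t, z). p \<in> UNIV \<times> - {0}"
        using z by (intro eventually_nhds_in_open open_Times) auto
      then show ?thesis by eventually_elim (simp add: mem_Times_iff flow_it[OF X])
    qed
    ultimately show ?thesis using isCont_cong by fast
  qed
  with r(3) that show thesis by blast
qed

lemma flow_cont_fixed_time:
  assumes X: "X \<in> hopf_vf \<gamma>"
  shows "continuous_on (- {0}) (flow X t)"
proof -
  obtain e where e: "0 < e" "\<And>z t. z \<noteq> 0 \<Longrightarrow> \<bar>t\<bar> < e \<Longrightarrow> isCont (\<lambda>p. flow X (fst p) (snd p)) (t, z)"
    using flow_cont_short[OF X] by blast
  obtain N where N: "\<bar>t\<bar> / e < real N" using reals_Archimedean2 by blast
  then have N0: "0 < real N" using e by (metis abs_ge_zero divide_nonneg_pos le_less_trans)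
  define s where "s = t / real N"
  have "\<bar>t\<bar> < e * real N" using N e by (simp add: field_simps)
  then have s: "\<bar>s\<bar> < e" using N0 by (simp add: s_def abs_divide divide_less_eq)
  have c1: "continuous_on (- {0}) (flow X s)"
  proof (rule continuous_at_imp_continuous_on, rule ballI)
    fix z :: "complex ^ 'n" assume "z \<in> - {0}"
    then have "isCont (\<lambda>p. flow X (fst p) (snd p)) (s, z)" using e(2) s by simp
    from isCont_o2[of z "\<lambda>z. (s, z)", OF _ this] show "isCont (flow X s) z" by simp
  qed
  have "continuous_on (- {0}) (flow X (real m * s))" for m
  proof (induction m)
    case 0
    have "continuous_on (- {0}) (\<lambda>z :: complex ^ 'n. z)" by (rule continuous_on_id)
    then show ?case by (rule continuous_on_eq) (simp add: flow_solves(2)[OF X])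
  next
    case (Suc m)
    have "continuous_on (- {0}) (\<lambda>z. flow X s (flow X (real m * s) z))"
      by (rule continuous_on_compose2[OF c1 Suc]) (use flow_nz[OF X] in \<open>force simp: image_iff\<close>)
    then show ?case by (rule continuous_on_eq) (auto simp: flow_add[OF X, symmetric] algebra_simps)
  qed
  from this[of N] show ?thesis using N0 by (simp add: s_def)
qed

lemma flow_isCont:
  assumes X: "X \<in> hopf_vf \<gamma>" and z: "z \<noteq> 0"
  shows "isCont (\<lambda>p. flow X (fst p) (snd p)) (t, z)"
proof -
  obtain e where e: "0 < e" "\<And>z t. z \<noteq> 0 \<Longrightarrow> \<bar>t\<bar> < e \<Longrightarrow> isCont (\<lambda>p. flow X (fst p) (snd p)) (t, z)"
    using flow_cont_short[OF X] by blast
  have 0: "isCont (\<lambda>p. flow X (fst p) (snd p)) (0, flow X t z)"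
    using e flow_nz[OF X z] by simp
  have "isCont (flow X t) z"
    using flow_cont_fixed_time[OF X] z continuous_on_eq_continuous_at[of "- {0}"] by auto
  then have "isCont (\<lambda>p. (fst p - t, flow X t (snd p))) (t, z)"
    by (intro isCont_Pair continuous_intros isCont_o2[of _ snd]) auto
  from isCont_o2[OF this, of "\<lambda>p. flow X (fst p) (snd p)"] 0
  have c: "isCont (\<lambda>p. flow X (fst p - t) (flow X t (snd p))) (t, z)" by simp
  have "\<forall>\<^sub>F p in nhds (t, z). p \<in> UNIV \<times> - {0}"
    using z by (intro eventually_nhds_in_open open_Times) auto
  then have "\<forall>\<^sub>F p in nhds (t, z). flow X (fst p - t) (flow X t (snd p)) = flow X (fst p) (snd p)"
    by eventually_elim (simp add: mem_Times_iff flow_add[OF X, symmetric])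
  with c show ?thesis using isCont_cong by fast
qed

subsection \<open>The exponential map\<close>

lemma exp_vf_class:
  assumes X: "X \<in> hopf_vf \<gamma>" and z: "z \<noteq> 0"
  shows "exp_vf \<gamma> X (hopf_class \<gamma> z) = hopf_class \<gamma> (flow X 1 z)"
proof -
  have "(THE q. \<exists>c. integral_curve X c \<and> hopf_class \<gamma> (c 0) = hopf_class \<gamma> z \<and> hopf_class \<gamma> (c 1) = q)
      = hopf_class \<gamma> (flow X 1 z)"
  proof (rule the_equality)
    show "\<exists>c. integral_curve X c \<and> hopf_class \<gamma> (c 0) = hopf_class \<gamma> z \<and> hopf_class \<gamma> (c 1) = hopf_class \<gamma> (flow X 1 z)"
      using flow_solves[OF assms] by (intro exI[of _ "\<lambda>t. flow X t z"]) (simp add: integral_curve_iff)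
    fix q assume "\<exists>c. integral_curve X c \<and> hopf_class \<gamma> (c 0) = hopf_class \<gamma> z \<and> hopf_class \<gamma> (c 1) = q"
    then obtain c k where c: "solves X (- {0}) UNIV c" "c 0 = it k z" "hopf_class \<gamma> (c 1) = q"
      by (auto simp: integral_curve_iff hopf_class_eq_iff)
    have "c 1 = it k (flow X 1 z)" using flow_unique_UNIV[OF X c(1), of 1] c(2) flow_it[OF X z] by simp
    with c(3) show "q = hopf_class \<gamma> (flow X 1 z)" by simp
  qed
  then show ?thesis using z by (simp add: exp_vf_def)
qed

lemma exp_vf_extensional: "exp_vf \<gamma> X \<in> extensional (hopf \<gamma>)"
  by (simp add: exp_vf_def)

lemma exp_vf_scale:
  assumes "X \<in> hopf_vf \<gamma>" "z \<noteq> 0"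
  shows "exp_vf \<gamma> (scale_vf (of_real t) X) (hopf_class \<gamma> z) = hopf_class \<gamma> (flow X t z)"
  using exp_vf_class[OF scale_vf_in[OF assms(1)] assms(2)] flow_scale[OF assms, of t 1] by simp

end

section \<open>Complex lines in the Lie algebra of a compact torus\<close>

lemma integer_valued_constant:
  fixes f :: "'a::topological_space \<Rightarrow> real"
  assumes "connected S" "continuous_on S f" "\<And>x. x \<in> S \<Longrightarrow> f x \<in> \<int>"
  shows "f constant_on S"
proof (rule continuous_discrete_range_constant[OF assms(1,2)])
  fix x assume x: "x \<in> S"
  have "1 \<le> norm (f y - f x)" if "y \<in> S" "f y \<noteq> f x" for y
    using Ints_nonzero_abs_ge1[of "f y - f x"] assms(3) x that by auto
  then show "\<exists>e>0. \<forall>y. y \<in> S \<and> f y \<noteq> f x \<longrightarrow> e \<le> norm (f y - f x)"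
    by (intro exI[of _ 1]) auto
qed

text \<open>
  The theorem of Hyers for functions on the line: a locally bounded quasi-additive function
  stays at bounded distance from a linear one.
\<close>

lemma quasi_additive_real:
  fixes g :: "real \<Rightarrow> real"
  assumes D: "\<And>s t. \<bar>g (s + t) - g s - g t\<bar> \<le> D" and B: "\<And>t. 0 \<le> t \<Longrightarrow> t \<le> 1 \<Longrightarrow> \<bar>g t\<bar> \<le> B"
  shows "\<exists>a C. \<forall>t. \<bar>g t - a * t\<bar> \<le> C"
proof -
  have D0: "0 \<le> D" using D[of 0 0] abs_ge_zero order_trans by blast
  have g0: "\<bar>g 0\<bar> \<le> D" using D[of 0 0] by simp
  have mult: "\<bar>g (real M * t) - real M * g t\<bar> \<le> real (Suc M) * D" for M t
  proof (induction M)
    case (Suc M)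
    have "\<bar>g (real M * t + t) - g (real M * t) - g t\<bar> \<le> D" by (rule D)
    then show ?case using Suc by (simp add: algebra_simps)
  qed (use g0 in simp)
  define x where "x N = g (real (Suc N)) / real (Suc N)" for N
  have step: "\<bar>g (real (Suc M) * real (Suc N)) / (real (Suc M) * real (Suc N)) - x N\<bar> \<le> 2 * D / real (Suc N)" for M N
  proof -
    have "\<bar>g (real (Suc M) * real (Suc N)) / (real (Suc M) * real (Suc N)) - x N\<bar>
        = \<bar>g (real (Suc M) * real (Suc N)) - real (Suc M) * g (real (Suc N))\<bar> / (real (Suc M) * real (Suc N))"
      by (simp add: x_def abs_divide diff_divide_distrib[symmetric] field_simps abs_mult del: of_nat_Suc)
    also have "\<dots> \<le> real (Suc (Suc M)) * D / (real (Suc M) * real (Suc N))"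
      by (intro divide_right_mono mult) auto
    also have "\<dots> \<le> (2 * real (Suc M)) * D / (real (Suc M) * real (Suc N))"
      using D0 by (intro divide_right_mono mult_right_mono) auto
    also have "\<dots> = 2 * D / real (Suc N)" by (simp add: field_simps del: of_nat_Suc)
    finally show ?thesis .
  qed
  have diff: "\<bar>x M - x N\<bar> \<le> 2 * D / real (Suc M) + 2 * D / real (Suc N)" for M N
    using step[of M N] step[of N M] by (simp add: mult.commute[of "real (Suc N)"] del: of_nat_Suc)
  have lim0: "(\<lambda>M. 2 * D / real (Suc M)) \<longlonglongrightarrow> 0"
    using tendsto_mult_right_zero[OF LIMSEQ_inverse_real_of_nat, of "2 * D"] by (simp add: divide_inverse)
  have "Cauchy x"
    unfolding Cauchy_def
  proof (intro allI impI)
    fix e :: real assume "0 < e"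
    then have "\<forall>\<^sub>F M in sequentially. 2 * D / real (Suc M) < e / 2"
      using order_tendstoD(2)[OF lim0, of "e / 2"] by simp
    then obtain M0 where M0: "\<And>M. M0 \<le> M \<Longrightarrow> 2 * D / real (Suc M) < e / 2"
      unfolding eventually_sequentially by blast
    have "dist (x m) (x n) < e" if "M0 \<le> m" "M0 \<le> n" for m n
      using diff[of m n] M0[OF that(1)] M0[OF that(2)] by (simp add: dist_real_def del: of_nat_Suc)
    then show "\<exists>M. \<forall>m\<ge>M. \<forall>n\<ge>M. dist (x m) (x n) < e" by blast
  qed
  then obtain a where a: "x \<longlonglongrightarrow> a" using Cauchy_convergent_iff convergent_def by blast
  have xa: "\<bar>a - x N\<bar> \<le> 2 * D / real (Suc N)" for N
  proof (rule LIMSEQ_le)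
    show "(\<lambda>M. \<bar>x M - x N\<bar>) \<longlonglongrightarrow> \<bar>a - x N\<bar>" by (intro tendsto_intros a)
    show "(\<lambda>M. 2 * D / real (Suc M) + 2 * D / real (Suc N)) \<longlonglongrightarrow> 2 * D / real (Suc N)"
      using tendsto_add[OF lim0 tendsto_const] by simp
  qed (use diff in blast)
  have int: "\<bar>g (real N) - a * real N\<bar> \<le> 2 * D" for N
  proof (cases N)
    case (Suc m)
    have "\<bar>g (real N) - a * real N\<bar> = real N * \<bar>a - x m\<bar>"
    proof -
      have "g (real N) - a * real N = real N * (x m - a)" by (simp add: Suc x_def algebra_simps del: of_nat_Suc)
      then show ?thesis by (simp add: abs_mult abs_minus_commute)
    qed
    also have "\<dots> \<le> real N * (2 * D / real N)" using xa[of m] Suc by (intro mult_left_mono) auto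
    finally show ?thesis using Suc by simp
  qed (use g0 D0 in simp)
  have pos: "\<bar>g t - a * t\<bar> \<le> 3 * D + B + \<bar>a\<bar>" if t: "0 \<le> t" for t
  proof -
    define N where "N = nat \<lfloor>t\<rfloor>"
    define r where "r = t - real N"
    have r: "0 \<le> r" "r \<le> 1" using t by (auto simp: r_def N_def) linarith+
    have "\<bar>a * r\<bar> \<le> \<bar>a\<bar>" using r by (simp add: abs_mult mult_left_le)
    moreover have "\<bar>g (real N + r) - g (real N) - g r\<bar> \<le> D" by (rule D)
    moreover have "g t = g (real N + r)" "a * t = a * real N + a * r" by (simp_all add: r_def algebra_simps)
    ultimately show ?thesis using int[of N] B[OF r] by linarith
  qed
  have "\<bar>g t - a * t\<bar> \<le> 5 * D + B + \<bar>a\<bar>" for t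
  proof (cases "0 \<le> t")
    case True
    then show ?thesis using pos[OF True] D0 by linarith
  next
    case False
    have "\<bar>g (t + - t) - g t - g (- t)\<bar> \<le> D" by (rule D)
    with pos[of "- t"] False g0 show ?thesis by simp
  qed
  then show ?thesis by blast
qed

text \<open>
  On the axes the function is close to linear ones, and quasi-additivity adds up the two.
\<close>

lemma quasi_additive_complex:
  fixes f :: "complex \<Rightarrow> real"
  assumes D: "\<And>w w'. \<bar>f (w + w') - f w - f w'\<bar> \<le> D" and f: "continuous_on UNIV f"
  shows "\<exists>a C. \<forall>w. \<bar>f w - Re (a * w)\<bar> \<le> C"
proof -
  have line: "\<exists>b C. \<forall>t. \<bar>f (of_real t * d) - b * t\<bar> \<le> C" for d
  proof -
    have "continuous_on {0..1} (\<lambda>t. f (of_real t * d))"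
      by (intro continuous_on_compose2[OF f] continuous_intros) auto
    then have "bounded ((\<lambda>t. f (of_real t * d)) ` {0..1})"
      by (intro compact_imp_bounded compact_continuous_image compact_Icc)
    then obtain B where "\<And>t. t \<in> {0..1} \<Longrightarrow> \<bar>f (of_real t * d)\<bar> \<le> B"
      unfolding bounded_iff by (auto simp del: atLeastAtMost_iff)
    then show ?thesis
      using D[of "of_real _ * d" "of_real _ * d"]
      by (intro quasi_additive_real[where D = D and B = B]) (auto simp: algebra_simps)
  qed
  from line[of 1] line[of \<i>] obtain b b' C C' where
    b: "\<And>t. \<bar>f (of_real t) - b * t\<bar> \<le> C" "\<And>t. \<bar>f (of_real t * \<i>) - b' * t\<bar> \<le> C'" by auto
  have "\<bar>f w - Re (Complex b (- b') * w)\<bar> \<le> D + C + C'" for w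
  proof -
    have "w = of_real (Re w) + of_real (Im w) * \<i>" by (simp add: complex_eq_iff)
    then have "\<bar>f w - f (of_real (Re w)) - f (of_real (Im w) * \<i>)\<bar> \<le> D" using D by metis
    moreover have "Re (Complex b (- b') * w) = b * Re w + b' * Im w" by simp
    ultimately show ?thesis using b(1)[of "Re w"] b(2)[of "Im w"] by linarith
  qed
  then show ?thesis by blast
qed

lemma Liouville_curve:
  fixes c :: "complex \<Rightarrow> complex ^ 'n"
  assumes "\<And>j. (\<lambda>w. c w $ j) holomorphic_on UNIV" "\<And>w. norm (c w) \<le> R"
  shows "c w = c 0"
proof -
  have "c w $ j = c 0 $ j" for j
  proof -
    have "bounded (range (\<lambda>w. c w $ j))"
      unfolding bounded_iff
      using order_trans[OF Finite_Cartesian_Product.norm_nth_le assms(2)] by blast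
    from Liouville_theorem[OF assms(1) this] show ?thesis
      unfolding constant_on_def by (metis UNIV_I)
  qed
  then show ?thesis by (simp add: vec_eq_iff)
qed

subsection \<open>Topology of the automorphism group\<close>

lemma openin_subbasic:
  assumes "compactin (hopf_topology \<gamma>) K" "openin (hopf_topology \<gamma>) U"
  shows "openin (hopf_aut_topology \<gamma>) {F \<in> hopf_aut \<gamma>. F ` K \<subseteq> U}"
  unfolding hopf_aut_topology_def by (rule topology_generated_by_Basis) (use assms in blast)

lemma topspace_hopf_aut: "topspace (hopf_aut_topology \<gamma>) = hopf_aut \<gamma>"
proof -
  have "compactin (hopf_topology \<gamma>) {}" "openin (hopf_topology \<gamma>) {}" by auto
  then show ?thesis
    unfolding hopf_aut_topology_def topology_generated_by_topspace by fastforce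
qed

lemma id_comp_subset: "hopf_aut_id_comp \<gamma> \<subseteq> hopf_aut \<gamma>"
  using connected_component_of_subset_topspace[of "hopf_aut_topology \<gamma>"]
  unfolding hopf_aut_id_comp_def topspace_hopf_aut by blast

lemma torus_subset: "compact_torus \<gamma> H \<Longrightarrow> H \<subseteq> hopf_aut \<gamma>"
  using id_comp_subset by (auto simp: compact_torus_def)

lemma hopf_aut_Bij: "F \<in> hopf_aut \<gamma> \<Longrightarrow> F \<in> Bij (hopf \<gamma>)"
  by (simp add: hopf_aut_def)

lemma BijGroup_mult: "F \<in> Bij S \<Longrightarrow> G \<in> Bij S \<Longrightarrow> F \<otimes>\<^bsub>BijGroup S\<^esub> G = compose S F G"
  by (simp add: BijGroup_def)

lemma torus_commute:
  assumes H: "compact_torus \<gamma> H" and F: "F \<in> H" "G \<in> H"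
  shows "F \<otimes>\<^bsub>BijGroup (hopf \<gamma>)\<^esub> G = G \<otimes>\<^bsub>BijGroup (hopf \<gamma>)\<^esub> F"
proof -
  obtain k and \<rho> where \<rho>: "\<rho> \<in> iso (product_group {..<k :: nat} (\<lambda>_. circle_group)) ((BijGroup (hopf \<gamma>))\<lparr>carrier := H\<rparr>)"
    using H unfolding compact_torus_def by blast
  let ?T = "product_group {..<k} (\<lambda>_. circle_group)"
  have h: "\<rho> \<in> hom ?T ((BijGroup (hopf \<gamma>))\<lparr>carrier := H\<rparr>)" using \<rho> by (simp add: iso_def)
  obtain a b where ab: "a \<in> carrier ?T" "b \<in> carrier ?T" "F = \<rho> a" "G = \<rho> b"
    using \<rho> F unfolding iso_def bij_betw_def by auto
  have "a \<otimes>\<^bsub>?T\<^esub> b = b \<otimes>\<^bsub>?T\<^esub> a"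
    by (auto simp: product_group_def circle_group_def mult.commute)
  then show ?thesis
    using hom_mult[OF h ab(1,2)] hom_mult[OF h ab(2,1)] ab(3,4) by simp
qed

lemma torus_compactin:
  assumes H: "compact_torus \<gamma> H"
  shows "compactin (hopf_aut_topology \<gamma>) H"
proof -
  obtain k and \<rho> where \<rho>: "homeomorphic_map (product_topology (\<lambda>_. top_of_set (sphere (0 :: complex) 1)) {..<k :: nat})
      (subtopology (hopf_aut_topology \<gamma>) H) \<rho>"
    using H unfolding compact_torus_def by blast
  have "compact_space (product_topology (\<lambda>_. top_of_set (sphere (0 :: complex) 1)) {..<k})"
    by (intro compact_space_product_topology[THEN iffD2] disjI2 ballI)
       (simp add: compact_space_subtopology)
  then have "compact_space (subtopology (hopf_aut_topology \<gamma>) H)"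
    using \<rho> homeomorphic_compact_space homeomorphic_space by blast
  then show ?thesis
    using torus_subset[OF H] by (simp add: compactin_subspace topspace_hopf_aut)
qed

context hopf_contraction
begin

declare hopf_class_in [intro]

text \<open>
  The orbits that meet an open set fill the union of its translates under \<open>it k\<close>.
\<close>

lemma openin_class_image:
  assumes "open V" "V \<subseteq> - {0}"
  shows "openin (hopf_topology \<gamma>) (hopf_class \<gamma> ` V)"
  unfolding openin_hopf_topology
proof
  show "hopf_class \<gamma> ` V \<subseteq> hopf \<gamma>" using assms by (auto intro!: hopf_class_in)
  have "{z. z \<noteq> 0 \<and> hopf_class \<gamma> z \<in> hopf_class \<gamma> ` V} = (\<Union>k. it k -` V)"
  proof safe
    fix z v assume "z \<noteq> 0" "hopf_class \<gamma> z = hopf_class \<gamma> v" "v \<in> V"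
    then obtain k where "v = it k z" using hopf_class_eq_iff by metis
    then show "z \<in> (\<Union>k. it k -` V)" using \<open>v \<in> V\<close> by auto
  next
    fix k assume "it k 0 \<in> V"
    then show False using assms by auto
  next
    fix z k assume "it k z \<in> V"
    then show "hopf_class \<gamma> z \<in> hopf_class \<gamma> ` V" by (intro image_eqI[of _ _ "it k z"]) auto
  qed
  moreover have "open (it k -` V)" for k
    using assms(1) cont_it[of UNIV k] by (simp add: continuous_on_open_vimage)
  ultimately show "open {z. z \<noteq> 0 \<and> hopf_class \<gamma> z \<in> hopf_class \<gamma> ` V}" by auto
qed

lemma topspace_hopf: "topspace (hopf_topology \<gamma>) = hopf \<gamma>"
proof
  show "topspace (hopf_topology \<gamma>) \<subseteq> hopf \<gamma>"
    using openin_topspace[of "hopf_topology \<gamma>"] openin_hopf_topology by blast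
  have "hopf \<gamma> = hopf_class \<gamma> ` (- {0})" by (auto simp: hopf_def)
  then show "hopf \<gamma> \<subseteq> topspace (hopf_topology \<gamma>)"
    using openin_subset[OF openin_class_image[OF open_Compl[OF closed_singleton[of 0]]]] by simp
qed

lemma continuous_class: "continuous_map (top_of_set (- {0})) (hopf_topology \<gamma>) (hopf_class \<gamma>)"
  unfolding continuous_map
proof (intro conjI allI impI)
  show "hopf_class \<gamma> ` topspace (top_of_set (- {0})) \<subseteq> topspace (hopf_topology \<gamma>)"
    by (auto simp: topspace_hopf intro!: hopf_class_in)
  fix U assume "openin (hopf_topology \<gamma>) U"
  then have "open {z. z \<noteq> 0 \<and> hopf_class \<gamma> z \<in> U}" by (simp add: openin_hopf_topology)
  then show "openin (top_of_set (- {0})) {x \<in> topspace (top_of_set (- {0})). hopf_class \<gamma> x \<in> U}"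
    unfolding openin_open by (intro exI[of _ "{z. z \<noteq> 0 \<and> hopf_class \<gamma> z \<in> U}"]) auto
qed

lemma compactin_class_image:
  assumes "compact K" "K \<subseteq> - {0}"
  shows "compactin (hopf_topology \<gamma>) (hopf_class \<gamma> ` K)"
  by (rule image_compactin[OF _ continuous_class]) (use assms in \<open>simp add: compactin_subtopology\<close>)

lemma hopf_aut_image:
  assumes "F \<in> hopf_aut \<gamma>" "p \<in> hopf \<gamma>"
  shows "F p \<in> hopf \<gamma>"
  using assms by (auto simp: hopf_aut_def Bij_def bij_betw_def)

text \<open>
  A flow map with holomorphic projection to the Hopf manifold is holomorphic: it differs from
  a holomorphic local lift by an iterate of \<open>\<gamma>\<close> that is locally constant.
\<close>

lemma flow_holo:
  assumes X: "X \<in> hopf_vf \<gamma>" and F: "exp_vf \<gamma> (scale_vf (of_real t) X) \<in> hopf_aut \<gamma>"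
  shows "holo_on (- {0}) (flow X t)"
  unfolding holo_on_def
proof
  fix z :: "complex ^ 'n" assume "z \<in> - {0}"
  then have z: "z \<noteq> 0" by simp
  let ?F = "exp_vf \<gamma> (scale_vf (of_real t) X)"
  from F have "hopf_holo \<gamma> ?F" by (simp add: hopf_aut_def)
  then have "\<exists>U f. open U \<and> z \<in> U \<and> 0 \<notin> U \<and> holo_on U f \<and>
      (\<forall>w\<in>U. f w \<noteq> 0 \<and> ?F (hopf_class \<gamma> w) = hopf_class \<gamma> (f w))"
    using z unfolding hopf_holo_def by simp
  then obtain U f where U: "open U" "z \<in> U" "0 \<notin> U" "holo_on U f"
    and f: "\<And>w. w \<in> U \<Longrightarrow> f w \<noteq> 0 \<and> ?F (hopf_class \<gamma> w) = hopf_class \<gamma> (f w)"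
    by (elim exE conjE) (rule that, blast+)
  obtain r where r: "0 < r" "ball z r \<subseteq> U" using U open_contains_ball by blast
  have nz: "w \<noteq> 0" if "w \<in> ball z r" for w using that r(2) U(3) by blast
  have ex: "\<exists>k. flow X t w = it k (f w)" if "w \<in> ball z r" for w
    using f[of w] that r exp_vf_scale[OF X nz[OF that], of t] hopf_class_eq_iff by auto
  define d where "d w = height (flow X t w) - height (f w)" for w
  have "continuous_on (ball z r) d"
    unfolding d_def
  proof (intro continuous_intros continuous_on_compose2[OF cont_height])
    show "continuous_on (ball z r) (flow X t)"
      by (rule continuous_on_subset[OF flow_cont_fixed_time[OF X]]) (use nz in blast)
    show "continuous_on (ball z r) f"
      using holo_on_imp_continuous_on[OF U(4)] r continuous_on_subset by blast
    show "f ` ball z r \<subseteq> - {0}" using f r(2) by (force simp: image_iff)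
    show "flow X t ` ball z r \<subseteq> - {0}"
    proof (rule image_subsetI)
      fix w assume "w \<in> ball z r"
      from flow_nz[OF X nz[OF this]] show "flow X t w \<in> - {0}" by simp
    qed
  qed
  moreover have d: "\<exists>k. d w = of_int k \<and> flow X t w = it k (f w)" if "w \<in> ball z r" for w
    using ex[OF that] f[of w] that r by (auto simp: d_def height_it)
  ultimately have "d constant_on ball z r"
    by (intro integer_valued_constant) (use d in force)+
  then obtain c where c: "\<And>w. w \<in> ball z r \<Longrightarrow> d w = c" unfolding constant_on_def by blast
  obtain k where k: "d z = of_int k" using d[of z] r by auto
  have "flow X t w = it k (f w)" if "w \<in> ball z r" for w
    using d[OF that] c[OF that] c[of z] k r by auto
  moreover have "holo_on (ball z r) (\<lambda>w. it k (f w))"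
    by (rule holo_on_compose[OF holo_on_subset[OF U(4) r(2)] holo_it]) simp
  ultimately have "holo_on (ball z r) (flow X t)" using holo_on_cong[of "ball z r"] by simp
  then show "\<exists>D. (flow X t has_derivative D) (at z) \<and> (\<forall>c v. D (c *s v) = c *s D v)"
    using r unfolding holo_on_def by simp
qed

end

text \<open>
  The hypothesis of both parts of the theorem: the complex line through \<open>X\<close> lies in the Lie
  algebra of a compact torus.
\<close>

locale torus_line = hopf_contraction \<gamma> for \<gamma> :: "complex ^ 'n \<Rightarrow> complex ^ 'n" +
  fixes H :: "((complex ^ 'n) set \<Rightarrow> (complex ^ 'n) set) set" and X :: "complex ^ 'n \<Rightarrow> complex ^ 'n"
  assumes torus: "compact_torus \<gamma> H"
    and X_in: "X \<in> lie_algebra \<gamma> H" and JX_in: "J_vf X \<in> lie_algebra \<gamma> H"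
begin

abbreviation Y where "Y \<equiv> J_vf X"

lemma X_vf: "X \<in> hopf_vf \<gamma>" and Y_vf: "Y \<in> hopf_vf \<gamma>"
  using X_in JX_in by (auto simp: lie_algebra_def)

lemma Y_apply: "Y v = \<i> *s X v"
  by (simp add: J_vf_def scale_vf_def)

lemma exp_X_in: "exp_vf \<gamma> (scale_vf (of_real t) X) \<in> H"
  and exp_Y_in: "exp_vf \<gamma> (scale_vf (of_real t) Y) \<in> H"
  using X_in JX_in by (auto simp: lie_algebra_def)

lemma H_aut: "F \<in> H \<Longrightarrow> F \<in> hopf_aut \<gamma>"
  using torus_subset[OF torus] by blast

lemma H_compose:
  assumes "F \<in> H" "G \<in> H"
  shows "compose (hopf \<gamma>) F G \<in> H"
proof -
  have "F \<otimes>\<^bsub>BijGroup (hopf \<gamma>)\<^esub> G \<in> H"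
    using torus assms by (auto simp: compact_torus_def intro: subgroup.m_closed)
  then show ?thesis using assms H_aut hopf_aut_Bij by (metis BijGroup_mult)
qed

lemma H_commute:
  assumes "F \<in> H" "G \<in> H" "p \<in> hopf \<gamma>"
  shows "F (G p) = G (F p)"
proof -
  have "compose (hopf \<gamma>) F G = compose (hopf \<gamma>) G F"
    using torus_commute[OF torus assms(1,2)] assms H_aut hopf_aut_Bij by (metis BijGroup_mult)
  then show ?thesis using assms(3) by (metis compose_eq)
qed

text \<open>
  The two real flows commute on the Hopf manifold because the torus is abelian. Their lifts
  then commute up to an iterate of \<open>\<gamma>\<close>, which is trivial at time zero and cannot jump.
\<close>

lemma flows_commute:
  assumes z: "z \<noteq> 0"
  shows "flow X s (flow Y t z) = flow Y t (flow X s z)"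
proof -
  note nz = flow_nz[OF X_vf] flow_nz[OF Y_vf]
  have ex: "\<exists>k. flow X s (flow Y t z) = it k (flow Y t (flow X s z))" for s
  proof -
    have "exp_vf \<gamma> (scale_vf (of_real s) X) (exp_vf \<gamma> (scale_vf (of_real t) Y) (hopf_class \<gamma> z))
        = exp_vf \<gamma> (scale_vf (of_real t) Y) (exp_vf \<gamma> (scale_vf (of_real s) X) (hopf_class \<gamma> z))"
      using z by (intro H_commute exp_X_in exp_Y_in) auto
    then show ?thesis
      using z by (simp add: exp_vf_scale[OF X_vf] exp_vf_scale[OF Y_vf] nz hopf_class_eq_iff)
  qed
  define d where "d s = height (flow X s (flow Y t z)) - height (flow Y t (flow X s z))" for s
  have d: "\<exists>k. d s = of_int k \<and> flow X s (flow Y t z) = it k (flow Y t (flow X s z))" for s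
    using ex[of s] z by (auto simp: d_def height_it nz)
  have cX: "continuous_on UNIV (\<lambda>s. flow X s y)" if "y \<noteq> 0" for y
    using solves_imp_continuous_on[OF flow_solves(1)[OF X_vf that]] .
  have "continuous_on UNIV d"
    unfolding d_def
    by (intro continuous_intros continuous_on_compose2[OF cont_height]
        continuous_on_compose2[OF flow_cont_fixed_time[OF Y_vf]] cX) (use z nz in \<open>auto simp: image_iff\<close>)
  then have "d constant_on UNIV"
  proof (intro integer_valued_constant)
    show "d s \<in> \<int>" for s using d[of s] by auto
  qed auto
  then have "d s = d 0" by (metis constant_on_def UNIV_I)
  also have "\<dots> = 0" using z nz by (simp add: d_def flow_solves(2)[OF X_vf])
  finally show ?thesis using d[of s] by auto
qed

text \<open>
  The flow of \<open>X\<close> in complex time: since \<open>J X\<close> is \<open>\<i>\<close> times \<open>X\<close>, imaginary times are the real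
  times of the flow of \<open>J X\<close>.
\<close>

definition cflow :: "complex \<Rightarrow> complex ^ 'n \<Rightarrow> complex ^ 'n" where
  "cflow w z = flow X (Re w) (flow Y (Im w) z)"

lemma cflow_nz: "z \<noteq> 0 \<Longrightarrow> cflow w z \<noteq> 0"
  by (simp add: cflow_def flow_nz[OF X_vf] flow_nz[OF Y_vf])

lemma cflow_0: "z \<noteq> 0 \<Longrightarrow> cflow 0 z = z"
  by (simp add: cflow_def flow_solves(2)[OF X_vf] flow_solves(2)[OF Y_vf])

lemma cflow_add:
  assumes z: "z \<noteq> 0"
  shows "cflow (w + w') z = cflow w (cflow w' z)"
proof -
  have "cflow w (cflow w' z) = flow X (Re w) (flow X (Re w') (flow Y (Im w) (flow Y (Im w') z)))"
    using z by (simp add: cflow_def flows_commute flow_nz[OF Y_vf])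
  then show ?thesis
    using z by (simp add: cflow_def flow_add[OF X_vf] flow_add[OF Y_vf] flow_nz[OF Y_vf])
qed

lemma cflow_it: "z \<noteq> 0 \<Longrightarrow> cflow w (it k z) = it k (cflow w z)"
  by (simp add: cflow_def flow_it[OF X_vf] flow_it[OF Y_vf] flow_nz[OF Y_vf])

lemma cflow_holo: "holo_on (- {0}) (cflow w)"
  unfolding cflow_def[abs_def]
  by (intro holo_on_compose[OF flow_holo[OF Y_vf] flow_holo[OF X_vf]] H_aut exp_X_in exp_Y_in)
     (auto simp: image_iff dest: flow_nz[OF Y_vf])

definition cflow_aut :: "complex \<Rightarrow> (complex ^ 'n) set \<Rightarrow> (complex ^ 'n) set" where
  "cflow_aut w = compose (hopf \<gamma>) (exp_vf \<gamma> (scale_vf (of_real (Re w)) X)) (exp_vf \<gamma> (scale_vf (of_real (Im w)) Y))"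

lemma cflow_aut_in: "cflow_aut w \<in> H"
  unfolding cflow_aut_def by (intro H_compose exp_X_in exp_Y_in)

lemma cflow_aut_class: "z \<noteq> 0 \<Longrightarrow> cflow_aut w (hopf_class \<gamma> z) = hopf_class \<gamma> (cflow w z)"
  by (simp add: cflow_aut_def compose_eq exp_vf_scale[OF X_vf] exp_vf_scale[OF Y_vf] cflow_def flow_nz[OF Y_vf])

text \<open>
  The partial derivatives in the two real directions are \<open>X\<close> and \<open>\<i> *s X\<close>, because each of the
  commuting flows can be applied last. They are continuous and together complex linear.
\<close>

lemma cflow_has_derivative:
  assumes z: "z \<noteq> 0"
  shows "((\<lambda>w. cflow w z) has_derivative (\<lambda>h. h *s X (cflow w z))) (at w)"
proof -
  define F where "F s t = flow X s (flow Y t z)" for s t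
  have Fnz: "F s t \<noteq> 0" for s t by (simp add: F_def z flow_nz[OF X_vf] flow_nz[OF Y_vf])
  have cont: "continuous_on UNIV (\<lambda>(s, t). F s t)"
  proof (rule continuous_at_imp_continuous_on, rule ballI)
    fix p :: "real \<times> real"
    have "continuous_on UNIV (\<lambda>t. flow Y t z)"
      using solves_imp_continuous_on[OF flow_solves(1)[OF Y_vf z]] .
    then have "isCont (\<lambda>t. flow Y t z) (snd p)" by (simp add: continuous_on_eq_continuous_at)
    then have "isCont (\<lambda>q. flow Y (snd q) z) p"
      by (rule isCont_o2[rotated]) (intro continuous_intros)
    then have "isCont (\<lambda>q. (fst q, flow Y (snd q) z)) p"
      by (rule isCont_Pair[rotated]) (intro continuous_intros)
    from isCont_o2[OF this, of "\<lambda>p. flow X (fst p) (snd p)"] flow_isCont[OF X_vf flow_nz[OF Y_vf z]]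
    show "isCont (\<lambda>(s, t). F s t) p" by (simp add: F_def case_prod_beta')
  qed
  have cX: "continuous_on (- {0}) X" using holo_on_imp_continuous_on[OF vf_holo[OF X_vf]] .
  have D: "((\<lambda>(s, t). F s t) has_derivative
      (\<lambda>(ts, tt). ts *\<^sub>R X (F (Re w) (Im w)) + blinfun_apply (blinfun_scaleR_left (\<i> *s X (F (Re w) (Im w)))) tt))
      (at (Re w, Im w) within UNIV \<times> UNIV)"
  proof (rule has_derivative_partialsI[where fy = "\<lambda>s t. blinfun_scaleR_left (\<i> *s X (F s t))"])
    show "((\<lambda>s. F s (Im w)) has_derivative (\<lambda>ts. ts *\<^sub>R X (F (Re w) (Im w)))) (at (Re w) within UNIV)"
      using flow_derivative[OF X_vf flow_nz[OF Y_vf z]] by (simp add: F_def has_vector_derivative_def)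
    show "((\<lambda>t. F s t) has_derivative blinfun_apply (blinfun_scaleR_left (\<i> *s X (F s t)))) (at t within UNIV)" for s t
      using flow_derivative[OF Y_vf flow_nz[OF X_vf z], of s t]
      by (simp add: F_def has_vector_derivative_def flows_commute[OF z] Y_apply)
    have "continuous_on UNIV (\<lambda>p. blinfun_scaleR_left (\<i> *s X (case p of (s, t) \<Rightarrow> F s t)))"
      by (intro bounded_linear.continuous_on[OF bounded_linear_blinfun_scaleR_left] continuous_intros
          continuous_on_compose2[OF cX] cont) (use Fnz in auto)
    then show "continuous (at (Re w, Im w) within UNIV \<times> UNIV) (\<lambda>(s, t). blinfun_scaleR_left (\<i> *s X (F s t)))"
      by (simp add: continuous_on_eq_continuous_at case_prod_beta')
  qed auto
  have P: "((\<lambda>w. (Re w, Im w)) has_derivative (\<lambda>h. (Re h, Im h))) (at w)"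
    by (auto intro!: derivative_eq_intros)
  have D': "((\<lambda>(s, t). F s t) has_derivative
      (\<lambda>(ts, tt). ts *\<^sub>R X (F (Re w) (Im w)) + tt *\<^sub>R (\<i> *s X (F (Re w) (Im w))))) (at (Re w, Im w))"
    using D by simp
  from has_derivative_compose[of "\<lambda>w. (Re w, Im w)" _ w UNIV "\<lambda>(s, t). F s t", OF P D']
  have "((\<lambda>w. F (Re w) (Im w)) has_derivative
      (\<lambda>h. Re h *\<^sub>R X (F (Re w) (Im w)) + Im h *\<^sub>R (\<i> *s X (F (Re w) (Im w))))) (at w)"
    by simp
  moreover have "Re h *\<^sub>R v + Im h *\<^sub>R (\<i> *s v) = h *s v" for h and v :: "complex ^ 'n"
    by (simp add: vec_eq_iff complex_eq_iff)
  ultimately show ?thesis by (simp add: cflow_def F_def)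
qed

lemma cflow_entire:
  assumes z: "z \<noteq> 0"
  shows "(\<lambda>w. cflow w z $ j) holomorphic_on UNIV"
proof (rule holomorphic_onI)
  fix w
  from bounded_linear.has_derivative[OF bounded_linear_vec_nth[of j] cflow_has_derivative[OF z, of w]]
  have "((\<lambda>w. cflow w z $ j) has_field_derivative X (cflow w z) $ j) (at w)"
    by (simp add: has_field_derivative_def mult.commute[of _ "X (cflow w z) $ j"])
  then show "(\<lambda>w. cflow w z $ j) field_differentiable at w within UNIV"
    using field_differentiable_def field_differentiable_at_within by blast
qed

lemma cflow_continuous: "z \<noteq> 0 \<Longrightarrow> continuous_on UNIV (\<lambda>w. cflow w z)"
  using has_derivative_continuous[OF cflow_has_derivative] by (intro continuous_at_imp_continuous_on) blast

subsection \<open>The height displacement is nearly linear\<close>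

definition displ :: "complex \<Rightarrow> complex ^ 'n \<Rightarrow> real" where
  "displ w z = height (cflow w z) - height z"

lemma displ_it: "z \<noteq> 0 \<Longrightarrow> displ w (it k z) = displ w z"
  by (simp add: displ_def cflow_it height_it cflow_nz)

lemma displ_cont: "continuous_on (- {0}) (displ w)"
  unfolding displ_def
  by (intro continuous_intros cont_height continuous_on_compose2[OF cont_height holo_on_imp_continuous_on[OF cflow_holo]])
     (use cflow_nz in \<open>auto simp: image_iff\<close>)

lemma displ_bounded: "\<exists>C. \<forall>z. z \<noteq> 0 \<longrightarrow> \<bar>displ w z\<bar> \<le> C"
proof -
  have "continuous_on shell (displ w)"
    by (rule continuous_on_subset[OF displ_cont]) (auto simp: shell_def)
  then have "bounded (displ w ` shell)" by (intro compact_imp_bounded compact_continuous_image compact_shell)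
  then obtain C where C: "\<And>z. z \<in> shell \<Longrightarrow> \<bar>displ w z\<bar> \<le> C" unfolding bounded_iff by auto
  have "\<bar>displ w z\<bar> \<le> C" if z: "z \<noteq> 0" for z
  proof -
    from z obtain k where "it k z \<in> shell" by (rule shell_cases)
    from C[OF this] show ?thesis by (simp add: displ_it[OF z])
  qed
  then show ?thesis by blast
qed

definition band :: "real \<Rightarrow> real \<Rightarrow> (complex ^ 'n) set set" where
  "band a b = hopf_class \<gamma> ` {z. z \<noteq> 0 \<and> a \<le> height z \<and> height z \<le> b}"

definition open_band :: "real \<Rightarrow> real \<Rightarrow> (complex ^ 'n) set set" where
  "open_band a b = hopf_class \<gamma> ` {z. z \<noteq> 0 \<and> a < height z \<and> height z < b}"

text \<open>
  A neighbourhood of the identity in the compact-open topology whose members move every point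
  by less than a quarter in height, for a suitable lift. The eight bands cover the heights from
  \<open>0\<close> to \<open>1\<close>, which represent all classes, and each may move by at most half its width.
\<close>

definition near_id :: "((complex ^ 'n) set \<Rightarrow> (complex ^ 'n) set) \<Rightarrow> bool" where
  "near_id F \<longleftrightarrow> (\<forall>j\<in>{..<8 :: nat}.
     F ` band (real j / 8) (real j / 8 + 1 / 8) \<subseteq> open_band (real j / 8 - 1 / 16) (real j / 8 + 3 / 16))"

lemma compactin_band: "compactin (hopf_topology \<gamma>) (band a b)"
  unfolding band_def by (intro compactin_class_image compact_height) auto

lemma openin_open_band: "openin (hopf_topology \<gamma>) (open_band a b)"
  unfolding open_band_def
proof (intro openin_class_image)
  have "open (- {0} \<inter> height -` {a<..<b})"
    by (rule continuous_open_preimage[OF cont_height]) auto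
  then show "open {z. z \<noteq> 0 \<and> a < height z \<and> height z < b}"
    by (rule back_subst[where P = "\<lambda>S. open S"]) auto
qed auto

lemma near_id_moves:
  assumes F: "near_id F" and z: "z \<noteq> 0"
  shows "\<exists>y. y \<noteq> 0 \<and> F (hopf_class \<gamma> z) = hopf_class \<gamma> y \<and> \<bar>height y - height z\<bar> < 1 / 4"
proof -
  obtain k where k: "0 \<le> height (it k z)" "height (it k z) < 1" by (rule normalize_height[OF z])
  define j where "j = nat \<lfloor>8 * height (it k z)\<rfloor>"
  have j: "real j \<le> 8 * height (it k z)" "8 * height (it k z) < real j + 1" and "j < 8"
    using k unfolding j_def by linarith+
  then have "hopf_class \<gamma> z \<in> band (real j / 8) (real j / 8 + 1 / 8)"
    unfolding band_def using z by (intro image_eqI[of _ _ "it k z"]) auto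
  then have "F (hopf_class \<gamma> z) \<in> open_band (real j / 8 - 1 / 16) (real j / 8 + 3 / 16)"
    using F \<open>j < 8\<close> unfolding near_id_def by blast
  then obtain y where y: "y \<noteq> 0" "F (hopf_class \<gamma> z) = hopf_class \<gamma> y"
    "real j / 8 - 1 / 16 < height y" "height y < real j / 8 + 3 / 16"
    unfolding open_band_def by auto
  have "\<bar>height (it (- k) y) - height z\<bar> < 1 / 4"
    using y(3,4) j height_it[OF z, of k] height_it[OF y(1), of "- k"] unfolding abs_less_iff of_int_minus
    by linarith
  then show ?thesis using y by (intro exI[of _ "it (- k) y"]) auto
qed

text \<open>Finitely many translates of this neighbourhood cover the torus.\<close>

lemma torus_cover:
  "\<exists>\<G>. finite \<G> \<and> \<G> \<subseteq> H \<and>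
     (\<forall>F\<in>H. \<exists>G\<in>\<G>. \<exists>F'. near_id F' \<and> (\<forall>p\<in>hopf \<gamma>. F p = F' (G p)))"
proof -
  let ?B = "BijGroup (hopf \<gamma>)"
  interpret B: group ?B by (rule group_BijGroup)
  have sub: "subgroup H ?B" using torus by (simp add: compact_torus_def)
  define tr where "tr G = {F \<in> hopf_aut \<gamma>. near_id (compose (hopf \<gamma>) F (inv\<^bsub>?B\<^esub> G))}" for G
  have band_sub: "band a b \<subseteq> hopf \<gamma>" for a b by (auto simp: band_def)
  have inv_in: "inv\<^bsub>?B\<^esub> G \<in> H" if "G \<in> H" for G using sub that by (rule subgroup.m_inv_closed)
  have op: "openin (hopf_aut_topology \<gamma>) (tr G)" if G: "G \<in> H" for G
  proof -
    let ?K = "\<lambda>j. (inv\<^bsub>?B\<^esub> G) ` band (real j / 8) (real j / 8 + 1 / 8)"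
    have "continuous_map (hopf_topology \<gamma>) (hopf_topology \<gamma>) (inv\<^bsub>?B\<^esub> G)"
      using H_aut[OF inv_in[OF G]] by (simp add: hopf_aut_def hopf_holo_def)
    then have "compactin (hopf_topology \<gamma>) (?K j)" for j
      by (rule image_compactin[OF compactin_band])
    then have "openin (hopf_aut_topology \<gamma>)
        (\<Inter>j\<in>{..<8 :: nat}. {F \<in> hopf_aut \<gamma>. F ` ?K j \<subseteq> open_band (real j / 8 - 1 / 16) (real j / 8 + 3 / 16)})"
      by (intro openin_INT2 openin_subbasic openin_open_band) (auto simp: lessThan_empty_iff)
    also have "(\<Inter>j\<in>{..<8 :: nat}. {F \<in> hopf_aut \<gamma>. F ` ?K j \<subseteq> open_band (real j / 8 - 1 / 16) (real j / 8 + 3 / 16)}) = tr G"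
    proof -
      have ceq: "compose (hopf \<gamma>) F (inv\<^bsub>?B\<^esub> G) ` band a b = F ` (inv\<^bsub>?B\<^esub> G) ` band a b" for F a b
        unfolding image_image using band_sub by (intro image_cong refl) (simp add: compose_eq subset_iff)
      moreover have "{..<8 :: nat} \<noteq> {}" by (auto simp: set_eq_iff intro: exI[of _ 0])
      ultimately show ?thesis unfolding tr_def near_id_def ceq by blast
    qed
    finally show ?thesis .
  qed
  have self: "G \<in> tr G" if G: "G \<in> H" for G
  proof -
    have car: "G \<in> carrier ?B" using sub G by (rule subgroup.mem_carrier)
    have "compose (hopf \<gamma>) G (inv\<^bsub>?B\<^esub> G) = G \<otimes>\<^bsub>?B\<^esub> inv\<^bsub>?B\<^esub> G"
      using car B.inv_closed[OF car] by (simp add: BijGroup_def)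
    also have "\<dots> = (\<lambda>p\<in>hopf \<gamma>. p)" using B.r_inv[OF car] by (simp add: BijGroup_def)
    finally have eq: "compose (hopf \<gamma>) G (inv\<^bsub>?B\<^esub> G) = (\<lambda>p\<in>hopf \<gamma>. p)" .
    have "near_id (\<lambda>p\<in>hopf \<gamma>. p)"
      unfolding near_id_def using band_sub by (force simp: band_def open_band_def)
    then show ?thesis using H_aut[OF G] by (simp add: tr_def eq)
  qed
  have "compactin (hopf_aut_topology \<gamma>) H" by (rule torus_compactin[OF torus])
  moreover have "H \<subseteq> \<Union> (tr ` H)" using self by blast
  moreover have "\<And>U. U \<in> tr ` H \<Longrightarrow> openin (hopf_aut_topology \<gamma>) U" using op by blast
  ultimately obtain \<F> where \<F>: "finite \<F>" "\<F> \<subseteq> tr ` H" "H \<subseteq> \<Union> \<F>"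
    unfolding compactin_def by metis
  then obtain \<G> where \<G>: "\<G> \<subseteq> H" "finite \<G>" "\<F> = tr ` \<G>"
    using finite_subset_image by metis
  have "\<exists>G\<in>\<G>. \<exists>F'. near_id F' \<and> (\<forall>p\<in>hopf \<gamma>. F p = F' (G p))" if F: "F \<in> H" for F
  proof -
    obtain G where G: "G \<in> \<G>" "F \<in> tr G" using \<F>(3) \<G>(3) F by blast
    let ?F' = "compose (hopf \<gamma>) F (inv\<^bsub>?B\<^esub> G)"
    have car: "G \<in> carrier ?B" using sub G \<G> by (auto intro: subgroup.mem_carrier)
    have "?F' (G p) = F p" if p: "p \<in> hopf \<gamma>" for p
    proof -
      have "(inv\<^bsub>?B\<^esub> G \<otimes>\<^bsub>?B\<^esub> G) p = p" using B.l_inv[OF car] p by (simp add: BijGroup_def)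
      moreover have "(inv\<^bsub>?B\<^esub> G \<otimes>\<^bsub>?B\<^esub> G) p = (inv\<^bsub>?B\<^esub> G) (G p)"
        using car B.inv_closed[OF car] p by (simp add: BijGroup_def compose_eq)
      moreover have "G p \<in> hopf \<gamma>" using hopf_aut_image[OF H_aut] G \<G> p by blast
      ultimately show ?thesis by (simp add: compose_eq)
    qed
    then show ?thesis using G by (intro bexI[of _ G] exI[of _ ?F']) (auto simp: tr_def)
  qed
  with \<G> show ?thesis by blast
qed

text \<open>
  Two flow maps in the same translate differ in height by an integer up to a bounded error;
  the integer is the same at all points since the punctured space is connected.
\<close>

lemma displ_uniform: "\<exists>C. \<forall>w. \<exists>m. \<forall>z. z \<noteq> 0 \<longrightarrow> \<bar>displ w z - m\<bar> \<le> C"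
proof -
  from torus_cover obtain \<G> where \<G>: "finite \<G>" "\<G> \<subseteq> H"
    "\<forall>F\<in>H. \<exists>G\<in>\<G>. \<exists>F'. near_id F' \<and> (\<forall>p\<in>hopf \<gamma>. F p = F' (G p))"
    by (elim exE conjE)
  define P where "P G w \<longleftrightarrow> (\<exists>F'. near_id F' \<and> (\<forall>p\<in>hopf \<gamma>. cflow_aut w p = F' (G p)))" for G w
  define wG where "wG G = (SOME w. P G w)" for G
  have P: "P G (wG G)" if "P G w" for G w unfolding wG_def by (rule someI[of _ w]) fact
  obtain B where B: "\<And>w z. z \<noteq> 0 \<Longrightarrow> \<bar>displ w z\<bar> \<le> B w" using displ_bounded by metis
  define C where "C = Max (insert 0 ((\<lambda>G. B (wG G)) ` \<G>)) + 1 / 2"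
  have "\<exists>m. \<forall>z. z \<noteq> 0 \<longrightarrow> \<bar>displ w z - m\<bar> \<le> C" for w
  proof -
    obtain G where G: "G \<in> \<G>" "P G w" using bspec[OF \<G>(3) cflow_aut_in[of w]] unfolding P_def by blast
    define w' where "w' = wG G"
    obtain F F' where F: "near_id F" "\<And>p. p \<in> hopf \<gamma> \<Longrightarrow> cflow_aut w p = F (G p)"
      and F': "near_id F'" "\<And>p. p \<in> hopf \<gamma> \<Longrightarrow> cflow_aut w' p = F' (G p)"
      using G(2) P[OF G(2)] unfolding P_def w'_def by blast
    define d where "d z = height (cflow w z) - height (cflow w' z)" for z
    have close: "\<exists>m :: int. \<bar>d z - m\<bar> < 1 / 2" if z: "z \<noteq> 0" for z
    proof -
      have "G (hopf_class \<gamma> z) \<in> hopf \<gamma>" using hopf_aut_image[OF H_aut] G \<G> z by blast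
      then obtain x where x: "x \<noteq> 0" "G (hopf_class \<gamma> z) = hopf_class \<gamma> x" by (rule hopf_cases)
      obtain y where y: "hopf_class \<gamma> (cflow w z) = hopf_class \<gamma> y" "\<bar>height y - height x\<bar> < 1 / 4"
        using near_id_moves[OF F(1) x(1)] F(2)[of "hopf_class \<gamma> z"] x z by (auto simp: cflow_aut_class)
      obtain y' where y': "hopf_class \<gamma> (cflow w' z) = hopf_class \<gamma> y'" "\<bar>height y' - height x\<bar> < 1 / 4"
        using near_id_moves[OF F'(1) x(1)] F'(2)[of "hopf_class \<gamma> z"] x z by (auto simp: cflow_aut_class)
      obtain k k' where "y = it k (cflow w z)" "y' = it k' (cflow w' z)"
        using y(1) y'(1) hopf_class_eq_iff by metis
      then have "height y = height (cflow w z) + of_int k" "height y' = height (cflow w' z) + of_int k'"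
        using z by (simp_all add: height_it cflow_nz)
      then have "\<bar>d z - of_int (k' - k)\<bar> < 1 / 2"
        using y(2) y'(2) unfolding d_def of_int_diff by linarith
      then show ?thesis by blast
    qed
    have conn: "connected (d ` (- {0}))"
    proof (intro connected_continuous_image)
      have "d = (\<lambda>z. displ w z - displ w' z)" by (simp add: d_def displ_def fun_eq_iff)
      then show "continuous_on (- {0}) d" by (simp add: continuous_intros displ_cont)
      have "1 \<le> CARD('n)" by (simp add: Suc_leI)
      then show "connected (- {0 :: complex ^ 'n})" by (intro connected_punctured_universe) simp
    qed
    have nz: "axis undefined 1 \<noteq> (0 :: complex ^ 'n)" by (simp add: axis_eq_0_iff)
    obtain m :: int where m: "\<bar>d (axis undefined 1) - m\<bar> < 1 / 2" using close[OF nz] by blast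
    have avoid: "of_int l + 1 / 2 \<notin> d ` (- {0})" for l :: int
    proof
      assume "of_int l + 1 / 2 \<in> d ` (- {0})"
      then obtain z where z: "z \<noteq> 0" "d z = of_int l + 1 / 2" by (metis ComplD image_iff singletonI)
      obtain i :: int where "\<bar>d z - i\<bar> < 1 / 2" using close[OF z(1)] by blast
      then have "real_of_int (- 1) < real_of_int (l - i)" "real_of_int (l - i) < real_of_int 0"
        using z(2) unfolding abs_less_iff of_int_diff by simp_all
      then have "- 1 < l - i" "l - i < 0" by (simp_all only: of_int_less_iff)
      then show False by simp
    qed
    have "\<bar>d z - m\<bar> \<le> 1 / 2" if z: "z \<noteq> 0" for z
    proof (rule ccontr)
      assume *: "\<not> \<bar>d z - m\<bar> \<le> 1 / 2"
      have mem: "d z \<in> d ` (- {0})" "d (axis undefined 1) \<in> d ` (- {0})" using z nz by auto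
      consider "of_int m + 1 / 2 \<le> d z" | "d z \<le> of_int (m - 1) + 1 / 2"
        using * unfolding abs_le_iff of_int_diff of_int_1 by linarith
      then show False
      proof cases
        case 1
        then have "of_int m + 1 / 2 \<in> {d (axis undefined 1)..d z}"
          using m unfolding atLeastAtMost_iff abs_less_iff by linarith
        then show False using connected_contains_Icc[OF conn mem(2,1)] avoid by blast
      next
        case 2
        then have "of_int (m - 1) + 1 / 2 \<in> {d z..d (axis undefined 1)}"
          using m unfolding atLeastAtMost_iff abs_less_iff of_int_diff of_int_1 by linarith
        then show False using connected_contains_Icc[OF conn mem] avoid by blast
      qed
    qed
    moreover have "\<bar>displ w' z\<bar> \<le> C - 1 / 2" if z: "z \<noteq> 0" for z
    proof -
      have "B w' \<le> C - 1 / 2" unfolding C_def w'_def using \<G>(1) G(1) by (auto intro!: Max_ge)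
      with B[OF z, of w'] show ?thesis by linarith
    qed
    ultimately have "\<bar>displ w z - m\<bar> \<le> C" if "z \<noteq> 0" for z
      using that unfolding d_def displ_def by (smt (verit, best))
    then show ?thesis by blast
  qed
  then show ?thesis by blast
qed

text \<open>
  The displacement is a cocycle over the flow. As it hardly depends on the point, it is
  quasi-additive in time, and Hyers' theorem applies.
\<close>

theorem displ_linear: "\<exists>a C. \<forall>w z. z \<noteq> 0 \<longrightarrow> \<bar>displ w z - Re (a * w)\<bar> \<le> C"
proof -
  obtain C m where C: "\<And>w z. z \<noteq> 0 \<Longrightarrow> \<bar>displ w z - m w\<bar> \<le> C" using displ_uniform by metis
  define z0 :: "complex ^ 'n" where "z0 = axis undefined 1"
  have z0: "z0 \<noteq> 0" by (simp add: z0_def axis_eq_0_iff)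
  have cocycle: "displ (w + w') z0 = displ w (cflow w' z0) + displ w' z0" for w w'
    by (simp add: displ_def cflow_add[OF z0])
  have "\<bar>displ (w + w') z0 - displ w z0 - displ w' z0\<bar> \<le> 2 * C" for w w'
    using cocycle[of w w'] C[OF z0, of w] C[OF cflow_nz[OF z0], of w w'] by linarith
  moreover have "continuous_on UNIV (\<lambda>w. displ w z0)"
    unfolding displ_def
    by (intro continuous_intros continuous_on_compose2[OF cont_height cflow_continuous[OF z0]])
       (use cflow_nz[OF z0] in \<open>auto simp: image_iff\<close>)
  ultimately have "\<exists>a D. \<forall>w. \<bar>displ w z0 - Re (a * w)\<bar> \<le> D"
    by (rule quasi_additive_complex)
  then obtain a D where D: "\<And>w. \<bar>displ w z0 - Re (a * w)\<bar> \<le> D" by blast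
  have "\<bar>displ w z - Re (a * w)\<bar> \<le> D + 2 * C" if "z \<noteq> 0" for w z
    using C[OF that, of w] C[OF z0, of w] D[of w] by linarith
  then show ?thesis by blast
qed

text \<open>
  A height bounded below keeps an orbit of the complex flow in a ball, and then the orbit is
  constant by Liouville's theorem.
\<close>

lemma X_zero:
  assumes "\<And>w z. z \<noteq> 0 \<Longrightarrow> \<bar>displ w z\<bar> \<le> C"
  shows "X = (\<lambda>z. 0)"
proof
  fix z
  show "X z = 0"
  proof (cases "z = 0")
    case False
    obtain R where R: "\<And>y. y \<noteq> 0 \<Longrightarrow> height z - C \<le> height y \<Longrightarrow> norm y \<le> R"
      using height_bounded by blast
    have "norm (cflow w z) \<le> R" for w
      using assms[OF False, of w] by (intro R cflow_nz[OF False]) (simp add: displ_def)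
    then have "cflow w z = z" for w
      using Liouville_curve[of "\<lambda>w. cflow w z", OF cflow_entire[OF False]] cflow_0[OF False] by metis
    then have "((\<lambda>w. z) has_derivative (\<lambda>h. h *s X z)) (at (0 :: complex))"
      using cflow_has_derivative[OF False, of 0] by simp
    moreover have "((\<lambda>w. z) has_derivative (\<lambda>h. 0)) (at (0 :: complex))" by simp
    ultimately have "(\<lambda>h. h *s X z) = (\<lambda>h. 0)" by (rule has_derivative_unique)
    then show ?thesis by (metis vector_smult_lid)
  qed (simp add: vf_0[OF X_vf])
qed

end

section \<open>Commuting power-bounded operators\<close>

definition complex_linear :: "(complex ^ 'n \<Rightarrow> complex ^ 'n) \<Rightarrow> bool" where
  "complex_linear g \<longleftrightarrow> (\<forall>x y. g (x + y) = g x + g y) \<and> (\<forall>c x. g (c *s x) = c *s g x)"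

lemma complex_linear_add: "complex_linear g \<Longrightarrow> g (x + y) = g x + g y"
  and complex_linear_scale: "complex_linear g \<Longrightarrow> g (c *s x) = c *s g x"
  by (simp_all add: complex_linear_def)

lemma complex_linear_0: "complex_linear g \<Longrightarrow> g 0 = 0"
  using complex_linear_scale[of g 0 0] by simp

lemma complex_linear_diff:
  assumes "complex_linear g"
  shows "g (x - y) = g x - g y"
proof -
  have "g ((x - y) + y) = g (x - y) + g y" by (rule complex_linear_add[OF assms])
  then show ?thesis by simp
qed

lemma complex_linear_sum: "complex_linear g \<Longrightarrow> g (\<Sum>i\<in>S. f i) = (\<Sum>i\<in>S. g (f i))"
  by (induction S rule: infinite_finite_induct) (simp_all add: complex_linear_0 complex_linear_add)

lemma complex_linear_imp_linear: "complex_linear g \<Longrightarrow> Vector_Spaces.linear (*s) (*s) g"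
  unfolding complex_linear_def Vector_Spaces.linear_iff
  using vec.vector_space_axioms by auto

lemma complex_linear_imp_bounded: "complex_linear g \<Longrightarrow> bounded_linear g"
  unfolding linear_conv_bounded_linear[symmetric]
  by (rule linearI) (simp_all add: complex_linear_add complex_linear_scale scaleR_smult)

lemma span_image_lessThan:
  "x \<in> vec.span (f ` {..<m :: nat}) \<Longrightarrow> \<exists>u. x = (\<Sum>i<m. u i *s (f i :: complex ^ 'n))"
proof (induction m arbitrary: x)
  case (Suc m)
  have "f ` {..<Suc m} = insert (f m) (f ` {..<m})" by (auto simp: less_Suc_eq)
  then obtain k where "x - k *s f m \<in> vec.span (f ` {..<m})"
    using Suc.prems by (auto simp: vec.span_insert)
  from Suc.IH[OF this] obtain u where u: "x - k *s f m = (\<Sum>i<m. u i *s f i)" by blast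
  have "x = (\<Sum>i<Suc m. (u(m := k)) i *s f i)" using u by (simp add: algebra_simps)
  then show ?case by blast
qed simp

lemma iterates_dependent:
  "\<exists>m. f m \<in> vec.span (f ` {..<m :: nat})" for f :: "nat \<Rightarrow> complex ^ 'n"
proof (rule ccontr)
  assume *: "\<nexists>m. f m \<in> vec.span (f ` {..<m})"
  have "vec.dim (f ` {..<m}) = m" for m
  proof (induction m)
    case (Suc m)
    have "f ` {..<Suc m} = insert (f m) (f ` {..<m})" by (auto simp: less_Suc_eq)
    then show ?case using Suc * by (simp add: vec.dim_insert)
  qed (simp add: vec.dim_eq_0)
  from this[of "Suc CARD('n)"] vec.dim_subset[of "f ` {..<Suc CARD('n)}" UNIV]
  show False unfolding vec_dim_card by simp
qed

definition poly_act :: "(complex ^ 'n \<Rightarrow> complex ^ 'n) \<Rightarrow> complex poly \<Rightarrow> complex ^ 'n \<Rightarrow> complex ^ 'n" where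
  "poly_act g p v = (\<Sum>i\<le>degree p. poly.coeff p i *s (g ^^ i) v)"

lemma poly_act_bound:
  assumes "degree p \<le> N"
  shows "poly_act g p v = (\<Sum>i\<le>N. poly.coeff p i *s (g ^^ i) v)"
  unfolding poly_act_def
  using assms by (intro sum.mono_neutral_left) (auto simp: coeff_eq_0)

lemma poly_act_linear_factor:
  assumes g: "complex_linear g"
  shows "poly_act g ([:- a, 1:] * q) v = g (poly_act g q v) - a *s poly_act g q v"
proof -
  define N where "N = Suc (degree q)"
  have "poly_act g ([:- a, 1:] * q) v = (\<Sum>i\<le>Suc N. poly.coeff ([:- a, 1:] * q) i *s (g ^^ i) v)"
    by (rule poly_act_bound, rule order_trans[OF degree_mult_le]) (simp add: N_def)
  also have "\<dots> = (\<Sum>i\<le>Suc N. poly.coeff (pCons 0 q) i *s (g ^^ i) v) - (\<Sum>i\<le>Suc N. a *s (poly.coeff q i *s (g ^^ i) v))"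
    by (simp add: sum_subtractf[symmetric] algebra_simps vector_smult_assoc del: sum.atMost_Suc)
  also have "(\<Sum>i\<le>Suc N. poly.coeff (pCons 0 q) i *s (g ^^ i) v) = (\<Sum>i\<le>N. poly.coeff q i *s g ((g ^^ i) v))"
    by (subst sum.atMost_Suc_shift) (simp)
  also have "\<dots> = g (poly_act g q v)"
    using poly_act_bound[of q N g v] g
    by (simp add: N_def complex_linear_sum complex_linear_scale del: sum.atMost_Suc)
  also have "(\<Sum>i\<le>Suc N. a *s (poly.coeff q i *s (g ^^ i) v)) = a *s poly_act g q v"
    using poly_act_bound[of q "Suc N" g v]
    by (simp add: N_def vec.scale_sum_right del: sum.atMost_Suc)
  finally show ?thesis .
qed

text \<open>
  Factors \<open>[:- a, 1:]\<close> are split off one at a time; the first product of the remaining ones that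
  does not annihilate \<open>v\<close> maps it to an eigenvector.
\<close>

lemma annihilated_imp_eigenvector:
  assumes g: "complex_linear g" and v: "v \<noteq> 0" and W: "vec.subspace W" "v \<in> W" "\<And>x. x \<in> W \<Longrightarrow> g x \<in> W"
  shows "p \<noteq> 0 \<Longrightarrow> poly_act g p v = 0 \<Longrightarrow> \<exists>a u. u \<in> W \<and> u \<noteq> 0 \<and> g u = a *s u"
proof (induction "degree p" arbitrary: p rule: less_induct)
  case less
  show ?case
  proof (cases "degree p = 0")
    case True
    then obtain c where "p = [:c:]" by (rule degree_eq_zeroE)
    then show ?thesis using less.prems v by (simp add: poly_act_def)
  next
    case False
    then have "\<not> constant (poly p)" by (simp add: constant_degree)
    then obtain a where "poly p a = 0"
      using Fundamental_Theorem_Algebra.fundamental_theorem_of_algebra by blast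
    then obtain q where q: "p = [:- a, 1:] * q" by (auto simp: poly_eq_0_iff_dvd)
    show ?thesis
    proof (cases "poly_act g q v = 0")
      case True
      have "q \<noteq> 0" using q less.prems by auto
      moreover from this have "degree q < degree p" unfolding q by (subst degree_mult_eq) auto
      ultimately show ?thesis using less.hyps True by blast
    next
      case False
      have "(g ^^ i) v \<in> W" for i by (induction i) (use W in auto)
      then have "poly_act g q v \<in> W"
        unfolding poly_act_def by (intro vec.subspace_sum vec.subspace_scale W)
      moreover have "g (poly_act g q v) = a *s poly_act g q v"
        using poly_act_linear_factor[OF g, of a q v] less.prems q by simp
      ultimately show ?thesis using False by blast
    qed
  qed
qed

lemma invariant_subspace_eigenvector:
  assumes g: "complex_linear g" and W: "vec.subspace W" "v \<in> W" "v \<noteq> 0" "\<And>x. x \<in> W \<Longrightarrow> g x \<in> W"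
  shows "\<exists>a u. u \<in> W \<and> u \<noteq> 0 \<and> g u = a *s u"
proof -
  obtain m where m: "(g ^^ m) v \<in> vec.span ((\<lambda>i. (g ^^ i) v) ` {..<m})"
    using iterates_dependent[of "\<lambda>i. (g ^^ i) v"] by blast
  obtain u where u: "(g ^^ m) v = (\<Sum>i<m. u i *s (g ^^ i) v)"
    using span_image_lessThan[OF m] by blast
  define p where "p = monom 1 m - (\<Sum>i<m. monom (u i) i)"
  have c: "poly.coeff p i = (if i = m then 1 else if i < m then - u i else 0)" for i
    by (simp add: p_def coeff_sum sum.delta)
  have "p \<noteq> 0" using c[of m] by auto
  moreover have "degree p \<le> m" by (rule degree_le) (simp add: c)
  then have "poly_act g p v = (\<Sum>i\<le>m. poly.coeff p i *s (g ^^ i) v)" by (rule poly_act_bound)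
  then have "poly_act g p v = 0" by (simp add: c u lessThan_Suc_atMost[symmetric] sum_negf)
  ultimately show ?thesis using annihilated_imp_eigenvector[OF g W(3,1,2,4)] by blast
qed

text \<open>
  There are no Jordan blocks: a generalized eigenvector of rank two is an eigenvector.
\<close>

definition semisimple :: "(complex ^ 'n \<Rightarrow> complex ^ 'n) \<Rightarrow> bool" where
  "semisimple g \<longleftrightarrow> (\<forall>a x. g (g x - a *s x) = a *s (g x - a *s x) \<longrightarrow> g x = a *s x)"

text \<open>
  The bounds force every eigenvalue to have modulus one, and the powers of a nontrivial Jordan
  block of such an eigenvalue grow linearly.
\<close>

lemma power_bounded_semisimple:
  assumes g: "complex_linear g"
    and K: "\<And>k v. norm ((g ^^ k) v) \<le> K * norm v" "\<And>k v. norm v \<le> K * norm ((g ^^ k) v)"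
  shows "semisimple g"
  unfolding semisimple_def
proof (intro allI impI)
  fix a x assume u: "g (g x - a *s x) = a *s (g x - a *s x)"
  define u where "u = g x - a *s x"
  have gu: "(g ^^ k) u = a ^ k *s u" for k
    by (induction k) (use u in \<open>simp_all add: u_def[symmetric] complex_linear_scale[OF g] vector_smult_assoc\<close>)
  have gx: "g x = a *s x + u" by (simp add: u_def)
  have gk: "(g ^^ Suc k) x = a ^ Suc k *s x + (of_nat (Suc k) * a ^ k) *s u" for k
  proof (induction k)
    case (Suc k)
    have "(g ^^ Suc (Suc k)) x = g (a ^ Suc k *s x + (of_nat (Suc k) * a ^ k) *s u)"
      using Suc by simp
    also have "\<dots> = a ^ Suc k *s (a *s x + u) + (of_nat (Suc k) * a ^ k) *s (a *s u)"
      using gu[of 1] by (simp add: complex_linear_add[OF g] complex_linear_scale[OF g] gx del: power_Suc of_nat_Suc)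
    also have "\<dots> = a ^ Suc (Suc k) *s x + (of_nat (Suc (Suc k)) * a ^ Suc k) *s u"
      by (simp add: vec_eq_iff algebra_simps)
    finally show ?case .
  qed (simp add: gx)
  show "g x = a *s x"
  proof (rule ccontr)
    assume "g x \<noteq> a *s x"
    then have u0: "0 < norm u" by (simp add: u_def)
    have le: "cmod a ^ k \<le> K" "1 \<le> K * cmod a ^ k" for k
      using K(1)[of k u] K(2)[of u k] u0 by (simp_all add: gu norm_smult norm_power)
    have "cmod a \<le> 1"
    proof (rule ccontr)
      assume "\<not> cmod a \<le> 1"
      then obtain k where "K < cmod a ^ k" using real_arch_pow[of "cmod a" K] by auto
      with le(1)[of k] show False by simp
    qed
    moreover have "1 \<le> cmod a"
    proof (rule ccontr)
      assume a: "\<not> 1 \<le> cmod a"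
      have K0: "0 < K" using le(1)[of 0] by simp
      obtain k where "cmod a ^ k < 1 / K" using real_arch_pow_inv[of "1 / K" "cmod a"] a K0 by auto
      then show False using le(2)[of k] K0 by (simp add: field_simps)
    qed
    ultimately have a1: "cmod a = 1" by simp
    have "real (Suc k) * norm u \<le> (K + 1) * norm x" for k
    proof -
      have "real (Suc k) * norm u = norm ((of_nat (Suc k) * a ^ k) *s u)"
        by (simp add: norm_smult norm_mult norm_power a1 del: of_nat_Suc)
      also have "\<dots> = norm ((g ^^ Suc k) x - a ^ Suc k *s x)" unfolding gk by simp
      also have "\<dots> \<le> norm ((g ^^ Suc k) x) + norm (a ^ Suc k *s x)" by (rule norm_triangle_ineq4)
      also have "\<dots> \<le> K * norm x + norm x" using K(1)[of "Suc k" x] by (simp add: norm_smult norm_power norm_mult a1)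
      finally show ?thesis by (simp add: algebra_simps)
    qed
    moreover obtain k where "(K + 1) * norm x / norm u < real k" using reals_Archimedean2 by blast
    ultimately have "real (Suc k) * norm u \<le> (K + 1) * norm x" "(K + 1) * norm x < real k * norm u"
      using u0 by (auto simp: field_simps)
    then show False using u0 by (simp add: algebra_simps)
  qed
qed

definition joint_eigenvector :: "(complex ^ 'n \<Rightarrow> complex ^ 'n) set \<Rightarrow> complex ^ 'n \<Rightarrow> bool" where
  "joint_eigenvector \<F> v \<longleftrightarrow> (\<forall>g\<in>\<F>. \<exists>a. g v = a *s v)"

text \<open>
  If some member of the family is not a scalar on an invariant subspace, the subspace splits
  into an eigenspace and the corresponding image, both proper and invariant.
\<close>

lemma joint_eigenvectors_span:
  assumes lin: "\<And>g. g \<in> \<F> \<Longrightarrow> complex_linear g" and ss: "\<And>g. g \<in> \<F> \<Longrightarrow> semisimple g"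
    and comm: "\<And>f g x. f \<in> \<F> \<Longrightarrow> g \<in> \<F> \<Longrightarrow> f (g x) = g (f x)"
  shows "vec.subspace W \<Longrightarrow> (\<And>g x. g \<in> \<F> \<Longrightarrow> x \<in> W \<Longrightarrow> g x \<in> W) \<Longrightarrow>
    W \<subseteq> vec.span {v. joint_eigenvector \<F> v}"
proof (induction "vec.dim W" arbitrary: W rule: less_induct)
  case less
  show ?case
  proof (cases "\<forall>g\<in>\<F>. \<exists>a. \<forall>x\<in>W. g x = a *s x")
    case True
    then have "W \<subseteq> {v. joint_eigenvector \<F> v}" by (auto simp: joint_eigenvector_def)
    then show ?thesis using vec.span_superset by blast
  next
    case False
    then obtain g where g: "g \<in> \<F>" "\<And>a. \<exists>x\<in>W. g x \<noteq> a *s x" by blast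
    note gl = lin[OF g(1)]
    obtain x0 where "x0 \<in> W" "g x0 \<noteq> 0 *s x0" using g(2) by blast
    then have "x0 \<in> W" "x0 \<noteq> 0" using complex_linear_0[OF gl] by auto
    with invariant_subspace_eigenvector[OF gl less.prems(1)] less.prems(2)[OF g(1)]
    obtain a u where u: "u \<in> W" "u \<noteq> 0" "g u = a *s u" by blast
    define N where "N x = g x - a *s x" for x
    have N: "complex_linear N"
      unfolding complex_linear_def N_def
      by (auto simp: complex_linear_add[OF gl] complex_linear_scale[OF gl] vec.scale_right_distrib
          vec.scale_right_diff_distrib vector_smult_assoc mult.commute)
    note Nl = complex_linear_imp_linear[OF N]
    define W1 where "W1 = {x \<in> W. N x = 0}"
    define W2 where "W2 = N ` W"
    have NW: "N x \<in> W" if "x \<in> W" for x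
      unfolding N_def using that less.prems(1) less.prems(2)[OF g(1)]
      by (intro vec.subspace_diff vec.subspace_scale)
    have s1: "vec.subspace W1"
      using less.prems(1) unfolding W1_def vec.subspace_def
      by (auto simp: complex_linear_0[OF N] complex_linear_add[OF N] complex_linear_scale[OF N])
    have s2: "vec.subspace W2"
      unfolding W2_def vec.subspace_def
    proof (intro conjI ballI allI)
      show "0 \<in> N ` W" using complex_linear_0[OF N] vec.subspace_0[OF less.prems(1)] by force
      show "x + y \<in> N ` W" if "x \<in> N ` W" "y \<in> N ` W" for x y
        using that vec.subspace_add[OF less.prems(1)] by (auto simp: complex_linear_add[OF N, symmetric])
      show "c *s x \<in> N ` W" if "x \<in> N ` W" for c x
        using that vec.subspace_scale[OF less.prems(1)] by (auto simp: complex_linear_scale[OF N, symmetric])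
    qed
    have sub1: "W1 \<subseteq> W" and sub2: "W2 \<subseteq> W" using NW by (auto simp: W1_def W2_def)
    have ker: "x = 0" if "x \<in> W2" "N x = 0" for x
    proof -
      from that(1) obtain y where y: "y \<in> W" "x = N y" unfolding W2_def by blast
      then have "g (g y - a *s y) = a *s (g y - a *s y)" using that(2) by (simp add: N_def)
      then have "g y = a *s y" using ss[OF g(1)] unfolding semisimple_def by blast
      with y show ?thesis by (simp add: N_def)
    qed
    have inj2: "inj_on N (vec.span W2)"
    proof (rule inj_onI)
      fix x y assume xy: "x \<in> vec.span W2" "y \<in> vec.span W2" "N x = N y"
      have "x \<in> W2" "y \<in> W2" using xy s2 vec.span_eq_iff by blast+
      then have "x - y \<in> W2" using s2 vec.subspace_diff by blast
      moreover have "N (x - y) = 0" using xy(3) by (simp add: complex_linear_diff[OF N])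
      ultimately show "x = y" using ker by force
    qed
    have "N ` W2 = W2"
    proof (rule vec.subspace_dim_equal)
      show "vec.subspace (N ` W2)" using vec.linear_subspace_image[OF Nl s2] .
      show "N ` W2 \<subseteq> W2" using sub2 by (auto simp: W2_def)
      show "vec.dim W2 \<le> vec.dim (N ` W2)" using vec.dim_image_eq[OF Nl inj2] by simp
    qed (rule s2)
    have split: "W \<subseteq> {x + y |x y. x \<in> W1 \<and> y \<in> W2}"
    proof
      fix x assume x: "x \<in> W"
      then have "N x \<in> N ` W2" using \<open>N ` W2 = W2\<close> by (auto simp: W2_def)
      then obtain y where y: "y \<in> W2" "N x = N y" by blast
      have "x - y \<in> W1"
        using x y sub2 vec.subspace_diff[OF less.prems(1)] by (auto simp: W1_def complex_linear_diff[OF N])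
      then show "x \<in> {x + y |x y. x \<in> W1 \<and> y \<in> W2}" using y(1) by force
    qed
    have inv: "f (N x) = N (f x)" if "f \<in> \<F>" for f x
      using comm[OF that g(1)] lin[OF that] by (simp add: N_def complex_linear_diff complex_linear_scale)
    have dimW: "vec.dim V < vec.dim W" if "vec.subspace V" "V \<subseteq> W" "V \<noteq> W" for V
      using that less.prems(1) by (metis psubsetI vec.dim_psubset vec.span_eq_iff)
    have "W1 \<subseteq> vec.span {v. joint_eigenvector \<F> v}"
    proof (rule less.hyps[OF dimW[OF s1 sub1] s1])
      obtain x where "x \<in> W" "g x \<noteq> a *s x" using g(2) by blast
      then show "W1 \<noteq> W" by (auto simp: W1_def N_def)
      show "f x \<in> W1" if "f \<in> \<F>" "x \<in> W1" for f x
        using that less.prems(2) inv[OF that(1), of x, symmetric] complex_linear_0[OF lin[OF that(1)]]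
        by (auto simp: W1_def)
    qed
    moreover have "W2 \<subseteq> vec.span {v. joint_eigenvector \<F> v}"
    proof (rule less.hyps[OF dimW[OF s2 sub2] s2])
      have "N u = 0" using u by (simp add: N_def)
      then show "W2 \<noteq> W" using ker u by blast
      show "f x \<in> W2" if "f \<in> \<F>" "x \<in> W2" for f x
        using that less.prems(2) inv[OF that(1)] by (auto simp: W2_def)
    qed
    ultimately show ?thesis using split vec.span_add by blast
  qed
qed

lemma joint_eigenbasis:
  fixes \<F> :: "(complex ^ 'n \<Rightarrow> complex ^ 'n) set"
  assumes lin: "\<And>g. g \<in> \<F> \<Longrightarrow> complex_linear g" and ss: "\<And>g. g \<in> \<F> \<Longrightarrow> semisimple g"
    and comm: "\<And>f g x. f \<in> \<F> \<Longrightarrow> g \<in> \<F> \<Longrightarrow> f (g x) = g (f x)"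
  shows "\<exists>e. (\<forall>j :: 'n. joint_eigenvector \<F> (e j)) \<and> bij (\<lambda>x. \<Sum>j\<in>UNIV. x $ j *s e j)"
proof -
  have UN: "vec.span {v. joint_eigenvector \<F> v} = UNIV"
  proof -
    have "UNIV \<subseteq> vec.span {v. joint_eigenvector \<F> v}"
      by (rule joint_eigenvectors_span) (erule lin, erule ss, erule (1) comm, simp_all)
    then show ?thesis by auto
  qed
  obtain B where B: "B \<subseteq> {v. joint_eigenvector \<F> v}" "vec.independent B"
    "{v. joint_eigenvector \<F> v} \<subseteq> vec.span B" "card B = vec.dim {v. joint_eigenvector \<F> v}"
    by (rule vec.basis_exists)
  have sB: "vec.span B = UNIV"
    using vec.span_mono[OF B(3)] UN unfolding vec.span_span by blast
  have fB: "finite B" using B(2) by (rule vec.finiteI_independent)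
  have "vec.dim {v. joint_eigenvector \<F> v} = vec.dim (UNIV :: (complex ^ 'n) set)"
    using UN vec.dim_span by metis
  then have cB: "card B = CARD('n)" using B(4) by (simp only: vec_dim_card)
  then obtain e where e: "bij_betw e (UNIV :: 'n set) B"
    using fB finite_same_card_bij[of "UNIV :: 'n set" B] by auto
  define Q where "Q x = (\<Sum>j\<in>UNIV. x $ j *s e j)" for x :: "complex ^ 'n"
  have sum_B: "(\<Sum>v\<in>B. c v *s v) = Q (\<chi> j. c (e j))" for c
    unfolding Q_def using sum.reindex_bij_betw[OF e, of "\<lambda>v. c v *s v"] by simp
  have "\<exists>x. y = Q x" for y
  proof -
    have "y \<in> range (\<lambda>u. \<Sum>v\<in>B. u v *s v)" unfolding vec.span_finite[OF fB, symmetric] sB by simp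
    then obtain u where "y = (\<Sum>v\<in>B. u v *s v)" by blast
    then show ?thesis unfolding sum_B by blast
  qed
  then have "surj Q" by (simp add: surj_def)
  moreover have "inj Q"
  proof (rule injI)
    fix x y assume "Q x = Q y"
    define ei where "ei = inv_into UNIV e"
    have ei: "ei (e j) = j" for j using e by (simp add: ei_def bij_betw_def)
    have "Q (\<chi> j. x $ ei (e j) - y $ ei (e j)) = 0"
      using \<open>Q x = Q y\<close> by (simp add: Q_def ei vec.scale_left_diff_distrib sum_subtractf)
    then have sum0: "(\<Sum>v\<in>B. (x $ ei v - y $ ei v) *s v) = 0" using sum_B[of "\<lambda>v. x $ ei v - y $ ei v"] by simp
    have "x $ ei v - y $ ei v = 0" if "v \<in> B" for v
      using vec.independentD[OF B(2) fB subset_refl sum0 that] .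
    then have "x $ j = y $ j" for j using ei[of j] e by (metis bij_betw_apply eq_iff_diff_eq_0 UNIV_I)
    then show "x = y" by (simp add: vec_eq_iff)
  qed
  ultimately have "bij Q" by (simp add: bij_def)
  moreover have "joint_eigenvector \<F> (e j)" for j using e B(1) by (auto simp: bij_betw_def)
  ultimately show ?thesis unfolding Q_def by blast
qed

section \<open>Linearization at the fixed point\<close>

lemma holo_complex_linear: "complex_linear L \<Longrightarrow> holo_on S L"
  unfolding holo_on_def
  by (metis bounded_linear_imp_has_derivative complex_linear_imp_bounded complex_linear_scale)

lemma frechet_complex_linear:
  assumes "holo_on U f" "z \<in> U"
  shows "complex_linear (frechet_derivative f (at z))"
  unfolding complex_linear_def
  using holo_on_frechet[OF assms] bounded_linear.linear[OF has_derivative_bounded_linear] linear_add by metis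

lemma holo_on_add:
  assumes "holo_on S f" "holo_on S g"
  shows "holo_on S (\<lambda>z. f z + g z)"
  unfolding holo_on_def
proof
  fix z assume z: "z \<in> S"
  note f = holo_on_frechet[OF assms(1) z] and g = holo_on_frechet[OF assms(2) z]
  show "\<exists>D. ((\<lambda>z. f z + g z) has_derivative D) (at z) \<and> (\<forall>c v. D (c *s v) = c *s D v)"
    using has_derivative_add[OF f(1) g(1)]
    by (intro exI[of _ "\<lambda>v. frechet_derivative f (at z) v + frechet_derivative g (at z) v"])
      (simp add: f(2) g(2) vec.scale_right_distrib)
qed

lemma holo_on_const: "holo_on S (\<lambda>z. c)"
  unfolding holo_on_def by (intro ballI exI[of _ "\<lambda>v. 0"]) auto

lemma holo_on_sum: "(\<And>i. i \<in> I \<Longrightarrow> holo_on S (f i)) \<Longrightarrow> holo_on S (\<lambda>z. \<Sum>i\<in>I. f i z)"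
  by (induction I rule: infinite_finite_induct) (auto intro: holo_on_add holo_on_const)

lemma holo_on_scale: "holo_on S f \<Longrightarrow> holo_on S (\<lambda>z. c *s f z)"
  by (rule holo_on_compose[where g = "\<lambda>x. c *s x" and T = UNIV])
     (auto intro!: holo_complex_linear simp: complex_linear_def vec.scale_right_distrib mult.commute)

lemma shifted_sums:
  fixes a :: "nat \<Rightarrow> 'a::real_normed_vector"
  assumes "\<And>l. norm (a l) \<le> B"
  shows "norm ((\<Sum>l<M. a (l + k)) - (\<Sum>l<M. a l)) \<le> 2 * real k * B"
  using assms
proof (induction k arbitrary: a)
  case (Suc k)
  have "norm ((\<Sum>l<M. a (Suc l + k)) - (\<Sum>l<M. a (Suc l))) \<le> 2 * real k * B"
    using Suc.IH[of "\<lambda>l. a (Suc l)"] Suc.prems by simp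
  moreover have "(\<Sum>l<M. a (Suc l)) - (\<Sum>l<M. a l) = a M - a 0"
    by (simp add: sum_subtractf[symmetric] sum_lessThan_telescope)
  then have "norm ((\<Sum>l<M. a (Suc l)) - (\<Sum>l<M. a l)) \<le> 2 * B"
    using norm_triangle_ineq4[of "a M" "a 0"] Suc.prems[of M] Suc.prems[of 0] by simp
  ultimately have "norm (((\<Sum>l<M. a (Suc l + k)) - (\<Sum>l<M. a (Suc l))) + ((\<Sum>l<M. a (Suc l)) - (\<Sum>l<M. a l)))
      \<le> 2 * real k * B + 2 * B"
    by (intro norm_triangle_le) linarith
  then show ?case by (simp add: algebra_simps)
qed simp

context hopf_contraction
begin

lemma height_large_small:
  assumes "0 < \<eta>"
  shows "\<exists>c. \<forall>z. z \<noteq> 0 \<and> c \<le> height z \<longrightarrow> norm z < \<eta>"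
proof -
  obtain R where R: "\<And>z. z \<noteq> 0 \<Longrightarrow> 0 \<le> height z \<Longrightarrow> norm z \<le> R" using height_bounded by blast
  obtain N where N: "\<And>m z. N \<le> m \<Longrightarrow> norm z \<le> R \<Longrightarrow> norm ((\<gamma> ^^ m) z) < \<eta>"
    using iterates_small[OF assms] by blast
  have "norm z < \<eta>" if z: "z \<noteq> 0" "real N \<le> height z" for z
  proof -
    have "norm (it (- int N) z) \<le> R" using z height_it[OF z(1), of "- int N"] by (intro R) auto
    from N[OF order_refl this] show ?thesis by (simp flip: it_of_nat)
  qed
  then show ?thesis by blast
qed

end

text \<open>
  The complex flow with its time normalized, extended to the origin. All that matters about it is
  that it commutes with \<open>\<gamma>\<close>, is holomorphic in both arguments and changes the height nearly by
  the real part of the time.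
\<close>

locale entire_flow = hopf_contraction \<gamma> for \<gamma> :: "complex ^ 'n \<Rightarrow> complex ^ 'n" +
  fixes \<Theta> :: "complex \<Rightarrow> complex ^ 'n \<Rightarrow> complex ^ 'n" and C :: real
  assumes \<Theta>_zero: "\<Theta> w 0 = 0" and \<Theta>_nz: "z \<noteq> 0 \<Longrightarrow> \<Theta> w z \<noteq> 0"
    and \<Theta>_0: "\<Theta> 0 z = z" and \<Theta>_add: "\<Theta> (w + w') z = \<Theta> w (\<Theta> w' z)"
    and \<Theta>_it: "\<Theta> w (it k z) = it k (\<Theta> w z)"
    and \<Theta>_holo: "holo_on (- {0}) (\<Theta> w)"
    and \<Theta>_entire: "(\<lambda>w. \<Theta> w z $ j) holomorphic_on UNIV"
    and \<Theta>_height: "z \<noteq> 0 \<Longrightarrow> \<bar>height (\<Theta> w z) - height z - Re w\<bar> \<le> C"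
begin

text \<open>
  The group generated by \<open>\<gamma>\<close> and the flow; \<open>act m w\<close> changes the height by \<open>m + Re w\<close> up to \<open>C\<close>.
\<close>

definition act :: "int \<Rightarrow> complex \<Rightarrow> complex ^ 'n \<Rightarrow> complex ^ 'n" where
  "act m w z = it m (\<Theta> w z)"

lemma act_0 [simp]: "act m w 0 = 0"
  by (simp add: act_def \<Theta>_zero)

lemma act_id: "act 0 0 z = z"
  by (simp add: act_def \<Theta>_0)

lemma act_add: "act (m + m') (w + w') z = act m w (act m' w' z)"
  by (simp add: act_def \<Theta>_add \<Theta>_it it_add)

lemma act_height:
  assumes "z \<noteq> 0"
  shows "\<bar>height (act m w z) - height z - (of_int m + Re w)\<bar> \<le> C"
  using \<Theta>_height[OF assms, of w] by (simp add: act_def height_it \<Theta>_nz[OF assms])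

text \<open>
  All elements that do not lower the height by more than \<open>r\<close> up to a bounded error are
  equicontinuous at the origin.
\<close>

lemma act_small:
  assumes "0 < \<eta>"
  shows "\<exists>\<delta>>0. \<forall>m w z. - r \<le> of_int m + Re w \<and> norm z < \<delta> \<longrightarrow> norm (act m w z) < \<eta>"
proof -
  obtain c where c: "\<And>z. z \<noteq> 0 \<Longrightarrow> c \<le> height z \<Longrightarrow> norm z < \<eta>"
    using height_large_small[OF assms] by blast
  obtain \<delta> where \<delta>: "0 < \<delta>" "\<And>z. z \<noteq> 0 \<Longrightarrow> norm z < \<delta> \<Longrightarrow> c + r + C < height z"
    using height_near_0 by blast
  have "norm (act m w z) < \<eta>" if "- r \<le> of_int m + Re w" "norm z < \<delta>" for m w z
  proof (cases "z = 0")
    case False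
    have "c \<le> height (act m w z)" using act_height[OF False, of m w] \<delta>(2)[OF False that(2)] that(1) by linarith
    moreover have "act m w z \<noteq> 0" by (simp add: act_def \<Theta>_nz[OF False])
    ultimately show ?thesis using c by blast
  qed (use assms in simp)
  then show ?thesis using \<delta>(1) by blast
qed

lemma act_holo: "holo_on UNIV (act m w)"
proof -
  have h: "holo_on (- {0}) (act m w)"
    unfolding act_def[abs_def] by (rule holo_on_compose[OF \<Theta>_holo holo_it]) simp
  have "isCont (act m w) z" for z
  proof (cases "z = 0")
    case True
    have "\<exists>d>0. \<forall>x. dist x 0 < d \<longrightarrow> dist (act m w x) (act m w 0) < e" if "0 < e" for e
      using act_small[OF that, of "- (of_int m + Re w)"] by (auto simp: dist_norm)
    then show ?thesis unfolding True continuous_at_eps_delta by blast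
  next
    case False
    then show ?thesis using holo_on_imp_continuous_on[OF h] by (simp add: continuous_on_eq_continuous_at open_Compl)
  qed
  then have "continuous_on UNIV (act m w)" by (simp add: continuous_at_imp_continuous_on)
  then show ?thesis using h by (intro holo_on_removable[of UNIV _ 0]) (simp_all add: Compl_eq_Diff_UNIV)
qed

definition lin :: "int \<Rightarrow> complex \<Rightarrow> complex ^ 'n \<Rightarrow> complex ^ 'n" where
  "lin m w = frechet_derivative (act m w) (at 0)"

lemma lin_linear: "complex_linear (lin m w)"
  unfolding lin_def by (rule frechet_complex_linear[OF act_holo]) simp

lemma lin_add: "lin (m + m') (w + w') v = lin m w (lin m' w' v)"
proof -
  have "act (m + m') (w + w') = (\<lambda>z. act m w (act m' w' z))" by (simp add: fun_eq_iff act_add)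
  then show ?thesis
    unfolding lin_def using frechet_compose[OF act_holo act_holo, of 0 m' w' m w v] by simp
qed

lemma lin_id: "lin 0 0 v = v"
proof -
  have "act 0 0 = (\<lambda>z. z)" by (simp add: fun_eq_iff act_id)
  then show ?thesis by (simp add: lin_def)
qed

lemma lin_cancel: "lin (- m) (- w) (lin m w v) = v"
  using lin_add[of "- m" m "- w" w v] by (simp add: lin_id)

text \<open>Uniform Cauchy estimates for the elements that lower the height by at most one.\<close>

lemma act_bounds:
  obtains \<delta> K where "0 < \<delta>" "1 \<le> K"
    "\<And>m w z. - 1 \<le> of_int m + Re w \<Longrightarrow> norm z \<le> \<delta> \<Longrightarrow> norm (act m w z) \<le> 1"
    "\<And>m w v. - 1 \<le> of_int m + Re w \<Longrightarrow> norm (lin m w v) \<le> K * norm v"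
    "\<And>m w z. - 1 \<le> of_int m + Re w \<Longrightarrow> norm z \<le> \<delta> / 2 \<Longrightarrow> norm (act m w z - lin m w z) \<le> K * (norm z)\<^sup>2"
proof -
  obtain \<delta>' where \<delta>': "0 < \<delta>'" "\<And>m w z. - 1 \<le> of_int m + Re w \<Longrightarrow> norm z < \<delta>' \<Longrightarrow> norm (act m w z) < 1"
    using act_small[of 1 1] by auto
  define \<delta> where "\<delta> = \<delta>' / 2"
  have \<delta>: "0 < \<delta>" "\<And>m w z. - 1 \<le> of_int m + Re w \<Longrightarrow> norm z \<le> \<delta> \<Longrightarrow> norm (act m w z) \<le> 1"
    using \<delta>' by (force simp: \<delta>_def intro!: less_imp_le)+
  define K where "K = max 1 (max (real CARD('n) * (1 / \<delta>)) (real CARD('n) * (8 * 1 / \<delta>\<^sup>2)))"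
  have "norm (lin m w v) \<le> K * norm v"
    "norm z \<le> \<delta> / 2 \<Longrightarrow> norm (act m w z - lin m w z) \<le> K * (norm z)\<^sup>2"
    if "- 1 \<le> of_int m + Re w" for m w v z
  proof -
    have b: "norm (act m w y) \<le> 1" if "y \<in> cball 0 \<delta>" for y using \<delta>(2) that \<open>- 1 \<le> _\<close> by simp
    note H = holo_bounds[where z = 0, OF open_UNIV act_holo \<delta>(1) subset_UNIV b]
    have "norm (lin m w v) \<le> real CARD('n) * (1 / \<delta>) * norm v" unfolding lin_def by (rule H(1))
    also have "\<dots> \<le> K * norm v" by (intro mult_right_mono) (auto simp: K_def)
    finally show "norm (lin m w v) \<le> K * norm v" .
    assume "norm z \<le> \<delta> / 2"
    then have "norm (act m w z - lin m w z) \<le> real CARD('n) * (8 * 1 / \<delta>\<^sup>2) * (norm z)\<^sup>2"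
      using H(2)[of z] by (simp add: lin_def)
    also have "\<dots> \<le> K * (norm z)\<^sup>2" by (intro mult_right_mono) (auto simp: K_def)
    finally show "norm (act m w z - lin m w z) \<le> K * (norm z)\<^sup>2" .
  qed
  with that \<delta> show thesis by (metis K_def max.cobounded1)
qed

text \<open>
  The derivative at the origin is the limit of difference quotients, which are entire in time;
  the second order estimates make the limit uniform in the half plane.
\<close>

lemma lin_holomorphic: "(\<lambda>w. lin 0 w v $ j) holomorphic_on {w. - 1 < Re w}"
proof -
  obtain \<delta> K where \<delta>: "0 < \<delta>" "1 \<le> K"
    "\<And>m w z. - 1 \<le> of_int m + Re w \<Longrightarrow> norm z \<le> \<delta> / 2 \<Longrightarrow> norm (act m w z - lin m w z) \<le> K * (norm z)\<^sup>2"
    using act_bounds by metis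
  define f where "f k w = of_nat (Suc k) * act 0 w (inverse (of_nat (Suc k)) *s v) $ j" for k and w :: complex
  have lim: "uniform_limit {w. - 1 < Re w} f (\<lambda>w. lin 0 w v $ j) sequentially"
  proof (rule uniform_limitI)
    fix e :: real assume e: "0 < e"
    have "(\<lambda>k. inverse (real (Suc k)) * norm v) \<longlonglongrightarrow> 0"
      by (rule tendsto_mult_left_zero[OF LIMSEQ_inverse_real_of_nat])
    then have 1: "\<forall>\<^sub>F k in sequentially. inverse (real (Suc k)) * norm v < \<delta> / 2"
      by (rule order_tendstoD) (use \<delta> in simp)
    have "(\<lambda>k. inverse (real (Suc k)) * (K * (norm v)\<^sup>2)) \<longlonglongrightarrow> 0"
      by (rule tendsto_mult_left_zero[OF LIMSEQ_inverse_real_of_nat])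
    then have 2: "\<forall>\<^sub>F k in sequentially. inverse (real (Suc k)) * (K * (norm v)\<^sup>2) < e"
      by (rule order_tendstoD) (rule e)
    from 1 2 show "\<forall>\<^sub>F k in sequentially. \<forall>w\<in>{w. - 1 < Re w}. dist (f k w) (lin 0 w v $ j) < e"
    proof eventually_elim
      case (elim k)
      define c :: complex where "c = of_nat (Suc k)"
      have c: "c \<noteq> 0" "cmod c = real (Suc k)" unfolding c_def by (simp_all del: of_nat_Suc)
      show ?case
      proof
        fix w :: complex assume w: "w \<in> {w. - 1 < Re w}"
        define x where "x = inverse c *s v"
        have x: "norm x = inverse (real (Suc k)) * norm v" using c by (simp add: x_def norm_smult norm_inverse)
        have "c *s lin 0 w x = lin 0 w v"
          using c by (simp add: x_def complex_linear_scale[OF lin_linear, symmetric] vector_smult_assoc)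
        then have l: "lin 0 w v $ j = c * lin 0 w x $ j" by (metis vector_smult_component)
        have "f k w - lin 0 w v $ j = (c *s (act 0 w x - lin 0 w x)) $ j"
          unfolding f_def c_def[symmetric] x_def[symmetric] by (simp add: l right_diff_distrib)
        then have "dist (f k w) (lin 0 w v $ j) \<le> norm (c *s (act 0 w x - lin 0 w x))"
          unfolding dist_norm by (simp only: Finite_Cartesian_Product.norm_nth_le)
        also have "\<dots> = real (Suc k) * norm (act 0 w x - lin 0 w x)" by (simp only: norm_smult c)
        also have "\<dots> \<le> real (Suc k) * (K * (norm x)\<^sup>2)"
          using w x elim(1) by (intro mult_left_mono \<delta>(3)) auto
        also have "\<dots> = inverse (real (Suc k)) * (K * (norm v)\<^sup>2)"
          by (simp add: x power2_eq_square divide_inverse del: of_nat_Suc)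
        finally show "dist (f k w) (lin 0 w v $ j) < e" using elim(2) by linarith
      qed
    qed
  qed
  have S: "open {w. - 1 < Re w}" by (intro open_Collect_less continuous_intros)
  show ?thesis
  proof (rule holomorphic_uniform_sequence[OF S])
    show "f k holomorphic_on {w. - 1 < Re w}" for k
      unfolding f_def act_def using \<Theta>_entire
      by (intro holomorphic_intros) (auto intro: holomorphic_on_subset)
    fix x assume "x \<in> {w. - 1 < Re w}"
    then obtain d where "0 < d" "cball x d \<subseteq> {w. - 1 < Re w}" using S open_contains_cball by blast
    then show "\<exists>d>0. cball x d \<subseteq> {w. - 1 < Re w} \<and> uniform_limit (cball x d) f (\<lambda>w. lin 0 w v $ j) sequentially"
      using lim uniform_limit_on_subset by blast
  qed
qed

text \<open>
  The identity theorem in the form in which it links balanced elements to real times: the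
  points \<open>\<i> / 2 ^ q\<close> of the imaginary axis accumulate at the origin.
\<close>

lemma dyadic_identity:
  assumes "f holomorphic_on {w. - 1 < Re w}" "\<And>q. f (\<i> / 2 ^ q) = 0"
  shows "f 1 = 0"
proof (rule analytic_continuation[where S = "{w. - 1 < Re w}" and U = "range (\<lambda>q :: nat. \<i> / 2 ^ q)" and \<xi> = 0 and f = f])
  show "open {w. - 1 < Re w}" by (intro open_Collect_less continuous_intros)
  have "convex {w. - 1 < Re w}" by (rule convex_halfspace_Re_gt)
  then show "connected {w. - 1 < Re w}" by (rule convex_connected)
  show "0 islimpt range (\<lambda>q :: nat. \<i> / 2 ^ q)"
  proof (rule islimpt_sequential[THEN iffD2], intro exI conjI allI)
    show "\<i> / 2 ^ q \<in> range (\<lambda>q :: nat. \<i> / 2 ^ q) - {0}" for q by auto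
    have "(\<lambda>q. \<i> * (1 / 2) ^ q) \<longlonglongrightarrow> \<i> * 0"
      by (intro tendsto_intros LIMSEQ_power_zero) simp
    moreover have "(\<lambda>q. \<i> * (1 / 2) ^ q) = (\<lambda>q. \<i> / 2 ^ q)" by (simp add: fun_eq_iff power_one_over)
    ultimately show "(\<lambda>q. \<i> / 2 ^ q) \<longlonglongrightarrow> 0" by simp
  qed
qed (use assms in auto)

subsection \<open>Balanced elements\<close>

text \<open>
  The times for which \<open>act m (bal m t)\<close> changes heights by a bounded amount only. These balanced
  elements form a group that behaves like a compact one near the origin.
\<close>

definition bal :: "int \<Rightarrow> real \<Rightarrow> complex" where
  "bal m t = Complex (- of_int m) t"

lemma bal_add: "bal (m + m') (t + t') = bal m t + bal m' t'"
  and bal_uminus: "bal (- m) (- t) = - bal m t" and bal_Re [simp]: "of_int m + Re (bal m t) = 0"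
  by (simp_all add: bal_def complex_eq_iff)

definition avg_term :: "int \<Rightarrow> real \<Rightarrow> complex ^ 'n \<Rightarrow> complex ^ 'n" where
  "avg_term m t z = lin (- m) (bal (- m) (- t)) (act m (bal m t) z)"

lemma avg_term_holo: "holo_on UNIV (avg_term m t)"
  unfolding avg_term_def[abs_def]
  by (rule holo_on_compose[OF act_holo holo_complex_linear[OF lin_linear, where S = UNIV]]) simp

lemma avg_term_shift:
  "avg_term m t (act m0 (bal m0 t0) z) = lin m0 (bal m0 t0) (avg_term (m + m0) (t + t0) z)"
proof -
  have "lin m0 (bal m0 t0) (lin (- (m + m0)) (bal (- (m + m0)) (- (t + t0))) v) = lin (- m) (bal (- m) (- t)) v" for v
    using lin_add[of m0 "- (m + m0)" "bal m0 t0" "bal (- (m + m0)) (- (t + t0))" v]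
    by (simp flip: bal_add)
  then show ?thesis by (simp add: avg_term_def act_add bal_add)
qed

text \<open>
  The parameter \<open>m\<close> ranges over \<open>0, \<dots>, N\<close> and the time over the multiples of \<open>1 / 2 ^ N\<close> below
  \<open>N + 1\<close>. Thus every dyadic time is finally a multiple of the mesh, and the boundary terms under
  a shift by a fixed element are negligible.
\<close>

definition average :: "nat \<Rightarrow> complex ^ 'n \<Rightarrow> complex ^ 'n" where
  "average N z = inverse (of_nat (Suc N * (Suc N * 2 ^ N))) *s
     (\<Sum>m<Suc N. \<Sum>l<Suc N * 2 ^ N. avg_term (int m) (real l / 2 ^ N) z)"

lemma average_holo: "holo_on UNIV (average N)"
  unfolding average_def[abs_def] by (intro holo_on_scale holo_on_sum avg_term_holo)

lemma average_norm:
  assumes "\<And>m l. norm (f m l) \<le> (B :: real)"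
  shows "norm (inverse (of_nat (Suc N * (Suc N * 2 ^ N))) *s (\<Sum>m<Suc N. \<Sum>l<Suc N * 2 ^ N. f m l :: complex ^ 'n)) \<le> B"
proof -
  define M where "M = Suc N * (Suc N * 2 ^ N)"
  define S where "S = (\<Sum>m<Suc N. \<Sum>l<Suc N * 2 ^ N. f m l)"
  have M: "0 < M" by (simp add: M_def)
  have "norm S \<le> (\<Sum>m<Suc N. \<Sum>l<Suc N * 2 ^ N. B)"
    unfolding S_def by (intro order_trans[OF norm_sum] sum_mono assms)
  also have "\<dots> = real (Suc N * (Suc N * 2 ^ N)) * B"
    by (simp only: sum_constant card_lessThan of_nat_mult mult.assoc)
  finally have "norm S \<le> real M * B" unfolding M_def .
  then show ?thesis
    unfolding M_def[symmetric] S_def[symmetric] norm_smult norm_inverse norm_of_nat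
    using M by (simp add: field_simps)
qed

text \<open>
  For a compact group the average of the maps \<open>g\<close>, each followed by the inverse of its linear
  part, conjugates the group to its linear parts. Here averages over longer and longer stretches
  of the group of balanced elements conjugate approximately, and a limit given by the theorem of
  Arzela and Ascoli does so exactly. Since \<open>bal 1 0\<close> is \<open>- 1\<close>, the map \<open>\<gamma>\<close> is the balanced element
  \<open>act 1 (- 1)\<close> after \<open>\<Theta> 1\<close>, and the identity theorem takes care of \<open>\<Theta> 1\<close>.
\<close>

lemma local_linearization:
  "\<exists>h r \<delta> K. 0 < r \<and> 0 < \<delta> \<and> holo_on (ball 0 r) h \<and> (\<forall>z\<in>ball 0 r. norm (h z - z) \<le> K * (norm z)\<^sup>2) \<and>
     (\<forall>z. norm z < \<delta> \<longrightarrow> norm (\<gamma> z) < r \<and> h (\<gamma> z) = lin 1 0 (h z))"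
proof -
  obtain \<delta> K where \<delta>: "0 < \<delta>" and K: "1 \<le> K"
    and act1: "\<And>m w z. - 1 \<le> of_int m + Re w \<Longrightarrow> norm z \<le> \<delta> \<Longrightarrow> norm (act m w z) \<le> 1"
    and linK: "\<And>m w v. - 1 \<le> of_int m + Re w \<Longrightarrow> norm (lin m w v) \<le> K * norm v"
    and quad: "\<And>m w z. - 1 \<le> of_int m + Re w \<Longrightarrow> norm z \<le> \<delta> / 2 \<Longrightarrow> norm (act m w z - lin m w z) \<le> K * (norm z)\<^sup>2"
    using act_bounds by metis
  define r where "r = \<delta> / 2"
  have r: "0 < r" using \<delta> by (simp add: r_def)
  have linb: "norm (lin m (bal m t) v) \<le> K * norm v" for m t v by (rule linK) simp
  have term_bound: "norm (avg_term m t z) \<le> K" if "norm z \<le> \<delta>" for m t z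
  proof -
    have "norm (avg_term m t z) \<le> K * norm (act m (bal m t) z)" unfolding avg_term_def by (rule linb)
    also have "\<dots> \<le> K * 1" using K that by (intro mult_left_mono act1) auto
    finally show ?thesis by simp
  qed
  have term_quad: "norm (avg_term m t z - z) \<le> K * K * (norm z)\<^sup>2" if "norm z \<le> r" for m t z
  proof -
    have "avg_term m t z - z = lin (- m) (bal (- m) (- t)) (act m (bal m t) z - lin m (bal m t) z)"
      by (simp add: avg_term_def complex_linear_diff[OF lin_linear] bal_uminus lin_cancel)
    also have "norm \<dots> \<le> K * norm (act m (bal m t) z - lin m (bal m t) z)" by (rule linb)
    also have "\<dots> \<le> K * (K * (norm z)\<^sup>2)" using K that by (intro mult_left_mono quad) (auto simp: r_def)
    finally show ?thesis by simp
  qed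
  have avg_bound: "norm (average N z) \<le> K" if "norm z \<le> \<delta>" for N z
    unfolding average_def by (intro average_norm term_bound that)
  have avg_quad: "norm (average N z - z) \<le> K * K * (norm z)\<^sup>2" if "norm z \<le> r" for N z
  proof -
    have "average N z - z = inverse (of_nat (Suc N * (Suc N * 2 ^ N))) *s
        (\<Sum>m<Suc N. \<Sum>l<Suc N * 2 ^ N. avg_term (int m) (real l / 2 ^ N) z - z)"
    proof -
      have eq: "(\<Sum>m<Suc N. \<Sum>l<Suc N * 2 ^ N. z) = of_nat (Suc N * (Suc N * 2 ^ N)) *s z"
        by (simp only: sum_constant_scaleR card_lessThan scaleR_scaleR scaleR_smult)
          (simp only: of_real_mult of_real_of_nat_eq of_nat_mult vector_smult_assoc)
      have "(of_nat (Suc N * (Suc N * 2 ^ N)) :: complex) \<noteq> 0" by (simp only: of_nat_eq_0_iff) simp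
      then have "inverse (of_nat (Suc N * (Suc N * 2 ^ N))) *s (\<Sum>m<Suc N. \<Sum>l<Suc N * 2 ^ N. z) = z"
        unfolding eq by (simp only: vector_smult_assoc left_inverse vector_smult_lid not_False_eq_True)
      then show ?thesis unfolding sum_subtractf average_def by (simp only: vec.scale_right_diff_distrib)
    qed
    also have "norm \<dots> \<le> K * K * (norm z)\<^sup>2" by (intro average_norm term_quad that)
    finally show ?thesis .
  qed
  have lip: "norm (average N x - average N y) \<le> real CARD('n) * (K / r) * norm (x - y)"
    if "x \<in> cball 0 r" "y \<in> cball 0 r" for N x y
    using that avg_bound by (intro holo_lipschitz[where z = 0, OF open_UNIV average_holo r]) (auto simp: r_def)
  define Lc where "Lc = real CARD('n) * (K / r)"
  have Lc: "0 < Lc" using K r by (simp add: Lc_def)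
  have equi: "\<exists>d>0. \<forall>N y. y \<in> cball 0 r \<and> norm (x - y) < d \<longrightarrow> norm (average N x - average N y) < e"
    if "x \<in> cball 0 r" "0 < e" for x e
  proof (intro exI[of _ "e / Lc"] conjI allI impI)
    show "0 < e / Lc" using that Lc by simp
    fix N y assume y: "y \<in> cball 0 r \<and> norm (x - y) < e / Lc"
    then have "Lc * norm (x - y) < e" using Lc by (simp add: field_simps)
    then show "norm (average N x - average N y) < e"
      using lip[of x y N] y that unfolding Lc_def by simp
  qed
  obtain h k where k: "strict_mono (k :: nat \<Rightarrow> nat)"
    and lim: "\<And>e. 0 < e \<Longrightarrow> \<exists>N. \<forall>n x. N \<le> n \<and> x \<in> cball 0 r \<longrightarrow> norm (average (k n) x - h x) < e"
  proof (rule Arzela_Ascoli[of "cball 0 r" average K])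
    show "norm (average n x) \<le> K" if "x \<in> cball 0 r" for n x
      using that \<delta> by (intro avg_bound) (auto simp: r_def)
  qed (use equi in auto)
  have ulim: "uniform_limit (cball 0 r) (\<lambda>n. average (k n)) h sequentially"
    unfolding uniform_limit_iff eventually_sequentially dist_norm using lim by meson
  have h_holo: "holo_on (ball 0 r) h"
    by (rule holo_on_uniform_limit[OF open_ball holo_on_subset[OF average_holo subset_UNIV]
          uniform_limit_on_subset[OF ulim ball_subset_cball]])
  have plim: "(\<lambda>n. average (k n) x) \<longlonglongrightarrow> h x" if "norm x \<le> r" for x
    using tendsto_uniform_limitI[OF ulim] that by simp
  have h_quad: "norm (h z - z) \<le> K * K * (norm z)\<^sup>2" if "norm z \<le> r" for z
    by (rule LIMSEQ_le_const2[OF tendsto_norm[OF tendsto_diff[OF plim[OF that] tendsto_const]]])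
       (use avg_quad that in blast)
  obtain \<delta>1 where \<delta>1: "0 < \<delta>1" "\<And>m w z. - 1 \<le> of_int m + Re w \<Longrightarrow> norm z < \<delta>1 \<Longrightarrow> norm (act m w z) < r"
    using act_small[OF r, of 1] by blast
  have \<delta>1r: "norm z < r" if "norm z < \<delta>1" for z :: "complex ^ 'n" using \<delta>1(2)[of 0 0 z] that by (simp add: act_id)
  have small: "(\<lambda>n. 2 * K * K * inverse (real (Suc (k n)))) \<longlonglongrightarrow> 0"
    using LIMSEQ_subseq_LIMSEQ[OF tendsto_mult_right_zero[OF LIMSEQ_inverse_real_of_nat] k, of "2 * K * K"]
    by (simp add: o_def)
  \<comment> \<open>a balanced element shifts the index of summation, so only boundary terms remain\<close>
  have shift: "norm (average N (act m0 (bal m0 t0) z) - lin m0 (bal m0 t0) (average N z)) \<le> 2 * K * K * inverse (real (Suc N))"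
    if z: "norm z < \<delta>1"
      and m0: "m0 = 1 \<and> t0 = 0 \<or> m0 = 0 \<and> (\<exists>q\<le>N. t0 = 1 / 2 ^ q)" for N m0 t0 z
  proof -
    define T where "T m l = avg_term (int m) (real l / 2 ^ N) z" for m l :: nat
    have T: "norm (T m l) \<le> K" for m l
      unfolding T_def using \<delta>1r[OF z] \<delta> by (intro term_bound) (auto simp: r_def)
    define c :: complex where "c = inverse (of_nat (Suc N * (Suc N * 2 ^ N)))"
    have cn: "cmod c = inverse (real (Suc N) * (real (Suc N) * 2 ^ N))"
      by (simp only: c_def norm_inverse norm_mult norm_power norm_of_nat norm_numeral of_nat_mult of_nat_power of_nat_numeral)
    let ?L = "lin m0 (bal m0 t0)"
    define E where "E = (\<Sum>m<Suc N. \<Sum>l<Suc N * 2 ^ N. avg_term (int m + m0) (real l / 2 ^ N + t0) z) - (\<Sum>m<Suc N. \<Sum>l<Suc N * 2 ^ N. T m l)"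
    have eq: "average N (act m0 (bal m0 t0) z) - ?L (average N z) = ?L (c *s E)"
      by (simp only: average_def c_def[symmetric] avg_term_shift T_def E_def complex_linear_scale[OF lin_linear]
          complex_linear_diff[OF lin_linear] complex_linear_sum[OF lin_linear] vec.scale_right_diff_distrib)
    have "norm E \<le> real (Suc N) * 2 ^ N * (2 * K)"
      using m0
    proof
      assume m0: "m0 = 1 \<and> t0 = 0"
      have "E = (\<Sum>l<Suc N * 2 ^ N. (\<Sum>m<Suc N. T (m + 1) l) - (\<Sum>m<Suc N. T m l))"
        unfolding E_def sum_subtractf by (subst (1 2) sum.swap) (simp add: T_def m0 add.commute)
      also have "norm \<dots> \<le> (\<Sum>l<Suc N * 2 ^ N. 2 * real 1 * K)"
        by (intro order_trans[OF norm_sum] sum_mono shifted_sums T)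
      also have "\<dots> = real (Suc N) * 2 ^ N * (2 * K)" by (simp add: algebra_simps)
      finally show ?thesis .
    next
      assume "m0 = 0 \<and> (\<exists>q\<le>N. t0 = 1 / 2 ^ q)"
      then obtain q where q: "m0 = 0" "q \<le> N" "t0 = 1 / 2 ^ q" by blast
      have t0: "real l / 2 ^ N + t0 = real (l + 2 ^ (N - q)) / 2 ^ N" for l
      proof -
        have "(2 :: real) ^ N = 2 ^ (N - q) * 2 ^ q" using q(2) by (simp flip: power_add)
        then show ?thesis by (simp add: q(3) field_simps)
      qed
      have "E = (\<Sum>m<Suc N. (\<Sum>l<Suc N * 2 ^ N. T m (l + 2 ^ (N - q))) - (\<Sum>l<Suc N * 2 ^ N. T m l))"
        unfolding E_def sum_subtractf t0 by (simp only: T_def q(1) add_0_right)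
      also have "norm \<dots> \<le> (\<Sum>m<Suc N. 2 * real (2 ^ (N - q)) * K)"
        by (intro order_trans[OF norm_sum] sum_mono shifted_sums T)
      also have "\<dots> \<le> (\<Sum>m<Suc N. 2 * 2 ^ N * K)"
        using K by (intro sum_mono mult_right_mono) (auto intro!: power_increasing)
      also have "\<dots> = real (Suc N) * 2 ^ N * (2 * K)" by (simp add: algebra_simps)
      finally show ?thesis .
    qed
    then have "K * (cmod c * norm E) \<le> K * (cmod c * (real (Suc N) * 2 ^ N * (2 * K)))"
      using K by (intro mult_left_mono) auto
    moreover have "norm (?L (c *s E)) \<le> K * (cmod c * norm E)"
      using linb[of m0 t0 "c *s E"] by (simp only: norm_smult)
    ultimately have "norm (average N (act m0 (bal m0 t0) z) - ?L (average N z)) \<le> K * (cmod c * (real (Suc N) * 2 ^ N * (2 * K)))"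
      unfolding eq by linarith
    also have "\<dots> = 2 * K * K * inverse (real (Suc N))"
      unfolding cn by (simp add: field_simps del: of_nat_Suc)
    finally show ?thesis .
  qed
  have exact: "h (act m0 (bal m0 t0) z) = lin m0 (bal m0 t0) (h z)"
    if z: "norm z < \<delta>1" and ev: "\<forall>\<^sub>F n in sequentially. m0 = 1 \<and> t0 = 0 \<or> m0 = 0 \<and> (\<exists>q\<le>k n. t0 = 1 / 2 ^ q)" for m0 t0 z
  proof -
    let ?x = "act m0 (bal m0 t0) z" and ?L = "lin m0 (bal m0 t0)"
    have "norm ?x < r" by (rule \<delta>1(2)) (use z in auto)
    then have 1: "(\<lambda>n. average (k n) ?x) \<longlonglongrightarrow> h ?x" by (intro plim) simp
    have 2: "(\<lambda>n. ?L (average (k n) z)) \<longlonglongrightarrow> ?L (h z)"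
      using \<delta>1r[OF z] by (intro bounded_linear.tendsto[OF complex_linear_imp_bounded[OF lin_linear]] plim) simp
    have "(\<lambda>n. average (k n) ?x - ?L (average (k n) z)) \<longlonglongrightarrow> 0"
      by (rule Lim_null_comparison[OF eventually_mono[OF ev] small]) (use shift[OF z] in blast)
    then have "h ?x - ?L (h z) = 0" using tendsto_diff[OF 1 2] LIMSEQ_unique by blast
    then show ?thesis by simp
  qed
  have h\<kappa>: "h (act 1 (- 1) z) = lin 1 (- 1) (h z)" if "norm z < \<delta>1" for z
  proof -
    have "bal 1 0 = - 1" by (simp add: bal_def complex_eq_iff)
    with exact[OF that, of 1 0] show ?thesis by simp
  qed
  have h\<Theta>: "h (\<Theta> 1 z) = lin 0 1 (h z)" if z: "norm z < \<delta>1" for z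
  proof -
    have "h (\<Theta> 1 z) $ j - lin 0 1 (h z) $ j = 0" for j
    proof (rule dyadic_identity[of "\<lambda>w. h (\<Theta> w z) $ j - lin 0 w (h z) $ j"])
      have "(\<lambda>w. h (\<Theta> w z) $ j) holomorphic_on {w. - 1 < Re w}"
      proof (rule holo_on_curve[OF h_holo])
        show "open {w. - 1 < Re w}" by (intro open_Collect_less continuous_intros)
        show "(\<lambda>w. \<Theta> w z) ` {w. - 1 < Re w} \<subseteq> ball 0 r"
          using \<delta>1(2)[of 0 _ z] z by (auto simp: act_def)
      qed (use \<Theta>_entire holomorphic_on_subset in blast)
      then show "(\<lambda>w. h (\<Theta> w z) $ j - lin 0 w (h z) $ j) holomorphic_on {w. - 1 < Re w}"
        by (intro holomorphic_intros lin_holomorphic)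
      fix q :: nat
      have "\<forall>\<^sub>F n in sequentially. q \<le> k n"
        unfolding eventually_sequentially using seq_suble[OF k] order_trans by blast
      then have "\<forall>\<^sub>F n in sequentially. (0 :: int) = 1 \<and> (1 :: real) / 2 ^ q = 0 \<or> (0 :: int) = 0 \<and> (\<exists>p\<le>k n. (1 :: real) / 2 ^ q = 1 / 2 ^ p)"
        by eventually_elim blast
      from exact[OF z this] have "h (act 0 (bal 0 (1 / 2 ^ q)) z) = lin 0 (bal 0 (1 / 2 ^ q)) (h z)" .
      moreover have "bal 0 (1 / 2 ^ q) = \<i> / 2 ^ q"
      proof -
        have "bal 0 (1 / 2 ^ q) = \<i> * complex_of_real (1 / 2 ^ q)" by (simp add: bal_def complex_eq_iff)
        then show ?thesis by simp
      qed
      ultimately show "h (\<Theta> (\<i> / 2 ^ q) z) $ j - lin 0 (\<i> / 2 ^ q) (h z) $ j = 0" by (simp add: act_def)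
    qed
    then show ?thesis by (simp add: vec_eq_iff)
  qed
  obtain \<delta>2 where \<delta>2: "0 < \<delta>2" "\<And>m w z. - 1 \<le> of_int m + Re w \<Longrightarrow> norm z < \<delta>2 \<Longrightarrow> norm (act m w z) < \<delta>1"
    using act_small[OF \<delta>1(1), of 1] by blast
  have "norm (\<gamma> z) < r \<and> h (\<gamma> z) = lin 1 0 (h z)" if z: "norm z < \<delta>2" for z
  proof -
    have z1: "norm z < \<delta>1" using \<delta>2(2)[of 0 0 z] z by (simp add: act_id)
    have z2: "norm (\<Theta> 1 z) < \<delta>1" using \<delta>2(2)[of 0 1 z] z by (simp add: act_def)
    have g: "\<gamma> z = act 1 (- 1) (\<Theta> 1 z)"
      by (simp add: act_def \<Theta>_0 flip: \<Theta>_add)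
    have "norm (\<gamma> z) < r" using \<delta>1(2)[of 1 0 z] z1 by (simp add: act_def \<Theta>_0)
    moreover have "h (\<gamma> z) = lin 1 (- 1) (lin 0 1 (h z))" unfolding g h\<kappa>[OF z2] h\<Theta>[OF z1] ..
    moreover have "\<dots> = lin 1 0 (h z)" by (simp flip: lin_add)
    ultimately show ?thesis by simp
  qed
  then show ?thesis
    using r \<delta>2(1) h_holo h_quad by (intro exI[of _ h] exI[of _ r] exI[of _ \<delta>2] exI[of _ "K * K"]) auto
qed

text \<open>
  The linear parts of the balanced elements are uniformly bounded, hence simultaneously
  diagonalizable; by the identity theorem their eigenlines are also preserved by the linear
  part of \<open>\<Theta> 1\<close>.
\<close>

lemma linear_part_diagonalizable:
  "\<exists>e lam. bij (\<lambda>x. \<Sum>j\<in>UNIV. x $ j *s e j) \<and> (\<forall>j :: 'n. lin 1 0 (e j) = lam j *s e j)"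
proof -
  obtain K where K: "\<And>m w v. - 1 \<le> of_int m + Re w \<Longrightarrow> norm (lin m w v) \<le> K * norm v"
    using act_bounds by metis
  define \<F> where "\<F> = {lin m (bal m t) | m t. True}"
  have linp: "(lin m (bal m t) ^^ k) v = lin (int k * m) (bal (int k * m) (real k * t)) v" for m t k v
  proof (induction k arbitrary: v)
    case 0
    have "bal 0 0 = 0" by (simp add: bal_def complex_eq_iff)
    then show ?case by (simp add: lin_id)
  next
    case (Suc k)
    have "lin m (bal m t) (lin (int k * m) (bal (int k * m) (real k * t)) v)
        = lin (m + int k * m) (bal (m + int k * m) (t + real k * t)) v"
      by (simp add: lin_add bal_add)
    then show ?case using Suc by (simp add: algebra_simps)
  qed
  have ss: "semisimple (lin m (bal m t))" for m t
  proof (rule power_bounded_semisimple[OF lin_linear])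
    show "norm ((lin m (bal m t) ^^ k) v) \<le> K * norm v" for k v unfolding linp
      by (rule K) (use bal_Re[of "int k * m" "real k * t"] in linarith)
    show "norm v \<le> K * norm ((lin m (bal m t) ^^ k) v)" for k v
    proof -
      let ?b = "bal (int k * m) (real k * t)"
      have "norm (lin (- (int k * m)) (- ?b) (lin (int k * m) ?b v)) \<le> K * norm (lin (int k * m) ?b v)"
        by (rule K) (simp add: bal_def)
      then show ?thesis by (simp add: linp lin_cancel)
    qed
  qed
  have comm: "lin m w (lin m' w' x) = lin m' w' (lin m w x)" for m m' w w' x
    by (simp add: add.commute flip: lin_add)
  obtain e where e: "\<And>j :: 'n. joint_eigenvector \<F> (e j)" "bij (\<lambda>x. \<Sum>j\<in>UNIV. x $ j *s e j)"
  proof -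
    have "\<exists>e. (\<forall>j :: 'n. joint_eigenvector \<F> (e j)) \<and> bij (\<lambda>x. \<Sum>j\<in>UNIV. x $ j *s e j)"
      by (rule joint_eigenbasis) (use lin_linear ss comm in \<open>auto simp: \<F>_def\<close>)
    then show thesis using that by blast
  qed
  have eig: "\<exists>a. lin m (bal m t) (e j) = a *s e j" for m t j
    using e(1)[of j] unfolding joint_eigenvector_def \<F>_def by blast
  have "\<exists>a. lin 1 0 (e j) = a *s e j" for j
  proof -
    have "\<exists>a. lin 0 1 (e j) = a *s e j"
    proof (cases "e j = 0")
      case False
      then obtain p where p: "e j $ p \<noteq> 0" by (auto simp: vec_eq_iff)
      have "lin 0 1 (e j) $ i * e j $ p - lin 0 1 (e j) $ p * e j $ i = 0" for i
      proof (rule dyadic_identity[of "\<lambda>w. lin 0 w (e j) $ i * e j $ p - lin 0 w (e j) $ p * e j $ i"])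
        show "(\<lambda>w. lin 0 w (e j) $ i * e j $ p - lin 0 w (e j) $ p * e j $ i) holomorphic_on {w. - 1 < Re w}"
          by (intro holomorphic_intros lin_holomorphic)
        fix q :: nat
        have "bal 0 (1 / 2 ^ q) = \<i> * complex_of_real (1 / 2 ^ q)" by (simp add: bal_def complex_eq_iff)
        then have "bal 0 (1 / 2 ^ q) = \<i> / 2 ^ q" by simp
        with eig[of 0 "1 / 2 ^ q" j] obtain a where "lin 0 (\<i> / 2 ^ q) (e j) = a *s e j" by auto
        then show "lin 0 (\<i> / 2 ^ q) (e j) $ i * e j $ p - lin 0 (\<i> / 2 ^ q) (e j) $ p * e j $ i = 0" by simp
      qed
      then have "lin 0 1 (e j) = (lin 0 1 (e j) $ p / e j $ p) *s e j"
        using p by (simp add: vec_eq_iff field_simps)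
      then show ?thesis by blast
    qed (simp add: complex_linear_0[OF lin_linear])
    then obtain a where a: "lin 0 1 (e j) = a *s e j" by blast
    have "bal 1 0 = - 1" by (simp add: bal_def complex_eq_iff)
    with eig[of 1 0 j] obtain b where b: "lin 1 (- 1) (e j) = b *s e j" by auto
    have "lin 1 0 (e j) = lin 1 (- 1) (lin 0 1 (e j))" by (simp flip: lin_add)
    also have "\<dots> = (a * b) *s e j" by (simp add: a b complex_linear_scale[OF lin_linear] vector_smult_assoc)
    finally show ?thesis by blast
  qed
  then obtain lam where "\<And>j. lin 1 0 (e j) = lam j *s e j" by metis
  with e(2) show ?thesis by blast
qed

end

subsection \<open>From a germ to a global automorphism\<close>

context hopf_contraction
begin

definition it_lin :: "int \<Rightarrow> complex ^ 'n \<Rightarrow> complex ^ 'n" where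
  "it_lin k = frechet_derivative (it k) (at 0)"

lemma it_lin_linear: "complex_linear (it_lin k)"
  unfolding it_lin_def by (rule frechet_complex_linear[OF holo_it]) simp

lemma it_lin_add: "it_lin (k + l) v = it_lin k (it_lin l v)"
proof -
  have "it (k + l) = (\<lambda>z. it k (it l z))" by (simp add: fun_eq_iff it_add)
  then show ?thesis
    unfolding it_lin_def using frechet_compose[OF holo_it holo_it, of 0 l k v] by simp
qed

lemma it_lin_0 [simp]: "it_lin 0 v = v"
proof -
  have "it 0 = (\<lambda>z. z)" by (simp add: fun_eq_iff)
  then show ?thesis by (simp add: it_lin_def)
qed

lemma it_lin_cancel [simp]: "it_lin (- k) (it_lin k v) = v" "it_lin k (it_lin (- k) v) = v"
  using it_lin_add[of "- k" k v] it_lin_add[of k "- k" v] by simp_all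

lemma it_lin_small:
  assumes "0 < e"
  shows "\<exists>N. \<forall>m\<ge>N. norm (it_lin (int m) v) < e"
proof -
  define \<eta> where "\<eta> = e / (real CARD('n) * (norm v + 1))"
  have n: "0 < real CARD('n)" by simp
  have v: "0 < norm v + 1" by (simp add: add_nonneg_pos)
  have \<eta>: "0 < \<eta>" unfolding \<eta>_def using assms v by (intro divide_pos_pos mult_pos_pos) auto
  obtain N where N: "\<And>m z. N \<le> m \<Longrightarrow> norm z \<le> 1 \<Longrightarrow> norm ((\<gamma> ^^ m) z) < \<eta>"
    using iterates_small[OF \<eta>, of 1] by blast
  have "norm (it_lin (int m) v) < e" if m: "N \<le> m" for m
  proof -
    have "norm (it_lin (int m) v) \<le> real CARD('n) * (\<eta> / 1) * norm v"
      unfolding it_lin_def using N[OF m]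
      by (intro holo_bounds(1)[OF open_UNIV holo_it]) (auto simp: it_of_nat intro: less_imp_le)
    also have "\<dots> < real CARD('n) * \<eta> * (norm v + 1)" using n \<eta> by (simp add: algebra_simps)
    also have "\<dots> = e" using n v by (simp add: \<eta>_def)
    finally show ?thesis .
  qed
  then show ?thesis by blast
qed

text \<open>
  Close to the origin \<open>h\<close> is injective, being a small perturbation of the identity. Every point
  reaches the domain of \<open>h\<close> under iteration, and the maps \<open>it_lin (- N) \<circ> h \<circ> it N\<close> agree where
  they are defined, by the conjugation property of \<open>h\<close>; together they form the global conjugation.
\<close>

lemma global_linearization:
  assumes r: "0 < r" and \<delta>: "0 < \<delta>" and h_holo: "holo_on (ball 0 r) h"
    and h_quad: "\<And>z. z \<in> ball 0 r \<Longrightarrow> norm (h z - z) \<le> K * (norm z)\<^sup>2"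
    and h_conj: "\<And>z. norm z < \<delta> \<Longrightarrow> norm (\<gamma> z) < r \<and> h (\<gamma> z) = it_lin 1 (h z)"
  shows "\<exists>g\<in>Aut0. \<forall>z. g (\<gamma> z) = it_lin 1 (g z)"
proof -
  define n where "n = real CARD('n)"
  have n: "1 \<le> n" unfolding n_def by (simp add: Suc_leI)
  define K' where "K' = max K 1"
  have K': "1 \<le> K'" by (simp add: K'_def)
  define \<rho> where "\<rho> = min (r / 4) (min \<delta> (1 / (8 * n * K')))"
  have \<rho>: "0 < \<rho>" "2 * \<rho> < r" "\<rho> \<le> \<delta>" using r \<delta> n K' by (auto simp: \<rho>_def)
  have "\<rho> \<le> 1 / (8 * n * K')" by (simp add: \<rho>_def)
  then have \<rho>n: "n * (K' * (2 * \<rho>)\<^sup>2 / \<rho>) \<le> 1 / 2"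
    using n K' \<rho>(1) by (simp add: power2_eq_square field_simps)
  have sub: "cball 0 (2 * \<rho>) \<subseteq> ball (0 :: complex ^ 'n) r" using \<rho> by auto
  \<comment> \<open>near the origin \<open>h\<close> is the identity plus a map with Lipschitz constant one half\<close>
  define e where "e z = h z + (- 1) *s z" for z
  have e_holo: "holo_on (ball 0 r) e"
    unfolding e_def[abs_def] using h_holo
    by (intro holo_on_add holo_on_scale) (auto intro!: holo_complex_linear simp: complex_linear_def)
  have e_M: "norm (e y) \<le> K' * (2 * \<rho>)\<^sup>2" if "y \<in> cball 0 (2 * \<rho>)" for y
  proof -
    have "norm (e y) \<le> K * (norm y)\<^sup>2" using h_quad sub that by (auto simp: e_def)
    also have "\<dots> \<le> K' * (2 * \<rho>)\<^sup>2"
      using that K' by (intro mult_mono power_mono) (auto simp: K'_def)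
    finally show ?thesis .
  qed
  have e_lip: "norm (e x - e y) \<le> 1 / 2 * norm (x - y)" if "x \<in> cball 0 \<rho>" "y \<in> cball 0 \<rho>" for x y
  proof -
    have "norm (e x - e y) \<le> real CARD('n) * (K' * (2 * \<rho>)\<^sup>2 / \<rho>) * norm (x - y)"
      by (rule holo_lipschitz[OF open_ball e_holo \<rho>(1) sub e_M that])
    also have "\<dots> \<le> 1 / 2 * norm (x - y)" using \<rho>n by (intro mult_right_mono) (auto simp: n_def)
    finally show ?thesis .
  qed
  have h_inj: "x = y" if xy: "x \<in> cball 0 \<rho>" "y \<in> cball 0 \<rho>" "h x = h y" for x y
  proof -
    have "e x - e y = - (x - y)" using xy(3) by (simp add: e_def)
    then have "norm (x - y) \<le> 1 / 2 * norm (x - y)" using e_lip[OF xy(1,2)] by (metis norm_minus_cancel)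
    then show ?thesis by simp
  qed
  have Dh_inj: "v = 0" if x: "x \<in> cball 0 \<rho>" and v: "frechet_derivative h (at x) v = 0" for x v
  proof -
    have xr: "x \<in> ball 0 r" using x \<rho> by auto
    have "(e has_derivative (\<lambda>v. frechet_derivative h (at x) v + (- 1) *s v)) (at x)"
      unfolding e_def[abs_def]
      by (intro has_derivative_add holo_on_frechet(1)[OF h_holo xr] bounded_linear_imp_has_derivative smult.bounded_linear_right)
    then have "frechet_derivative e (at x) v = - v"
      using frechet_derivative_at[of e _ x] v by (auto simp: fun_eq_iff)
    moreover have "norm (frechet_derivative e (at x) v) \<le> real CARD('n) * (K' * (2 * \<rho>)\<^sup>2 / \<rho>) * norm v"
    proof (rule holo_bounds(1)[OF open_ball e_holo \<rho>(1)])
      have s: "cball x \<rho> \<subseteq> cball 0 (2 * \<rho>)" using x by (simp add: cball_subset_cball_iff)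
      then show "cball x \<rho> \<subseteq> ball 0 r" using sub by blast
      show "norm (e y) \<le> K' * (2 * \<rho>)\<^sup>2" if "y \<in> cball x \<rho>" for y using e_M s that by blast
    qed
    ultimately have "norm v \<le> (n * (K' * (2 * \<rho>)\<^sup>2 / \<rho>)) * norm v" by (simp add: n_def)
    also have "\<dots> \<le> 1 / 2 * norm v" using \<rho>n by (intro mult_right_mono) auto
    finally show ?thesis by simp
  qed
  \<comment> \<open>\<open>P N z\<close> says that the orbit of \<open>z\<close> stays in the domain of \<open>h\<close> from step \<open>N\<close> on\<close>
  define P where "P N z \<longleftrightarrow> (\<forall>M\<ge>N. norm ((\<gamma> ^^ M) z) < \<rho>)" for N z
  define val where "val N z = it_lin (- int N) (h (it (int N) z))" for N z
  have P_unif: "\<exists>N. \<forall>z. norm z \<le> R \<longrightarrow> P N z" for R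
    using iterates_small[OF \<rho>(1), of R] unfolding P_def by blast
  have val_Suc: "val (Suc N) z = val N z" if "P N z" for N z
  proof -
    have "norm (it (int N) z) < \<delta>" using that \<rho> by (auto simp: P_def it_of_nat)
    then have "h (\<gamma> (it (int N) z)) = it_lin 1 (h (it (int N) z))" using h_conj by blast
    moreover have "it (int (Suc N)) z = \<gamma> (it (int N) z)" using it_plus_1[of "int N" z] by (simp add: add.commute)
    ultimately show ?thesis by (simp add: val_def flip: it_lin_add)
  qed
  have val_add: "val (N + k) z = val N z" if "P N z" for N k z
    by (induction k) (use that val_Suc P_def in auto)
  have val_eq: "val M z = val N z" if "P M z" "P N z" for M N z
    using val_add[OF that(1), of N] val_add[OF that(2), of M] by (simp add: add.commute)
  define H where "H z = val (SOME N. P N z) z" for z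
  have H_val: "H z = val N z" if "P N z" for N z
    unfolding H_def by (rule val_eq[OF someI[of "\<lambda>N. P N z"] that]) (rule that)
  have val_deriv: "(val N has_derivative (\<lambda>v. it_lin (- int N)
      (frechet_derivative h (at (it (int N) x)) (frechet_derivative (it (int N)) (at x) v)))) (at x)"
    if "norm (it (int N) x) < r" for N x
  proof -
    have a: "(it (int N) has_derivative frechet_derivative (it (int N)) (at x)) (at x)"
      by (rule holo_on_frechet[OF holo_it]) simp
    have b: "(h has_derivative frechet_derivative h (at (it (int N) x))) (at (it (int N) x))"
      by (rule holo_on_frechet[OF h_holo]) (use that in simp)
    show ?thesis
      unfolding val_def[abs_def]
      by (rule bounded_linear.has_derivative[OF complex_linear_imp_bounded[OF it_lin_linear]])
         (rule has_derivative_compose[OF a b])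
  qed
  have H_deriv: "\<exists>D. (H has_derivative D) (at x) \<and> complex_linear D \<and> inj D" for x
  proof -
    obtain N where N: "\<And>z. norm z \<le> norm x + 1 \<Longrightarrow> P N z" using P_unif[of "norm x + 1"] by blast
    define D1 where "D1 = frechet_derivative (it (int N)) (at x)"
    define D2 where "D2 = frechet_derivative h (at (it (int N) x))"
    define D where "D v = it_lin (- int N) (D2 (D1 v))" for v
    have small: "norm (it (int N) x) < \<rho>" using N[of x] by (auto simp: P_def it_of_nat)
    then have xr: "it (int N) x \<in> ball 0 r" using \<rho> by auto
    have der: "(val N has_derivative D) (at x)"
      unfolding D_def[abs_def] D1_def D2_def using small \<rho> by (intro val_deriv) auto
    have near: "val N z = H z" if "z \<in> ball x 1" for z
    proof -
      have "norm z \<le> norm x + 1" using that norm_triangle_sub[of z x] by (simp add: dist_norm norm_minus_commute)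
      then show ?thesis using H_val[OF N] by simp
    qed
    have "(H has_derivative D) (at x)"
      by (rule has_derivative_transform_within_open[OF der open_ball _ near]) auto
    moreover have l: "complex_linear D1" "complex_linear D2"
      unfolding D1_def D2_def
      by (rule frechet_complex_linear[OF holo_it], simp, rule frechet_complex_linear[OF h_holo xr])
    then have "complex_linear D"
      using it_lin_linear[of "- int N"] unfolding D_def complex_linear_def by simp
    moreover have "inj D"
    proof (rule injI)
      fix v w assume "D v = D w"
      then have "it_lin (int N) (D v) = it_lin (int N) (D w)" by simp
      then have "D2 (D1 v - D1 w) = 0" by (simp add: D_def complex_linear_diff[OF l(2)])
      then have D0: "frechet_derivative h (at (it (int N) x)) (D1 v - D1 w) = 0" unfolding D2_def .
      have mem: "it (int N) x \<in> cball 0 \<rho>" using small by simp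
      have "D1 v - D1 w = 0" by (rule Dh_inj[OF mem D0])
      then have "frechet_derivative (it (- int N)) (at (it (int N) x)) (D1 v)
          = frechet_derivative (it (- int N)) (at (it (int N) x)) (D1 w)" by simp
      then show "v = w"
        unfolding D1_def using frechet_compose[OF holo_it holo_it, of x "int N" "- int N"] by simp
    qed
    ultimately show ?thesis by blast
  qed
  have H_holo: "holo_on UNIV H"
    unfolding holo_on_def using H_deriv complex_linear_scale by blast
  have H_conj: "H (\<gamma> z) = it_lin 1 (H z)" for z
  proof -
    obtain N where N: "\<And>y. norm y \<le> max (norm z) (norm (\<gamma> z)) \<Longrightarrow> P N y" using P_unif by blast
    have P: "P N z" "P N (\<gamma> z)" by (rule N; simp)+
    have "norm (it (int N) z) < \<delta>" using P(1) \<rho> by (auto simp: P_def it_of_nat)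
    then have "h (\<gamma> (it (int N) z)) = it_lin 1 (h (it (int N) z))" using h_conj by blast
    moreover have "it (int N) (\<gamma> z) = \<gamma> (it (int N) z)"
      using it_add[of "int N" 1 z] it_plus_1[of "int N" z] by simp
    ultimately show ?thesis by (simp add: H_val[OF P(1)] H_val[OF P(2)] val_def add.commute flip: it_lin_add)
  qed
  have h0: "h 0 = 0" using h_quad[of 0] r by simp
  have H0: "H 0 = 0"
  proof -
    obtain N where "P N 0" using P_unif[of 0] by auto
    from H_val[OF this] show ?thesis by (simp add: val_def h0 complex_linear_0[OF it_lin_linear])
  qed
  have "inj H"
  proof (rule injI)
    fix x y assume eq: "H x = H y"
    obtain N where N: "\<And>z. norm z \<le> max (norm x) (norm y) \<Longrightarrow> P N z" using P_unif by blast
    have P: "P N x" "P N y" by (rule N; simp)+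
    have "it_lin (int N) (val N x) = it_lin (int N) (val N y)" using eq H_val[OF P(1)] H_val[OF P(2)] by simp
    then have "h (it (int N) x) = h (it (int N) y)" by (simp add: val_def)
    moreover have "it (int N) x \<in> cball 0 \<rho>" "it (int N) y \<in> cball 0 \<rho>"
      using P by (auto simp: P_def it_of_nat intro: less_imp_le)
    ultimately have "it (int N) x = it (int N) y" using h_inj by blast
    then show "x = y" by (metis it_cancel(1))
  qed
  moreover have "surj H"
  proof -
    obtain d where d: "0 < d" "\<And>m z. norm z < d \<Longrightarrow> norm ((\<gamma> ^^ m) z) < \<rho>"
      using iterates_stay[OF \<rho>(1)] by blast
    define d' where "d' = min d r"
    have d': "0 < d'" using d r by (simp add: d'_def)
    have der: "(h has_derivative (\<lambda>v. v)) (at 0)"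
      using r h_quad by (intro has_derivative_quadratic[where r = r and K = K]) (auto simp: h0 bounded_linear_ident)
    have "h 0 \<in> interior (h ` ball 0 d')"
    proof (rule sussmann_open_mapping[OF open_ball holo_on_imp_continuous_on[OF h_holo] _ der])
      show "bounded_linear (\<lambda>v :: complex ^ 'n. v)" by (rule bounded_linear_ident)
    qed (use r d' in \<open>auto simp: fun_eq_iff d'_def interior_open\<close>)
    then obtain \<epsilon> where \<epsilon>: "0 < \<epsilon>" "ball 0 \<epsilon> \<subseteq> h ` ball 0 d'"
      unfolding mem_interior h0 by blast
    have "\<exists>z. H z = y" for y
    proof -
      obtain m where "norm (it_lin (int m) y) < \<epsilon>" using it_lin_small[OF \<epsilon>(1)] by blast
      then have "it_lin (int m) y \<in> h ` ball 0 d'" using \<epsilon>(2) by (auto simp: subset_iff)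
      then obtain x where x: "norm x < d'" "h x = it_lin (int m) y" by auto
      define z where "z = it (- int m) x"
      have "P m z"
        unfolding P_def
      proof (intro allI impI)
        fix M assume "m \<le> M"
        then have "(\<gamma> ^^ M) z = (\<gamma> ^^ (M - m)) x"
          using it_add[of "int (M - m)" "int m" z] by (simp add: z_def of_nat_diff flip: it_of_nat)
        then show "norm ((\<gamma> ^^ M) z) < \<rho>" using d(2) x by (simp add: d'_def)
      qed
      from H_val[OF this] have "H z = y" by (simp add: val_def z_def x)
      then show ?thesis ..
    qed
    then show ?thesis by (metis surj_def)
  qed
  ultimately have bijH: "bij H" by (simp add: bij_def)
  have "holo_on UNIV (inv_into UNIV H)"
    unfolding holo_on_def
  proof
    fix y
    obtain x where x: "y = H x" using bijH by (metis bij_pointE)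
    obtain D where D: "(H has_derivative D) (at x)" "complex_linear D" "inj D" using H_deriv by blast
    have "linear D" using complex_linear_imp_bounded[OF D(2)] bounded_linear.linear by blast
    then have "surj D" using D(3) by (rule linear_injective_imp_surjective) simp
    then have DD: "D (inv_into UNIV D v) = v" for v by (rule surj_f_inv_f)
    have "(inv_into UNIV H has_derivative inv_into UNIV D) (at (H x))"
    proof (rule has_derivative_inverse_strong[OF open_UNIV UNIV_I holo_on_imp_continuous_on[OF H_holo] _ D(1)])
      show "inv_into UNIV H (H x) = x" for x using bijH by (simp add: bij_is_inj)
      show "D \<circ> inv_into UNIV D = id" using DD by (simp add: fun_eq_iff)
    qed
    moreover have "inv_into UNIV D (c *s v) = c *s inv_into UNIV D v" for c v
      by (rule injD[OF D(3)]) (simp add: DD complex_linear_scale[OF D(2)])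
    ultimately show "\<exists>D. (inv_into UNIV H has_derivative D) (at y) \<and> (\<forall>c v. D (c *s v) = c *s D v)"
      unfolding x by blast
  qed
  then have "H \<in> Aut0" using bijH H_holo H0 by (simp add: Aut0_def)
  with H_conj show ?thesis by blast
qed

text \<open>
  The linear change of coordinates to the eigenbasis completes the conjugation. The eigenvalues
  lie in the punctured disc because the iterates of the linear part tend to \<open>0\<close>.
\<close>

lemma linearizable_imp_diagonal:
  assumes g: "g \<in> Aut0" "\<And>z. g (\<gamma> z) = it_lin 1 (g z)"
    and e: "bij (\<lambda>x. \<Sum>j\<in>UNIV. x $ j *s e j)" "\<And>j :: 'n. it_lin 1 (e j) = lam j *s e j"
  shows "\<not> non_diagonal \<gamma>"
proof -
  define Q where "Q x = (\<Sum>j\<in>UNIV. x $ j *s e j)" for x :: "complex ^ 'n"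
  have Q: "bij Q" using e(1) by (simp add: Q_def[abs_def])
  have Ql: "complex_linear Q"
    unfolding complex_linear_def Q_def
    by (simp add: vec.scale_left_distrib sum.distrib vec.scale_sum_right vector_smult_assoc)
  define Qi where "Qi = inv_into UNIV Q"
  have Qi: "Qi (Q x) = x" "Q (Qi x) = x" for x
    using Q by (simp_all add: Qi_def bij_is_inj bij_is_surj surj_f_inv_f)
  have Qil: "complex_linear Qi"
    unfolding complex_linear_def
    by (metis Qi complex_linear_add[OF Ql] complex_linear_scale[OF Ql])
  define l where "l = (\<chi> j. lam j)"
  have AQ: "it_lin 1 (Q x) = Q (diag_map l x)" for x
    by (simp add: Q_def complex_linear_sum[OF it_lin_linear] complex_linear_scale[OF it_lin_linear] e(2)
        diag_map_def l_def vector_smult_assoc mult.commute)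
  have e0: "e j \<noteq> 0" for j
  proof
    assume "e j = 0"
    have "Q (axis j 1) = (\<Sum>i\<in>UNIV. (if i = j then 1 else 0) *s e i)"
      unfolding Q_def by (intro sum.cong refl) (simp add: axis_def)
    also have "\<dots> = 0" using \<open>e j = 0\<close> by (intro sum.neutral) auto
    also have "\<dots> = Q 0" by (simp add: complex_linear_0[OF Ql])
    finally have "axis j (1 :: complex) = 0" using Q by (simp add: bij_is_inj inj_eq)
    then show False by (simp add: axis_eq_0_iff)
  qed
  have disc: "l $ j \<in> punctured_disc" for j
  proof -
    have pow: "it_lin (int m) (e j) = lam j ^ m *s e j" for m
    proof (induction m)
      case (Suc m)
      have "it_lin (int (Suc m)) (e j) = it_lin 1 (it_lin (int m) (e j))" by (simp flip: it_lin_add)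
      then show ?case using Suc by (simp add: complex_linear_scale[OF it_lin_linear] e(2) vector_smult_assoc mult.commute)
    qed simp
    have "lam j \<noteq> 0"
    proof
      assume "lam j = 0"
      then have "it_lin (- 1) (it_lin 1 (e j)) = 0" by (simp add: e(2) complex_linear_0[OF it_lin_linear])
      then show False using e0 by simp
    qed
    moreover have "cmod (lam j) < 1"
    proof (rule ccontr)
      assume *: "\<not> cmod (lam j) < 1"
      obtain m where "norm (it_lin (int m) (e j)) < norm (e j)"
        using it_lin_small[of "norm (e j)" "e j"] e0 by auto
      then have "cmod (lam j) ^ m < 1" using e0[of j] by (simp add: pow norm_smult norm_power)
      moreover have "1 \<le> cmod (lam j) ^ m" using * by (intro one_le_power) simp
      ultimately show False by simp
    qed
    ultimately show ?thesis by (simp add: punctured_disc_def l_def)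
  qed
  define f where "f z = Qi (g z)" for z
  have gb: "bij g" "holo_on UNIV g" "holo_on UNIV (inv_into UNIV g)" "g 0 = 0" using g(1) by (auto simp: Aut0_def)
  have bf: "bij f"
  proof -
    have "bij Qi" using Q by (simp add: Qi_def bij_imp_bij_inv)
    from bij_comp[OF gb(1) this] show ?thesis by (simp add: f_def[abs_def] o_def)
  qed
  have f_inv: "inv_into UNIV f = (\<lambda>y. inv_into UNIV g (Q y))"
  proof (rule inv_equality)
    show "inv_into UNIV g (Q (f x)) = x" for x using gb(1) by (simp add: f_def Qi bij_is_inj)
    show "f (inv_into UNIV g (Q y)) = y" for y using gb(1) by (simp add: f_def Qi bij_is_surj surj_f_inv_f)
  qed
  have "f \<in> Aut0"
    unfolding Aut0_def
  proof (intro CollectI conjI bf)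
    show "holo_on UNIV f" unfolding f_def[abs_def]
      by (rule holo_on_compose[OF gb(2) holo_complex_linear[OF Qil, of UNIV]]) simp
    show "holo_on UNIV (inv_into UNIV f)" unfolding f_inv
      by (rule holo_on_compose[OF holo_complex_linear[OF Ql, of UNIV] gb(3)]) simp
    show "f 0 = 0" using gb(4) by (simp add: f_def complex_linear_0[OF Qil])
  qed
  moreover have "f \<circ> \<gamma> \<circ> inv_into UNIV f = diag_map l"
  proof
    fix y
    have "g (inv_into UNIV g (Q y)) = Q y" using gb(1) by (simp add: bij_is_surj surj_f_inv_f)
    then show "(f \<circ> \<gamma> \<circ> inv_into UNIV f) y = diag_map l y" by (simp add: f_inv f_def g(2) AQ Qi)
  qed
  ultimately show ?thesis using disc unfolding non_diagonal_def by blast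
qed

end

context entire_flow
begin

theorem not_non_diagonal: "\<not> non_diagonal \<gamma>"
proof -
  have lin: "lin 1 0 = it_lin 1"
  proof -
    have "act 1 0 = it 1" by (simp add: fun_eq_iff act_def \<Theta>_0)
    then show ?thesis by (simp add: lin_def it_lin_def)
  qed
  obtain h r \<delta> K where "0 < r" "0 < \<delta>" "holo_on (ball 0 r) h"
    "\<forall>z\<in>ball 0 r. norm (h z - z) \<le> K * (norm z)\<^sup>2"
    "\<forall>z. norm z < \<delta> \<longrightarrow> norm (\<gamma> z) < r \<and> h (\<gamma> z) = lin 1 0 (h z)"
    using local_linearization by blast
  then obtain g where g: "g \<in> Aut0" "\<And>z. g (\<gamma> z) = it_lin 1 (g z)"
    using global_linearization[of r \<delta> h K] unfolding lin by blast
  obtain e lam where e: "bij (\<lambda>x. \<Sum>j\<in>UNIV. x $ j *s e j)" "\<And>j :: 'n. it_lin 1 (e j) = lam j *s e j"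
    using linear_part_diagonalizable unfolding lin by blast
  show ?thesis by (rule linearizable_imp_diagonal[OF g e])
qed

end

context torus_line
begin

text \<open>
  The slope \<open>a\<close> of the displacement is not \<open>0\<close>, by \<open>X_zero\<close>, and dividing time by it makes the
  slope \<open>1\<close>.
\<close>

lemma rescaled_flow:
  assumes "X \<noteq> (\<lambda>z. 0)"
  obtains a C where "a \<noteq> 0" "entire_flow \<gamma> (\<lambda>w z. if z = 0 then 0 else cflow (w / a) z) C"
proof -
  obtain a C where aC: "\<And>w z. z \<noteq> 0 \<Longrightarrow> \<bar>displ w z - Re (a * w)\<bar> \<le> C"
    using displ_linear by blast
  have a: "a \<noteq> 0"
  proof
    assume "a = 0"
    then show False using X_zero[of C] aC assms by simp
  qed
  have "entire_flow \<gamma> (\<lambda>w z. if z = 0 then 0 else cflow (w / a) z) C"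
  proof
    fix w w' :: complex and z :: "complex ^ 'n" and k j
    show "(if (0 :: complex ^ 'n) = 0 then 0 else cflow (w / a) 0) = 0" by simp
    show "(if z = 0 then 0 else cflow (w / a) z) \<noteq> 0" if "z \<noteq> 0" using that cflow_nz by simp
    show "(if z = 0 then 0 else cflow (0 / a) z) = z" using cflow_0 by simp
    show "(if z = 0 then 0 else cflow ((w + w') / a) z) =
        (if (if z = 0 then 0 else cflow (w' / a) z) = 0 then 0
         else cflow (w / a) (if z = 0 then 0 else cflow (w' / a) z))"
      using cflow_nz by (simp add: add_divide_distrib cflow_add)
    show "(if it k z = 0 then 0 else cflow (w / a) (it k z)) = it k (if z = 0 then 0 else cflow (w / a) z)"
      using cflow_it by simp
    show "holo_on (- {0}) (\<lambda>z. if z = 0 then 0 else cflow (w / a) z)"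
      by (rule holo_on_cong[OF _ cflow_holo[of "w / a"]]) (auto simp: open_Compl)
    show "(\<lambda>w. (if z = 0 then 0 else cflow (w / a) z) $ j) holomorphic_on UNIV"
    proof (cases "z = 0")
      case False
      have "(\<lambda>w. cflow w z $ j) \<circ> (\<lambda>w. w / a) holomorphic_on UNIV"
        by (rule holomorphic_on_compose_gen[OF _ cflow_entire[OF False]]) (use a in \<open>auto intro!: holomorphic_intros\<close>)
      with False show ?thesis by (simp add: o_def)
    qed simp
    show "\<bar>height (if z = 0 then 0 else cflow (w / a) z) - height z - Re w\<bar> \<le> C" if "z \<noteq> 0"
      using aC[OF that, of "w / a"] a that by (simp add: displ_def)
  qed
  with a that show thesis by blast
qed

theorem diagonalizable:
  assumes "X \<noteq> (\<lambda>z. 0)"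
  shows "\<not> non_diagonal \<gamma>"
proof -
  obtain a C where "entire_flow \<gamma> (\<lambda>w z. if z = 0 then 0 else cflow (w / a) z) C"
    using rescaled_flow[OF assms] by blast
  then show ?thesis by (rule entire_flow.not_non_diagonal)
qed

end

section \<open>Diagonal contractions\<close>

text \<open>
  Diagonal maps are parametrized by logarithms of their entries, so that composition becomes
  addition.
\<close>

definition ediag :: "complex ^ 'n \<Rightarrow> complex ^ 'n \<Rightarrow> complex ^ 'n" where
  "ediag v z = (\<chi> j. exp (v $ j) * z $ j)"

lemma ediag_nth [simp]: "ediag v z $ j = exp (v $ j) * z $ j"
  by (simp add: ediag_def)

lemma ediag_add: "ediag (v + w) z = ediag v (ediag w z)"
  by (simp add: vec_eq_iff exp_add)

lemma ediag_0 [simp]: "ediag 0 z = z"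
  by (simp add: vec_eq_iff)

lemma ediag_cancel [simp]: "ediag (- v) (ediag v z) = z" "ediag v (ediag (- v) z) = z"
  by (simp_all flip: ediag_add)

lemma ediag_eq_0_iff [simp]: "ediag v z = 0 \<longleftrightarrow> z = 0"
  by (simp add: vec_eq_iff)

lemma ediag_linear: "complex_linear (ediag v)"
  by (simp add: complex_linear_def vec_eq_iff algebra_simps)

lemma ediag_cont: "continuous_on S (\<lambda>p. ediag (f p) (g p))"
  if "continuous_on S f" "continuous_on S g"
  unfolding ediag_def using that by (intro continuous_intros)

definition diag_vf :: "complex ^ 'n \<Rightarrow> complex ^ 'n \<Rightarrow> complex ^ 'n" where
  "diag_vf a z = (\<chi> j. a $ j * z $ j)"

lemma diag_vf_nth [simp]: "diag_vf a z $ j = a $ j * z $ j"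
  by (simp add: diag_vf_def)

lemma scale_diag_vf: "scale_vf c (diag_vf a) = diag_vf (c *s a)"
  by (simp add: scale_vf_def fun_eq_iff vec_eq_iff algebra_simps)

locale diagonal_contraction = hopf_contraction \<gamma> for \<gamma> :: "complex ^ 'n \<Rightarrow> complex ^ 'n" +
  fixes lam :: "complex ^ 'n"
  assumes lam: "lam $ j \<in> punctured_disc" and \<gamma>_diag: "\<gamma> = diag_map lam"
begin

definition Lam :: "complex ^ 'n" where
  "Lam = (\<chi> j. Ln (lam $ j))"

definition logs :: "complex ^ 'n" where
  "logs = (\<chi> j. complex_of_real (ln (cmod (lam $ j))))"

lemma lam_bounds: "0 < cmod (lam $ j)" "cmod (lam $ j) < 1" "lam $ j \<noteq> 0"
  using lam[of j] by (auto simp: punctured_disc_def)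

lemma exp_Lam: "exp (Lam $ j) = lam $ j"
  using lam_bounds(3) by (simp add: Lam_def)

lemma Re_Lam: "Re (Lam $ j) = ln (cmod (lam $ j))"
  using lam_bounds(3) by (simp add: Lam_def)

lemma logs_neg: "ln (cmod (lam $ j)) < 0"
  using lam_bounds by simp

lemma Z_field_eq: "Z_field lam = diag_vf logs"
  by (simp add: fun_eq_iff vec_eq_iff Z_field_def logs_def)

lemma \<gamma>_ediag: "\<gamma> z = ediag Lam z"
  by (simp add: \<gamma>_diag diag_map_def vec_eq_iff exp_Lam)

lemma it_ediag: "it k z = ediag (of_int k *s Lam) z"
proof (induction k rule: int_induct[where k = 0])
  case (step1 i)
  have "it (i + 1) z = ediag Lam (it i z)" by (rule trans[OF it_plus_1 \<gamma>_ediag])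
  also have "\<dots> = ediag (Lam + of_int i *s Lam) z" by (simp add: step1 ediag_add)
  also have "Lam + of_int i *s Lam = of_int (i + 1) *s Lam" by (simp add: vec_eq_iff algebra_simps)
  finally show ?case .
next
  case (step2 i)
  have "it (i - 1) z = it (- 1) (it i z)" by (simp flip: it_add)
  also have "\<dots> = ediag (- Lam) (it i z)"
  proof -
    have "\<gamma> (it (- 1) (it i z)) = it i z" using it_plus_1[of "- 1"] by simp
    then show ?thesis by (metis \<gamma>_ediag ediag_cancel(1))
  qed
  also have "\<dots> = ediag (- Lam + of_int i *s Lam) z" by (simp only: step2 ediag_add)
  also have "- Lam + of_int i *s Lam = of_int (i - 1) *s Lam" by (simp add: vec_eq_iff algebra_simps)
  finally show ?case .
qed simp

lemma ediag_it: "ediag v (it k z) = it k (ediag v z)"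
  by (simp add: it_ediag add.commute flip: ediag_add)

subsection \<open>The automorphisms induced by diagonal maps\<close>

text \<open>
  The choice of a representative is harmless, as diagonal maps commute with \<open>\<gamma>\<close>.
\<close>

definition ind :: "complex ^ 'n \<Rightarrow> (complex ^ 'n) set \<Rightarrow> (complex ^ 'n) set" where
  "ind v = (\<lambda>p\<in>hopf \<gamma>. hopf_class \<gamma> (ediag v (SOME z. z \<in> p)))"

lemma ind_class: "z \<noteq> 0 \<Longrightarrow> ind v (hopf_class \<gamma> z) = hopf_class \<gamma> (ediag v z)"
proof -
  assume z: "z \<noteq> 0"
  have "(SOME y. y \<in> hopf_class \<gamma> z) \<in> hopf_class \<gamma> z"
    using hopf_class_self by (rule someI)
  then obtain k where "(SOME y. y \<in> hopf_class \<gamma> z) = it k z" unfolding hopf_class_it by blast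
  then show ?thesis using z by (simp add: ind_def ediag_it hopf_class_in)
qed

lemma ind_in: "p \<in> hopf \<gamma> \<Longrightarrow> ind v p \<in> hopf \<gamma>"
  by (metis ediag_eq_0_iff hopf_cases hopf_class_in ind_class)

lemma ind_ind: "p \<in> hopf \<gamma> \<Longrightarrow> ind v (ind w p) = ind (v + w) p"
  by (metis ediag_add ediag_eq_0_iff hopf_cases ind_class)

lemma ind_0: "p \<in> hopf \<gamma> \<Longrightarrow> ind 0 p = p"
  by (metis ediag_0 hopf_cases ind_class)

lemma ind_extensional: "ind v \<in> extensional (hopf \<gamma>)"
  by (simp add: ind_def)

lemma ind_one: "ind 0 = \<one>\<^bsub>BijGroup (hopf \<gamma>)\<^esub>"
  unfolding BijGroup_def
  by (simp, rule extensionalityI[OF ind_extensional[of 0]]) (auto simp: ind_0)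

lemma ind_eqI:
  assumes "F \<in> extensional (hopf \<gamma>)" "\<And>z. z \<noteq> 0 \<Longrightarrow> F (hopf_class \<gamma> z) = hopf_class \<gamma> (ediag v z)"
  shows "F = ind v"
proof (rule extensionalityI[OF assms(1) ind_extensional])
  fix p assume "p \<in> hopf \<gamma>"
  then show "F p = ind v p" by (metis assms(2) hopf_cases ind_class)
qed

lemma ind_eq_iff: "ind v = ind w \<longleftrightarrow> (\<exists>k. \<forall>j. exp (v $ j) = exp (w $ j + of_int k * Lam $ j))"
proof
  define o1 :: "complex ^ 'n" where "o1 = (\<chi> j. 1)"
  have o1: "o1 \<noteq> 0" by (simp add: o1_def vec_eq_iff)
  assume "ind v = ind w"
  then have "hopf_class \<gamma> (ediag v o1) = hopf_class \<gamma> (ediag w o1)" by (metis ind_class o1)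
  then obtain k where "ediag v o1 = it k (ediag w o1)" using hopf_class_eq_iff by blast
  then have "ediag v o1 = ediag (w + of_int k *s Lam) o1" by (simp add: it_ediag add.commute flip: ediag_add)
  then show "\<exists>k. \<forall>j. exp (v $ j) = exp (w $ j + of_int k * Lam $ j)"
    by (auto simp: vec_eq_iff o1_def)
next
  assume "\<exists>k. \<forall>j. exp (v $ j) = exp (w $ j + of_int k * Lam $ j)"
  then obtain k where k: "\<And>j. exp (v $ j) = exp (w $ j + of_int k * Lam $ j)" by blast
  have "ediag v z = it k (ediag w z)" for z
    by (simp add: it_ediag vec_eq_iff k exp_add)
  then show "ind v = ind w" by (intro ind_eqI ind_extensional) (simp add: ind_class)
qed

lemma ind_bij: "bij_betw (ind v) (hopf \<gamma>) (hopf \<gamma>)"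
  by (rule bij_betwI[where g = "ind (- v)"]) (auto simp: ind_in ind_ind ind_0)

lemma ind_Bij: "ind v \<in> Bij (hopf \<gamma>)"
  by (simp add: Bij_def ind_bij ind_extensional)

lemma ind_inverse: "restrict (inv_into (hopf \<gamma>) (ind v)) (hopf \<gamma>) = ind (- v)"
proof (rule extensionalityI[OF restrict_extensional ind_extensional])
  fix p assume p: "p \<in> hopf \<gamma>"
  have "inv_into (hopf \<gamma>) (ind v) p = ind (- v) p"
    using ind_bij[of v] p by (intro inv_into_f_eq) (auto simp: bij_betw_def ind_in ind_ind ind_0)
  then show "restrict (inv_into (hopf \<gamma>) (ind v)) (hopf \<gamma>) p = ind (- v) p" using p by simp
qed

text \<open>
  The map \<open>ediag v\<close> is a global holomorphic lift of \<open>ind v\<close>.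
\<close>

lemma ind_holo: "hopf_holo \<gamma> (ind v)"
  unfolding hopf_holo_def
proof (intro conjI allI impI)
  show "continuous_map (hopf_topology \<gamma>) (hopf_topology \<gamma>) (ind v)"
    unfolding continuous_map topspace_hopf
  proof (intro conjI allI impI)
    show "ind v ` hopf \<gamma> \<subseteq> hopf \<gamma>" by (auto simp: ind_in)
    fix U assume "openin (hopf_topology \<gamma>) U"
    then have U: "open {z. z \<noteq> 0 \<and> hopf_class \<gamma> z \<in> U}" by (simp add: openin_hopf_topology)
    have "continuous_on UNIV (ediag v)" by (intro ediag_cont continuous_intros)
    with U have "open (ediag v -` {z. z \<noteq> 0 \<and> hopf_class \<gamma> z \<in> U})" by (intro open_vimage)
    also have "ediag v -` {z. z \<noteq> 0 \<and> hopf_class \<gamma> z \<in> U} =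
        {z. z \<noteq> 0 \<and> hopf_class \<gamma> z \<in> {p \<in> hopf \<gamma>. ind v p \<in> U}}"
    proof (rule Set.set_eqI)
      fix y
      show "y \<in> ediag v -` {z. z \<noteq> 0 \<and> hopf_class \<gamma> z \<in> U} \<longleftrightarrow>
          y \<in> {z. z \<noteq> 0 \<and> hopf_class \<gamma> z \<in> {p \<in> hopf \<gamma>. ind v p \<in> U}}"
        by (cases "y = 0") (simp_all add: ind_class hopf_class_in)
    qed
    finally show "openin (hopf_topology \<gamma>) {p \<in> hopf \<gamma>. ind v p \<in> U}"
      by (simp add: openin_hopf_topology)
  qed
  fix z :: "complex ^ 'n" assume "z \<noteq> 0"
  then show "\<exists>U f. open U \<and> z \<in> U \<and> 0 \<notin> U \<and> holo_on U f \<and>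
      (\<forall>w\<in>U. f w \<noteq> 0 \<and> ind v (hopf_class \<gamma> w) = hopf_class \<gamma> (f w))"
    by (intro exI[of _ "- {0}"] exI[of _ "ediag v"])
       (auto simp: open_Compl ind_class intro: holo_complex_linear[OF ediag_linear])
qed

lemma ind_aut: "ind v \<in> hopf_aut \<gamma>"
  unfolding hopf_aut_def by (simp add: ind_Bij ind_holo ind_inverse)

lemma ind_mult: "ind v \<otimes>\<^bsub>BijGroup (hopf \<gamma>)\<^esub> ind w = ind (v + w)"
proof -
  have "compose (hopf \<gamma>) (ind v) (ind w) = ind (v + w)"
    by (rule extensionalityI[OF _ ind_extensional]) (auto simp: compose_eq ind_ind)
  then show ?thesis by (simp add: BijGroup_mult ind_Bij)
qed

lemma ind_inv: "inv\<^bsub>BijGroup (hopf \<gamma>)\<^esub> ind v = ind (- v)"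
proof -
  interpret B: group "BijGroup (hopf \<gamma>)" by (rule group_BijGroup)
  show ?thesis
    by (rule B.inv_equality) (simp_all add: ind_mult ind_one, simp_all add: BijGroup_def ind_Bij)
qed

lemma ind_subgroup:
  assumes "0 \<in> V" "\<And>v w. v \<in> V \<Longrightarrow> w \<in> V \<Longrightarrow> v + w \<in> V" "\<And>v. v \<in> V \<Longrightarrow> - v \<in> V"
  shows "subgroup (ind ` V) (BijGroup (hopf \<gamma>))"
proof
  show "ind ` V \<subseteq> carrier (BijGroup (hopf \<gamma>))" by (auto simp: BijGroup_def ind_Bij)
  show "x \<otimes>\<^bsub>BijGroup (hopf \<gamma>)\<^esub> y \<in> ind ` V" if "x \<in> ind ` V" "y \<in> ind ` V" for x y
    using that assms(2) by (auto simp: ind_mult)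
  show "\<one>\<^bsub>BijGroup (hopf \<gamma>)\<^esub> \<in> ind ` V" using assms(1) by (auto simp flip: ind_one)
  show "inv\<^bsub>BijGroup (hopf \<gamma>)\<^esub> x \<in> ind ` V" if "x \<in> ind ` V" for x
    using that assms(3) by (auto simp: ind_inv)
qed

subsection \<open>Linear diagonal vector fields\<close>

lemma diag_vf_in: "diag_vf a \<in> hopf_vf \<gamma>"
proof -
  have l: "complex_linear (diag_vf a)" by (simp add: complex_linear_def vec_eq_iff algebra_simps)
  have g: "\<gamma> = ediag Lam" by (simp add: fun_eq_iff \<gamma>_ediag)
  have "frechet_derivative \<gamma> (at z) = \<gamma>" for z
    unfolding g
    using frechet_derivative_at[OF bounded_linear_imp_has_derivative[OF complex_linear_imp_bounded[OF ediag_linear]]]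
    by metis
  moreover have "diag_vf a (\<gamma> z) = \<gamma> (diag_vf a z)" for z by (simp add: g vec_eq_iff)
  ultimately show ?thesis
    using holo_complex_linear[OF l] complex_linear_0[OF l] by (simp add: hopf_vf_def)
qed

lemma flow_diag_vf:
  fixes a z :: "complex ^ 'n"
  assumes z: "z \<noteq> 0"
  shows "flow (diag_vf a) t z = ediag (of_real t *s a) z"
proof -
  have "solves (diag_vf a) (- {0}) UNIV (\<lambda>t. ediag (of_real t *s a) z)"
    unfolding solves_def
  proof (intro ballI conjI)
    fix t
    show "ediag (of_real t *s a) z \<in> - {0}" using z by simp
    have "((\<lambda>t. exp (of_real t * a $ j) * z $ j) has_vector_derivative a $ j * (exp (of_real t * a $ j) * z $ j)) (at t)" for j
      by (rule has_vector_derivative_real_field[THEN has_vector_derivative_eq_rhs])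
         (auto intro!: derivative_eq_intros)
    then show "((\<lambda>t. ediag (of_real t *s a) z) has_vector_derivative diag_vf a (ediag (of_real t *s a) z)) (at t)"
      unfolding has_vector_derivative_def
      by (intro has_derivative_vecI) simp
  qed
  from flow_unique_UNIV[OF diag_vf_in this, of t] show ?thesis by simp
qed

lemma exp_diag_vf: "exp_vf \<gamma> (diag_vf a) = ind a"
  by (rule ind_eqI[OF exp_vf_extensional]) (simp add: exp_vf_class[OF diag_vf_in] flow_diag_vf)

lemma exp_Z: "exp_vf \<gamma> (scale_vf s (Z_field lam)) = ind (s *s logs)"
  by (simp add: Z_field_eq scale_diag_vf exp_diag_vf)

lemma generated_Z: "generated_by_vf \<gamma> (Z_field lam) = ind ` range (\<lambda>s. s *s logs)"
  by (auto simp: generated_by_vf_def exp_Z)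

lemma logs_nz: "logs \<noteq> 0"
proof
  assume "logs = 0"
  then have "logs $ j = 0" for j by simp
  then show False using logs_neg[of undefined] by (simp only: logs_def vec_lambda_beta of_real_eq_0_iff)
qed

lemma Z_nz: "Z_field lam \<noteq> (\<lambda>z. 0)"
proof
  assume "Z_field lam = (\<lambda>z. 0)"
  then have "diag_vf logs (\<chi> j. 1) = 0" by (simp add: Z_field_eq fun_eq_iff)
  then show False using logs_nz by (simp add: vec_eq_iff)
qed

subsection \<open>Complex lines in a torus are spanned by \<open>Z\<close>\<close>

text \<open>
  With \<open>k\<close> the integral part of \<open>Re w\<close>, the map \<open>ediag (w *s logs)\<close> is \<open>it k\<close> up to a diagonal map
  with entries of modulus between \<open>cmod (lam $ j)\<close> and \<open>1\<close>. Such maps form a compact set and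
  change heights by a bounded amount.
\<close>

lemma height_ediag_logs: "\<exists>B. \<forall>w z. z \<noteq> 0 \<longrightarrow> \<bar>height (ediag (w *s logs) z) - height z - Re w\<bar> \<le> B"
proof -
  define A where "A = {c :: complex ^ 'n. \<forall>j. cmod (lam $ j) \<le> cmod (c $ j) \<and> cmod (c $ j) \<le> 1}"
  have "norm x \<le> real CARD('n) * 1" if "x \<in> A" for x
    using that by (intro norm_le_components) (simp add: A_def)
  then have "bounded A" unfolding bounded_iff by blast
  moreover have "closed A"
    unfolding A_def by (intro closed_Collect_all closed_Collect_conj closed_Collect_le continuous_intros)
  ultimately have A: "compact (A \<times> shell)" by (intro compact_Times compact_shell) (simp add: compact_eq_bounded_closed)
  have "continuous_on (A \<times> shell) (\<lambda>p. height (diag_map (fst p) (snd p)))"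
  proof (rule continuous_on_compose2[OF cont_height])
    show "continuous_on (A \<times> shell) (\<lambda>p. diag_map (fst p) (snd p))"
      unfolding diag_map_def by (intro continuous_intros)
    have "diag_map c z \<noteq> 0" if "c \<in> A" "z \<in> shell" for c z
    proof -
      have "c $ j \<noteq> 0" for j
      proof
        assume "c $ j = 0"
        then show False using that(1) lam_bounds(1)[of j] by (auto simp: A_def dest!: spec[of _ j])
      qed
      then show ?thesis using that(2) by (auto simp: diag_map_def vec_eq_iff shell_def)
    qed
    then show "(\<lambda>p. diag_map (fst p) (snd p)) ` (A \<times> shell) \<subseteq> - {0}" by force
  qed
  then have "bounded ((\<lambda>p. height (diag_map (fst p) (snd p))) ` (A \<times> shell))"
    by (intro compact_imp_bounded compact_continuous_image A)
  then obtain B where B: "\<And>c z. c \<in> A \<Longrightarrow> z \<in> shell \<Longrightarrow> \<bar>height (diag_map c z)\<bar> \<le> B"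
    unfolding bounded_iff by fastforce
  have shell_case: "\<bar>height (ediag (w *s logs) z) - height z - Re w\<bar> \<le> B + 2" if z: "z \<in> shell" for w z
  proof -
    define k where "k = \<lfloor>Re w\<rfloor>"
    define c where "c = (\<chi> j. exp (w * logs $ j - of_int k * Lam $ j))"
    have z0: "z \<noteq> 0" using z by (auto simp: shell_def)
    have k: "0 \<le> Re w - of_int k" "Re w - of_int k \<le> 1" unfolding k_def by linarith+
    have "c \<in> A"
      unfolding A_def
    proof (intro CollectI allI conjI)
      fix j
      have n: "cmod (c $ j) = exp ((Re w - of_int k) * ln (cmod (lam $ j)))"
        by (simp add: c_def logs_def Re_Lam algebra_simps)
      have "(Re w - of_int k) * ln (cmod (lam $ j)) \<le> 0" using k(1) logs_neg[of j] by (intro mult_nonneg_nonpos) auto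
      then show "cmod (c $ j) \<le> 1" by (simp add: n)
      have "1 * ln (cmod (lam $ j)) \<le> (Re w - of_int k) * ln (cmod (lam $ j))"
        using k(2) logs_neg[of j] by (intro mult_right_mono_neg) auto
      then have "exp (ln (cmod (lam $ j))) \<le> cmod (c $ j)" by (simp add: n)
      then show "cmod (lam $ j) \<le> cmod (c $ j)" using lam_bounds(1)[of j] by simp
    qed
    moreover have "ediag (w *s logs) z = it k (diag_map c z)"
      by (simp add: it_ediag vec_eq_iff diag_map_def c_def exp_diff)
    moreover have "diag_map c z \<noteq> 0"
      using z0 by (auto simp: diag_map_def c_def vec_eq_iff)
    moreover have "0 \<le> height z" "height z \<le> 1" using z by (auto simp: shell_def)
    ultimately show ?thesis using B[of c z] z k by (simp add: height_it abs_le_iff)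
  qed
  have "\<bar>height (ediag (w *s logs) z) - height z - Re w\<bar> \<le> B + 2" if z: "z \<noteq> 0" for w z
  proof -
    from z obtain k where "it k z \<in> shell" by (rule shell_cases)
    from shell_case[OF this, of w] show ?thesis
      using z by (simp add: ediag_it height_it)
  qed
  then show ?thesis by blast
qed

text \<open>
  The complex flow of \<open>X\<close> and the group \<open>ediag (w *s logs)\<close> change the height by the same
  amount up to a bounded error, so composing one with the inverse of the other gives bounded
  entire curves.
\<close>

lemma torus_line_unique:
  assumes tl: "torus_line \<gamma> H X" and X: "X \<noteq> (\<lambda>z. 0)"
  shows "\<exists>a. a \<noteq> 0 \<and> X = scale_vf a (Z_field lam)"
proof -
  interpret torus_line \<gamma> H X by (rule tl)
  obtain a C where a: "a \<noteq> 0" and ef: "entire_flow \<gamma> (\<lambda>w z. if z = 0 then 0 else cflow (w / a) z) C"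
    using rescaled_flow[OF X] by blast
  obtain B where B: "\<And>w z. z \<noteq> 0 \<Longrightarrow> \<bar>height (ediag (w *s logs) z) - height z - Re w\<bar> \<le> B"
    using height_ediag_logs by blast
  have eq: "cflow (w / a) z = ediag (w *s logs) z" if z: "z \<noteq> 0" for w z
  proof -
    define \<psi> where "\<psi> w = ediag (- w *s logs) (cflow (w / a) z)" for w
    have ent: "(\<lambda>w. cflow (w / a) z $ j) holomorphic_on UNIV" for j
      using entire_flow.\<Theta>_entire[OF ef, of z j] z by simp
    have "(\<lambda>w. \<psi> w $ j) holomorphic_on UNIV" for j
      unfolding \<psi>_def by (simp, intro holomorphic_intros ent)
    moreover obtain R where R: "\<And>y. y \<noteq> 0 \<Longrightarrow> height z - C - B \<le> height y \<Longrightarrow> norm y \<le> R"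
      using height_bounded by blast
    have "norm (\<psi> w) \<le> R" for w
    proof (rule R)
      show "\<psi> w \<noteq> 0" using cflow_nz[OF z] by (simp add: \<psi>_def)
      show "height z - C - B \<le> height (\<psi> w)"
        using B[OF cflow_nz[OF z, of "w / a"], of "- w"] entire_flow.\<Theta>_height[OF ef z, of w] z
        unfolding \<psi>_def by simp
    qed
    ultimately have "\<psi> w = \<psi> 0" by (intro Liouville_curve)
    also have "\<psi> 0 = z" by (simp add: \<psi>_def cflow_0[OF z])
    finally have "ediag (w *s logs) (\<psi> w) = ediag (w *s logs) z" by simp
    then show ?thesis by (simp add: \<psi>_def flip: ediag_add)
  qed
  have "X z = scale_vf a (Z_field lam) z" for z
  proof (cases "z = 0")
    case True
    then show ?thesis using X_vf by (simp add: hopf_vf_def scale_vf_def Z_field_eq vec_eq_iff[of "diag_vf logs 0"])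
  next
    case False
    have "cflow w z = ediag ((a * w) *s logs) z" for w using eq[OF False, of "a * w"] a by simp
    then have "((\<lambda>w. ediag ((a * w) *s logs) z) has_derivative (\<lambda>h. h *s X z)) (at 0)"
      using cflow_has_derivative[OF False, of 0] by (simp add: cflow_0[OF False])
    moreover have "((\<lambda>w. ediag ((a * w) *s logs) z) has_derivative (\<lambda>h. h *s scale_vf a (Z_field lam) z)) (at 0)"
    proof (rule has_derivative_vecI)
      fix j
      have "((\<lambda>w. exp (a * w * logs $ j) * z $ j) has_field_derivative a * logs $ j * z $ j) (at 0)"
        by (auto intro!: derivative_eq_intros)
      then show "((\<lambda>w. ediag ((a * w) *s logs) z $ j) has_derivative (\<lambda>h. (h *s scale_vf a (Z_field lam) z) $ j)) (at 0)"
        using mult_commute_abs[of "a * logs $ j * z $ j"]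
        by (simp add: has_field_derivative_def scale_vf_def Z_field_eq mult.assoc)
    qed
    ultimately have "(\<lambda>h. h *s X z) = (\<lambda>h. h *s scale_vf a (Z_field lam) z)" by (rule has_derivative_unique)
    then show ?thesis by (metis vector_smult_lid)
  qed
  with a show ?thesis by (metis ext)
qed

end

subsection \<open>Hausdorff topologies\<close>

context hopf_contraction
begin

lemma hopf_Hausdorff: "Hausdorff_space (hopf_topology \<gamma>)"
  unfolding Hausdorff_space_def topspace_hopf
proof (intro allI impI, elim conjE)
  fix p q assume "p \<in> hopf \<gamma>" "q \<in> hopf \<gamma>" "p \<noteq> q"
  then obtain y z where y: "y \<noteq> 0" "p = hopf_class \<gamma> y" and z: "z \<noteq> 0" "q = hopf_class \<gamma> z"
    by (metis hopf_cases)
  \<comment> \<open>only one iterate of \<open>y\<close> can come close to \<open>z\<close>, by comparison of heights\<close>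
  define k0 where "k0 = \<lfloor>height z - height y + 1 / 2\<rfloor>"
  have "it k0 y \<noteq> z" using \<open>p \<noteq> q\<close> y z by auto
  then obtain U V where UV: "open U" "open V" "it k0 y \<in> U" "z \<in> V" "U \<inter> V = {}"
    using hausdorff by metis
  define Y where "Y = it k0 -` U \<inter> {x. x \<noteq> 0 \<and> \<bar>height x - height y\<bar> < 1 / 4}"
  define Z where "Z = V \<inter> {x. x \<noteq> 0 \<and> \<bar>height x - height z\<bar> < 1 / 4}"
  have op: "open {x. x \<noteq> 0 \<and> \<bar>height x - c\<bar> < 1 / 4}" for c
  proof -
    have "open (- {0} \<inter> height -` {c - 1 / 4<..<c + 1 / 4})"
      by (rule continuous_open_preimage[OF cont_height]) (auto simp: open_Compl)
    also have "- {0} \<inter> height -` {c - 1 / 4<..<c + 1 / 4} = {x. x \<noteq> 0 \<and> \<bar>height x - c\<bar> < 1 / 4}"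
      unfolding abs_diff_less_iff by auto
    finally show ?thesis .
  qed
  have "open (it k0 -` U)" using UV(1) cont_it[of UNIV k0] by (simp add: continuous_on_open_vimage)
  then have oY: "open Y" and oZ: "open Z" unfolding Y_def Z_def using op UV(2) by (auto intro!: open_Int)
  show "\<exists>S T. openin (hopf_topology \<gamma>) S \<and> openin (hopf_topology \<gamma>) T \<and> p \<in> S \<and> q \<in> T \<and> disjnt S T"
  proof (intro exI conjI)
    show "openin (hopf_topology \<gamma>) (hopf_class \<gamma> ` Y)" "openin (hopf_topology \<gamma>) (hopf_class \<gamma> ` Z)"
      using oY oZ by (intro openin_class_image; auto simp: Y_def Z_def)+
    show "p \<in> hopf_class \<gamma> ` Y" "q \<in> hopf_class \<gamma> ` Z"
      using y z UV by (auto simp: Y_def Z_def)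
    show "disjnt (hopf_class \<gamma> ` Y) (hopf_class \<gamma> ` Z)"
      unfolding disjnt_iff
    proof (intro allI notI, elim conjE)
      fix s assume "s \<in> hopf_class \<gamma> ` Y" "s \<in> hopf_class \<gamma> ` Z"
      then obtain y' z' where yz: "y' \<in> Y" "z' \<in> Z" "hopf_class \<gamma> z' = hopf_class \<gamma> y'" by auto
      then obtain k where k: "z' = it k y'" using hopf_class_eq_iff by blast
      have "\<bar>height y' - height y\<bar> < 1 / 4" "\<bar>height z' - height z\<bar> < 1 / 4" "y' \<noteq> 0"
        using yz by (auto simp: Y_def Z_def)
      moreover from \<open>y' \<noteq> 0\<close> have "height z' = height y' + of_int k" unfolding k by (rule height_it)
      ultimately have "\<bar>of_int k - (height z - height y)\<bar> < 1 / 2" by linarith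
      then have "k = k0" unfolding k0_def by linarith
      then show False using yz UV(5) k by (auto simp: Y_def Z_def)
    qed
  qed
qed

lemma aut_Hausdorff: "Hausdorff_space (hopf_aut_topology \<gamma>)"
  unfolding Hausdorff_space_def topspace_hopf_aut
proof (intro allI impI, elim conjE)
  fix F G assume F: "F \<in> hopf_aut \<gamma>" and G: "G \<in> hopf_aut \<gamma>" and "F \<noteq> G"
  have "F \<in> extensional (hopf \<gamma>)" "G \<in> extensional (hopf \<gamma>)"
    using F G by (auto dest!: hopf_aut_Bij simp: Bij_def)
  then obtain p where p: "p \<in> hopf \<gamma>" "F p \<noteq> G p" using \<open>F \<noteq> G\<close> extensionalityI by metis
  obtain U V where UV: "openin (hopf_topology \<gamma>) U" "openin (hopf_topology \<gamma>) V" "F p \<in> U" "G p \<in> V" "disjnt U V"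
    using hopf_Hausdorff p hopf_aut_image[OF F p(1)] hopf_aut_image[OF G p(1)]
    unfolding Hausdorff_space_def topspace_hopf by metis
  have K: "compactin (hopf_topology \<gamma>) {p}" using p by (simp add: topspace_hopf)
  let ?S = "\<lambda>U. {F \<in> hopf_aut \<gamma>. F ` {p} \<subseteq> U}"
  have "F \<in> ?S U" "G \<in> ?S V" "disjnt (?S U) (?S V)" using F G UV(3,4,5) by (auto simp: disjnt_iff)
  then show "\<exists>S T. openin (hopf_aut_topology \<gamma>) S \<and> openin (hopf_aut_topology \<gamma>) T \<and> F \<in> S \<and> G \<in> T \<and> disjnt S T"
    using openin_subbasic[OF K UV(1)] openin_subbasic[OF K UV(2)] by blast
qed

end

context diagonal_contraction
begin

text \<open>
  Continuity of \<open>ind\<close> in the compact-open topology: a compact set of classes is covered by the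
  images of finitely many open sets of representatives, each of which is mapped correctly by
  all nearby parameters.
\<close>

lemma ind_continuous: "continuous_map euclidean (hopf_aut_topology \<gamma>) ind"
  unfolding hopf_aut_topology_def continuous_on_generated_topo_iff
proof (intro conjI allI impI)
  show "ind ` topspace euclidean \<subseteq> \<Union> {{F \<in> hopf_aut \<gamma>. F ` K \<subseteq> U} |K U.
      compactin (hopf_topology \<gamma>) K \<and> openin (hopf_topology \<gamma>) U}"
  proof
    fix F assume "F \<in> ind ` topspace euclidean"
    then have "F \<in> topspace (hopf_aut_topology \<gamma>)" using ind_aut by (auto simp: topspace_hopf_aut)
    then show "F \<in> \<Union> {{F \<in> hopf_aut \<gamma>. F ` K \<subseteq> U} |K U.
        compactin (hopf_topology \<gamma>) K \<and> openin (hopf_topology \<gamma>) U}"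
      unfolding hopf_aut_topology_def topology_generated_by_topspace .
  qed
  fix A assume "A \<in> {{F \<in> hopf_aut \<gamma>. F ` K \<subseteq> U} |K U. compactin (hopf_topology \<gamma>) K \<and> openin (hopf_topology \<gamma>) U}"
  then obtain K U where A: "A = {F \<in> hopf_aut \<gamma>. F ` K \<subseteq> U}" and K: "compactin (hopf_topology \<gamma>) K"
    and U: "openin (hopf_topology \<gamma>) U" by blast
  define O' where "O' = {z. z \<noteq> 0 \<and> hopf_class \<gamma> z \<in> U}"
  have O': "open O'" using U by (simp add: O'_def openin_hopf_topology)
  have "continuous_on UNIV (\<lambda>p. ediag (fst p :: complex ^ 'n) (snd p))" by (intro ediag_cont continuous_intros)
  with O' have W: "open ((\<lambda>p. ediag (fst p) (snd p)) -` O')" by (intro open_vimage)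
  have Ksub: "K \<subseteq> hopf \<gamma>" using compactin_subset_topspace[OF K] by (simp add: topspace_hopf)
  have "open (ind -` A)"
    unfolding open_subopen[of "ind -` A"]
  proof
    fix v assume v: "v \<in> ind -` A"
    define good where "good p V B \<longleftrightarrow> open V \<and> open B \<and> v \<in> V \<and> B \<subseteq> - {0} \<and> p \<in> hopf_class \<gamma> ` B \<and>
        (\<forall>w\<in>V. \<forall>z\<in>B. ediag w z \<in> O')" for p V B
    have "\<exists>V B. good p V B" if p: "p \<in> K" for p
    proof -
      obtain z where z: "z \<noteq> 0" "p = hopf_class \<gamma> z" using p Ksub hopf_cases by blast
      have "ind v p \<in> U" using v p by (auto simp: A)
      then have "(v, z) \<in> (\<lambda>p. ediag (fst p) (snd p)) -` O'" using z by (simp add: O'_def ind_class)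
      then obtain V B where "open V" "open B" "(v, z) \<in> V \<times> B"
        and sub: "V \<times> B \<subseteq> (\<lambda>p. ediag (fst p) (snd p)) -` O'"
        by (rule open_prod_elim[OF W])
      then have VB: "open V" "open B" "v \<in> V" "z \<in> B" by auto
      have inO: "ediag w y \<in> O'" if "w \<in> V" "y \<in> B" for w y using sub that by force
      have "B \<subseteq> - {0}" using inO[OF VB(3)] by (force simp: O'_def)
      moreover have "p \<in> hopf_class \<gamma> ` B" using VB(4) z(2) by blast
      ultimately show ?thesis
        unfolding good_def using VB(1-3) inO by (intro exI[of _ V] exI[of _ B] conjI) simp_all
    qed
    then obtain V B where "\<And>p. p \<in> K \<Longrightarrow> good p (V p) (B p)" by metis
    then have VB: "\<And>p. p \<in> K \<Longrightarrow> open (V p)" "\<And>p. p \<in> K \<Longrightarrow> open (B p)" "\<And>p. p \<in> K \<Longrightarrow> v \<in> V p"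
      "\<And>p. p \<in> K \<Longrightarrow> B p \<subseteq> - {0}" "\<And>p. p \<in> K \<Longrightarrow> p \<in> hopf_class \<gamma> ` B p"
      "\<And>p w z. p \<in> K \<Longrightarrow> w \<in> V p \<Longrightarrow> z \<in> B p \<Longrightarrow> ediag w z \<in> O'"
      unfolding good_def by blast+
    define \<C> where "\<C> = (\<lambda>p. hopf_class \<gamma> ` B p) ` K"
    have "\<And>C. C \<in> \<C> \<Longrightarrow> openin (hopf_topology \<gamma>) C" using VB(2,4) openin_class_image by (auto simp: \<C>_def)
    moreover have "K \<subseteq> \<Union> \<C>" using VB(5) by (auto simp: \<C>_def)
    ultimately obtain \<C>' where \<C>': "finite \<C>'" "\<C>' \<subseteq> \<C>" "K \<subseteq> \<Union> \<C>'"
      using K unfolding compactin_def by metis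
    then obtain P where P: "P \<subseteq> K" "finite P" "\<C>' = (\<lambda>p. hopf_class \<gamma> ` B p) ` P"
      unfolding \<C>_def using finite_subset_image by metis
    have "open (\<Inter>p\<in>P. V p)" using P VB(1) by (intro open_INT) auto
    moreover have "v \<in> (\<Inter>p\<in>P. V p)" using P VB(3) by auto
    moreover have "(\<Inter>p\<in>P. V p) \<subseteq> ind -` A"
    proof
      fix w assume w: "w \<in> (\<Inter>p\<in>P. V p)"
      have "ind w q \<in> U" if q: "q \<in> K" for q
      proof -
        obtain p z where p: "p \<in> P" "z \<in> B p" "q = hopf_class \<gamma> z" using \<C>'(3) P(3) q by blast
        then have "ediag w z \<in> O'" using VB(6)[of p w z] P(1) w by blast
        moreover have "z \<noteq> 0" using VB(4)[of p] p P(1) by auto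
        ultimately show ?thesis using p(3) by (simp add: O'_def ind_class)
      qed
      then show "w \<in> ind -` A" using ind_aut by (auto simp: A)
    qed
    ultimately show "\<exists>T. open T \<and> v \<in> T \<and> T \<subseteq> ind -` A" by blast
  qed
  then show "openin euclidean (ind -` A \<inter> topspace euclidean)" by simp
qed

subsection \<open>The torus of diagonal automorphisms\<close>

definition idx :: "'n \<Rightarrow> nat" where
  "idx = (SOME f. bij_betw f UNIV {..<CARD('n)})"

lemma idx: "bij_betw idx UNIV {..<CARD('n)}"
proof -
  have "\<exists>f. bij_betw f (UNIV :: 'n set) {..<CARD('n)}" by (rule finite_same_card_bij) auto
  then show ?thesis unfolding idx_def by (rule someI_ex)
qed

lemma idx_less: "idx j < CARD('n)"
  using idx by (auto simp: bij_betw_def)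

lemma idx_ex: "i < CARD('n) \<Longrightarrow> \<exists>j. idx j = i"
  using idx by (metis bij_betw_def imageE lessThan_iff)

text \<open>
  Angles parametrize the torus: the first ones rotate the coordinates and the last one is the
  time along a one-parameter group that passes through \<open>\<gamma>\<close> after a full turn.
\<close>

definition angle_vec :: "(nat \<Rightarrow> real) \<Rightarrow> complex ^ 'n" where
  "angle_vec \<theta> = (\<chi> j. \<i> * complex_of_real (\<theta> (idx j)) + complex_of_real (\<theta> (CARD('n)) / (2 * pi)) * Lam $ j)"

lemma angle_vec_add: "angle_vec (\<lambda>i. \<theta> i + \<theta>' i) = angle_vec \<theta> + angle_vec \<theta>'"
  by (simp add: angle_vec_def vec_eq_iff algebra_simps add_divide_distrib)

lemma angle_vec_0: "angle_vec (\<lambda>i. 0) = 0"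
  by (simp add: angle_vec_def vec_eq_iff)

lemma angle_vec_uminus: "angle_vec (\<lambda>i. - \<theta> i) = - angle_vec \<theta>"
  by (simp add: angle_vec_def vec_eq_iff)

text \<open>
  Equality of the moduli of the entries, which do not see the rotations, determines the last
  angle up to full turns; then the arguments determine the other angles.
\<close>

lemma angle_ind_eq_iff:
  "ind (angle_vec \<theta>) = ind (angle_vec \<theta>') \<longleftrightarrow> (\<forall>i<Suc CARD('n). cis (\<theta> i) = cis (\<theta>' i))"
proof
  let ?n = "CARD('n)"
  assume "\<forall>i<Suc ?n. cis (\<theta> i) = cis (\<theta>' i)"
  then have eq: "cis (\<theta> (idx j)) = cis (\<theta>' (idx j))" "cis (\<theta> ?n) = cis (\<theta>' ?n)" for j
    using idx_less[of j] by (auto simp: less_Suc_eq)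
  have "cis (\<theta> ?n - \<theta>' ?n) = 1" using eq(2) by (simp add: cis_divide[symmetric])
  then have "cos (\<theta> ?n - \<theta>' ?n) = 1" by (metis cis.sel(1) one_complex.sel(1))
  then obtain k :: int where k: "\<theta> ?n - \<theta>' ?n = of_int k * (2 * pi)"
    using cos_one_2pi_int by (metis mult.assoc mult.commute)
  have t: "\<theta> ?n / (2 * pi) = \<theta>' ?n / (2 * pi) + of_int k" using k by (simp add: field_simps)
  have "exp (angle_vec \<theta> $ j) = exp (angle_vec \<theta>' $ j + of_int k * Lam $ j)" for j
  proof -
    have "exp (angle_vec \<theta> $ j) = cis (\<theta> (idx j)) * exp (complex_of_real (\<theta> ?n / (2 * pi)) * Lam $ j)"
      by (simp add: angle_vec_def exp_add cis_conv_exp)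
    also have "\<dots> = cis (\<theta>' (idx j)) * exp (complex_of_real (\<theta>' ?n / (2 * pi) + of_int k) * Lam $ j)"
      by (simp only: eq(1) t)
    also have "\<dots> = exp (angle_vec \<theta>' $ j + of_int k * Lam $ j)"
      by (simp add: angle_vec_def exp_add cis_conv_exp algebra_simps)
    finally show ?thesis .
  qed
  then show "ind (angle_vec \<theta>) = ind (angle_vec \<theta>')" unfolding ind_eq_iff by blast
next
  let ?n = "CARD('n)"
  assume "ind (angle_vec \<theta>) = ind (angle_vec \<theta>')"
  then obtain k where k: "\<And>j. exp (angle_vec \<theta> $ j) = exp (angle_vec \<theta>' $ j + of_int k * Lam $ j)"
    unfolding ind_eq_iff by blast
  have Re_eq: "\<theta> ?n / (2 * pi) = \<theta>' ?n / (2 * pi) + of_int k"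
  proof -
    fix j :: 'n
    have "cmod (exp (angle_vec \<theta> $ j)) = cmod (exp (angle_vec \<theta>' $ j + of_int k * Lam $ j))" using k by simp
    then have "\<theta> ?n / (2 * pi) * Re (Lam $ j) = (\<theta>' ?n / (2 * pi) + of_int k) * Re (Lam $ j)"
      by (simp add: angle_vec_def algebra_simps)
    then show "\<theta> ?n / (2 * pi) = \<theta>' ?n / (2 * pi) + of_int k"
      using logs_neg[of j] by (simp only: mult_cancel_right) (simp add: Re_Lam)
  qed
  have n: "cis (\<theta> ?n) = cis (\<theta>' ?n)"
  proof -
    have "\<theta> ?n = \<theta>' ?n + 2 * pi * of_int k" using Re_eq by (simp add: field_simps)
    then have "cis (\<theta> ?n) = cis (\<theta>' ?n) * cis (2 * pi * of_int k)" by (simp only: cis_mult)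
    then show ?thesis using cis_multiple_2pi[of "of_int k"] by simp
  qed
  have "cis (\<theta> (idx j)) = cis (\<theta>' (idx j))" for j
  proof -
    have "cis (\<theta> (idx j)) * exp (complex_of_real (\<theta> ?n / (2 * pi)) * Lam $ j) = exp (angle_vec \<theta> $ j)"
      by (simp add: angle_vec_def exp_add cis_conv_exp)
    also have "\<dots> = exp (angle_vec \<theta>' $ j + of_int k * Lam $ j)" by (rule k)
    also have "\<dots> = cis (\<theta>' (idx j)) * exp (complex_of_real (\<theta>' ?n / (2 * pi) + of_int k) * Lam $ j)"
      by (simp add: angle_vec_def exp_add cis_conv_exp algebra_simps)
    finally show ?thesis by (simp only: Re_eq) simp
  qed
  then have "cis (\<theta> i) = cis (\<theta>' i)" if "i < ?n" for i using idx_ex[OF that] by metis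
  with n show "\<forall>i<Suc ?n. cis (\<theta> i) = cis (\<theta>' i)" by (auto simp: less_Suc_eq)
qed

definition diag_torus :: "((complex ^ 'n) set \<Rightarrow> (complex ^ 'n) set) set" where
  "diag_torus = ind ` range angle_vec"

text \<open>
  The discontinuity of \<open>Arg\<close> does not matter, since \<open>ind (angle_vec \<theta>)\<close> depends only on the
  angles modulo full turns.
\<close>

definition torus_map :: "(nat \<Rightarrow> complex) \<Rightarrow> (complex ^ 'n) set \<Rightarrow> (complex ^ 'n) set" where
  "torus_map x = ind (angle_vec (\<lambda>i. Arg (x i)))"

abbreviation circles :: "nat \<Rightarrow> (nat \<Rightarrow> complex) topology" where
  "circles m \<equiv> product_topology (\<lambda>_. top_of_set (sphere 0 1)) {..<m}"

lemma cis_Arg_circle: "cmod u = 1 \<Longrightarrow> cis (Arg u) = u"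
  by (metis Arg_correct mult_1 norm_zero of_real_1 rcis_cmod_Arg rcis_def)

lemma torus_map_eq:
  assumes "\<And>i. i < Suc CARD('n) \<Longrightarrow> cmod (x i) = 1 \<and> cis (\<theta> i) = x i"
  shows "torus_map x = ind (angle_vec \<theta>)"
  unfolding torus_map_def angle_ind_eq_iff using assms cis_Arg_circle by metis

lemma circles_mem: "x \<in> topspace (circles (Suc CARD('n))) \<Longrightarrow> i < Suc CARD('n) \<Longrightarrow> cmod (x i) = 1"
  by (auto simp: topspace_product_topology PiE_iff)

lemma torus_map_image: "torus_map ` topspace (circles (Suc CARD('n))) = diag_torus"
proof
  show "torus_map ` topspace (circles (Suc CARD('n))) \<subseteq> diag_torus" by (auto simp: torus_map_def diag_torus_def)
  show "diag_torus \<subseteq> torus_map ` topspace (circles (Suc CARD('n)))"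
  proof
    fix F assume "F \<in> diag_torus"
    then obtain \<theta> where F: "F = ind (angle_vec \<theta>)" by (auto simp: diag_torus_def)
    define x where "x = (\<lambda>i\<in>{..<Suc CARD('n)}. cis (\<theta> i))"
    have "torus_map x = F" unfolding F by (rule torus_map_eq) (simp add: x_def)
    moreover have "x \<in> topspace (circles (Suc CARD('n)))" by (simp add: x_def topspace_product_topology PiE_iff)
    ultimately show "F \<in> torus_map ` topspace (circles (Suc CARD('n)))" by blast
  qed
qed

lemma torus_map_inj: "inj_on torus_map (topspace (circles (Suc CARD('n))))"
proof (rule inj_onI)
  fix x y assume xy: "x \<in> topspace (circles (Suc CARD('n)))" "y \<in> topspace (circles (Suc CARD('n)))" "torus_map x = torus_map y"
  have "x i = y i" if "i < Suc CARD('n)" for i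
    using xy(3) that cis_Arg_circle[OF circles_mem[OF xy(1) that]] cis_Arg_circle[OF circles_mem[OF xy(2) that]]
    unfolding torus_map_def angle_ind_eq_iff by metis
  then show "x = y"
    using xy(1,2) unfolding topspace_product_topology by (intro PiE_ext) auto
qed

lemma circles_inclusion: "continuous_map (circles (Suc CARD('n))) euclidean (\<lambda>x. x)"
  unfolding euclidean_product_topology[symmetric] continuous_map_componentwise_UNIV
proof
  fix i
  show "continuous_map (circles (Suc CARD('n))) euclidean (\<lambda>x. x i)"
  proof (cases "i < Suc CARD('n)")
    case True
    then have "continuous_map (circles (Suc CARD('n))) (top_of_set (sphere 0 1)) (\<lambda>x. x i)"
      by (intro continuous_map_product_projection) simp
    then show ?thesis by (rule continuous_map_into_fulltopology)
  next
    case False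
    \<comment> \<open>points of the product take the value \<open>undefined\<close> outside the index set\<close>
    have "continuous_map (circles (Suc CARD('n))) euclidean (\<lambda>x. undefined :: complex)" by simp
    then show ?thesis
      by (rule continuous_map_eq) (use False in \<open>auto simp: topspace_product_topology PiE_iff extensional_def\<close>)
  qed
qed

text \<open>Near a given point of the torus the angles can be chosen continuously.\<close>

lemma torus_map_continuous: "continuous_map (circles (Suc CARD('n))) (hopf_aut_topology \<gamma>) torus_map"
  unfolding continuous_map_eq_topcontinuous_at topcontinuous_at_def
proof (intro ballI conjI allI impI)
  show "torus_map \<in> topspace (circles (Suc CARD('n))) \<rightarrow> topspace (hopf_aut_topology \<gamma>)"
    by (auto simp: torus_map_def topspace_hopf_aut ind_aut)
  fix x0 assume x0: "x0 \<in> topspace (circles (Suc CARD('n)))"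
  fix V assume V: "openin (hopf_aut_topology \<gamma>) V \<and> torus_map x0 \<in> V"
  define N where "N = {x :: nat \<Rightarrow> complex. \<forall>i\<in>{..<Suc CARD('n)}. 0 < Re (x i / x0 i)}"
  define \<theta> where "\<theta> x i = (if i < Suc CARD('n) then Arg (x0 i) + Arg (x i / x0 i) else 0)" for x :: "nat \<Rightarrow> complex" and i
  have coord: "continuous_on S (\<lambda>x. x i)" for S and i :: nat
    by (rule continuous_on_subset[OF continuous_on_product_coordinates]) simp
  have x0i: "x0 i \<noteq> 0" if "i < Suc CARD('n)" for i using circles_mem[OF x0 that] by auto
  have N: "open N"
  proof -
    have "N = (\<Inter>i\<in>{..<Suc CARD('n)}. {x. 0 < Re (x i / x0 i)})" by (auto simp: N_def)
    moreover have "open {x :: nat \<Rightarrow> complex. 0 < Re (x i / x0 i)}" if "i \<in> {..<Suc CARD('n)}" for i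
      using x0i that by (intro open_Collect_less continuous_intros coord) auto
    ultimately show ?thesis by (simp only:) (intro open_INT, auto)
  qed
  have c\<theta>: "continuous_on N (\<lambda>x. \<theta> x i)" for i
  proof (cases "i < Suc CARD('n)")
    case True
    have "continuous_on N (\<lambda>x. Arg (x i / x0 i))"
    proof (rule continuous_on_compose2[where g = Arg and t = "- \<real>\<^sub>\<le>\<^sub>0"])
      show "continuous_on (- \<real>\<^sub>\<le>\<^sub>0) Arg" using continuous_at_Arg by (intro continuous_at_imp_continuous_on) auto
      show "continuous_on N (\<lambda>x. x i / x0 i)" using x0i[OF True] by (intro continuous_intros coord) auto
      show "(\<lambda>x. x i / x0 i) ` N \<subseteq> - \<real>\<^sub>\<le>\<^sub>0"
        using True unfolding N_def by (auto simp: complex_nonpos_Reals_iff dest!: bspec[of _ _ i])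
    qed
    then show ?thesis using True unfolding \<theta>_def by (simp add: continuous_on_add)
  qed (simp add: \<theta>_def)
  have "continuous_on N (\<lambda>x. angle_vec (\<theta> x))"
    unfolding angle_vec_def by (intro continuous_intros c\<theta>) auto
  moreover have "open (ind -` V)"
    using ind_continuous V unfolding continuous_map by (simp add: vimage_def)
  ultimately have op: "open (N \<inter> (\<lambda>x. angle_vec (\<theta> x)) -` (ind -` V))"
    using N by (intro continuous_open_preimage)
  define U where "U = {x \<in> topspace (circles (Suc CARD('n))). x \<in> N \<inter> (\<lambda>x. angle_vec (\<theta> x)) -` (ind -` V)}"
  have U: "openin (circles (Suc CARD('n))) U"
    unfolding U_def by (rule openin_continuous_map_preimage[OF circles_inclusion]) (use op in simp)
  have eq: "torus_map x = ind (angle_vec (\<theta> x))" if "x \<in> topspace (circles (Suc CARD('n)))" for x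
  proof (rule torus_map_eq)
    fix i assume i: "i < Suc CARD('n)"
    have "cis (\<theta> x i) = cis (Arg (x0 i)) * cis (Arg (x i / x0 i))" using i by (simp add: \<theta>_def cis_mult)
    also have "\<dots> = x0 i * (x i / x0 i)"
      using circles_mem[OF x0 i] circles_mem[OF that i] by (simp add: cis_Arg_circle norm_divide)
    also have "\<dots> = x i" using x0i[OF i] by simp
    finally show "cmod (x i) = 1 \<and> cis (\<theta> x i) = x i" using circles_mem[OF that i] by simp
  qed
  have "x0 \<in> U"
    using x0 V eq[OF x0] x0i by (auto simp: U_def N_def)
  moreover have "\<forall>y\<in>U. torus_map y \<in> V" using eq by (auto simp: U_def)
  ultimately show "\<exists>U. openin (circles (Suc CARD('n))) U \<and> x0 \<in> U \<and> (\<forall>y\<in>U. torus_map y \<in> V)" using U by blast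
qed

lemma diag_torus_id_comp: "diag_torus \<subseteq> hopf_aut_id_comp \<gamma>"
proof
  fix F assume F: "F \<in> diag_torus"
  have "connected_space (top_of_set (sphere (0 :: complex) 1))"
    using connected_sphere[of "0 :: complex" 1] by (simp add: connectedin_def flip: connectedin_iff_connected)
  then have "connected_space (circles (Suc CARD('n)))" by (simp add: connected_space_product_topology)
  then have "connectedin (circles (Suc CARD('n))) (topspace (circles (Suc CARD('n))))"
    by (simp only: connectedin_topspace)
  from connectedin_continuous_map_image[OF torus_map_continuous this]
  have "connectedin (hopf_aut_topology \<gamma>) diag_torus" unfolding torus_map_image .
  moreover have "\<one>\<^bsub>BijGroup (hopf \<gamma>)\<^esub> \<in> diag_torus"
    unfolding diag_torus_def ind_one[symmetric] using angle_vec_0 by (metis rangeI imageI)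
  ultimately show "F \<in> hopf_aut_id_comp \<gamma>"
    using F unfolding hopf_aut_id_comp_def connected_component_of_def by blast
qed

lemma torus_map_hom:
  assumes x: "x \<in> topspace (circles (Suc CARD('n)))" and y: "y \<in> topspace (circles (Suc CARD('n)))"
  shows "torus_map (\<lambda>i\<in>{..<Suc CARD('n)}. x i * y i) = torus_map x \<otimes>\<^bsub>BijGroup (hopf \<gamma>)\<^esub> torus_map y"
proof -
  have "torus_map (\<lambda>i\<in>{..<Suc CARD('n)}. x i * y i) = ind (angle_vec (\<lambda>i. Arg (x i) + Arg (y i)))"
  proof (rule torus_map_eq)
    fix i assume i: "i < Suc CARD('n)"
    show "cmod ((\<lambda>i\<in>{..<Suc CARD('n)}. x i * y i) i) = 1 \<and>
        cis (Arg (x i) + Arg (y i)) = (\<lambda>i\<in>{..<Suc CARD('n)}. x i * y i) i"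
      using i circles_mem[OF x i] circles_mem[OF y i]
      by (simp add: norm_mult cis_mult[symmetric] cis_Arg_circle)
  qed
  also have "\<dots> = torus_map x \<otimes>\<^bsub>BijGroup (hopf \<gamma>)\<^esub> torus_map y"
    by (simp add: torus_map_def ind_mult angle_vec_add)
  finally show ?thesis .
qed

lemma diag_torus_compact: "compact_torus \<gamma> diag_torus"
  unfolding compact_torus_def
proof (intro conjI exI)
  show "diag_torus \<subseteq> hopf_aut_id_comp \<gamma>" by (rule diag_torus_id_comp)
  show "subgroup diag_torus (BijGroup (hopf \<gamma>))"
    unfolding diag_torus_def
  proof (rule ind_subgroup)
    show "0 \<in> range angle_vec" using angle_vec_0 by (metis rangeI)
    show "v + w \<in> range angle_vec" if "v \<in> range angle_vec" "w \<in> range angle_vec" for v w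
      using that by (auto simp flip: angle_vec_add)
    show "- v \<in> range angle_vec" if "v \<in> range angle_vec" for v
      using that by (auto simp flip: angle_vec_uminus)
  qed
  have tc: "topspace (circles (Suc CARD('n))) = carrier (product_group {..<Suc CARD('n)} (\<lambda>_. circle_group))"
    by (simp add: topspace_product_topology circle_group_def)
  show "torus_map \<in> iso (product_group {..<Suc CARD('n)} (\<lambda>_. circle_group)) ((BijGroup (hopf \<gamma>))\<lparr>carrier := diag_torus\<rparr>)"
    unfolding iso_def
  proof (intro CollectI conjI)
    show "bij_betw torus_map (carrier (product_group {..<Suc CARD('n)} (\<lambda>_. circle_group)))
        (carrier ((BijGroup (hopf \<gamma>))\<lparr>carrier := diag_torus\<rparr>))"
      using torus_map_inj torus_map_image unfolding tc bij_betw_def by simp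
    show "torus_map \<in> hom (product_group {..<Suc CARD('n)} (\<lambda>_. circle_group)) ((BijGroup (hopf \<gamma>))\<lparr>carrier := diag_torus\<rparr>)"
    proof (rule homI)
      fix x y assume xy: "x \<in> carrier (product_group {..<Suc CARD('n)} (\<lambda>_. circle_group))"
        "y \<in> carrier (product_group {..<Suc CARD('n)} (\<lambda>_. circle_group))"
      show "torus_map x \<in> carrier ((BijGroup (hopf \<gamma>))\<lparr>carrier := diag_torus\<rparr>)"
        using xy(1) torus_map_image unfolding tc[symmetric] by auto
      have "x \<otimes>\<^bsub>product_group {..<Suc CARD('n)} (\<lambda>_. circle_group)\<^esub> y = (\<lambda>i\<in>{..<Suc CARD('n)}. x i * y i)"
        by (simp add: product_group_def circle_group_def)
      then show "torus_map (x \<otimes>\<^bsub>product_group {..<Suc CARD('n)} (\<lambda>_. circle_group)\<^esub> y)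
          = torus_map x \<otimes>\<^bsub>(BijGroup (hopf \<gamma>))\<lparr>carrier := diag_torus\<rparr>\<^esub> torus_map y"
        using torus_map_hom xy unfolding tc by simp
    qed
  qed
  show "homeomorphic_map (circles (Suc CARD('n))) (subtopology (hopf_aut_topology \<gamma>) diag_torus) torus_map"
  proof (rule continuous_imp_homeomorphic_map)
    show "compact_space (circles (Suc CARD('n)))"
      by (intro compact_space_product_topology[THEN iffD2] disjI2 ballI) (simp add: compact_space_subtopology)
    show "Hausdorff_space (subtopology (hopf_aut_topology \<gamma>) diag_torus)"
      by (rule Hausdorff_space_subtopology[OF aut_Hausdorff])
    show "continuous_map (circles (Suc CARD('n))) (subtopology (hopf_aut_topology \<gamma>) diag_torus) torus_map"
      using torus_map_image by (intro continuous_map_into_subtopology torus_map_continuous) auto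
    show "torus_map ` topspace (circles (Suc CARD('n))) = topspace (subtopology (hopf_aut_topology \<gamma>) diag_torus)"
      unfolding torus_map_image using diag_torus_id_comp id_comp_subset by (auto simp: topspace_hopf_aut)
  qed (rule torus_map_inj)
qed

lemma generated_Z_in_torus: "generated_by_vf \<gamma> (Z_field lam) \<subseteq> diag_torus"
proof -
  have "s *s logs \<in> range angle_vec" for s
  proof -
    define idi where "idi = inv_into UNIV idx"
    have idi: "idi (idx j) = j" for j using idx by (simp add: idi_def bij_betw_def)
    \<comment> \<open>the real part of \<open>s\<close> is a motion along \<open>Lam\<close>, whose effect on the arguments is undone by rotations\<close>
    define \<theta> where "\<theta> i = (if i < CARD('n) then Im s * ln (cmod (lam $ idi i)) - Re s * Im (Lam $ idi i) else 2 * pi * Re s)" for i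
    have "angle_vec \<theta> = s *s logs"
      by (simp add: vec_eq_iff angle_vec_def \<theta>_def idx_less idi logs_def complex_eq_iff Re_Lam)
    then show ?thesis by (metis rangeI)
  qed
  then show ?thesis unfolding generated_Z diag_torus_def by blast
qed

subsection \<open>The Lie algebra of the group generated by \<open>Z\<close>\<close>

text \<open>
  The group generated by \<open>Z\<close> is not closed in general, so a one-parameter group inside it need not
  be continuous for its intrinsic topology a priori. But the logarithms of the one-parameter group
  differ from multiples of \<open>logs\<close> by elements of a countable group, so that two different times
  have the same such element; their difference shows that the generator is a multiple of \<open>Z\<close>.
\<close>

lemma lie_algebra_generated_Z:
  "lie_algebra \<gamma> (generated_by_vf \<gamma> (Z_field lam)) = range (\<lambda>c. scale_vf c (Z_field lam))"
proof
  show "range (\<lambda>c. scale_vf c (Z_field lam)) \<subseteq> lie_algebra \<gamma> (generated_by_vf \<gamma> (Z_field lam))"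
    by (auto simp: lie_algebra_def Z_field_eq scale_diag_vf diag_vf_in generated_by_vf_def vector_smult_assoc intro!: image_eqI[OF refl])
  show "lie_algebra \<gamma> (generated_by_vf \<gamma> (Z_field lam)) \<subseteq> range (\<lambda>c. scale_vf c (Z_field lam))"
  proof
    fix X assume X_in: "X \<in> lie_algebra \<gamma> (generated_by_vf \<gamma> (Z_field lam))"
    then have X: "X \<in> hopf_vf \<gamma>" by (simp add: lie_algebra_def)
    have "\<exists>k s. \<forall>z. z \<noteq> 0 \<longrightarrow> flow X t z = ediag (of_int k *s Lam + s *s logs) z" for t
    proof -
      obtain s where s: "exp_vf \<gamma> (scale_vf (of_real t) X) = ind (s *s logs)"
        using X_in unfolding lie_algebra_def generated_Z by blast
      have ex: "\<exists>k. flow X t z = it k (ediag (s *s logs) z)" if z: "z \<noteq> 0" for z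
        using exp_vf_scale[OF X z, of t] z by (simp add: s ind_class hopf_class_eq_iff[symmetric])
      define d where "d z = height (flow X t z) - height (ediag (s *s logs) z)" for z
      have d: "\<exists>k. d z = of_int k \<and> flow X t z = it k (ediag (s *s logs) z)" if z: "z \<noteq> 0" for z
        using ex[OF z] z by (auto simp: d_def height_it)
      have "d constant_on - {0}"
      proof (rule integer_valued_constant)
        have "1 \<le> CARD('n)" by (simp add: Suc_leI)
        then show "connected (- {0 :: complex ^ 'n})" by (intro connected_punctured_universe) simp
        show "continuous_on (- {0}) d"
          unfolding d_def
          by (intro continuous_intros continuous_on_compose2[OF cont_height flow_cont_fixed_time[OF X]]
              continuous_on_compose2[OF cont_height ediag_cont]) (use flow_nz[OF X] in force)+
        show "d z \<in> \<int>" if "z \<in> - {0}" for z using d[of z] that by auto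
      qed
      then obtain c where c: "\<And>z. z \<noteq> 0 \<Longrightarrow> d z = c" unfolding constant_on_def by auto
      define o1 :: "complex ^ 'n" where "o1 = (\<chi> j. 1)"
      have o1: "o1 \<noteq> 0" by (simp add: o1_def vec_eq_iff)
      obtain k where k: "d o1 = of_int k" using d[OF o1] by blast
      have "flow X t z = ediag (of_int k *s Lam + s *s logs) z" if z: "z \<noteq> 0" for z
      proof -
        obtain l where l: "d z = of_int l" "flow X t z = it l (ediag (s *s logs) z)" using d[OF z] by blast
        have "l = k" using l(1) k c[OF z] c[OF o1] by simp
        with l(2) show ?thesis by (simp add: it_ediag ediag_add)
      qed
      then show ?thesis by blast
    qed
    then obtain k s where flow: "\<And>t z. z \<noteq> 0 \<Longrightarrow> flow X t z = ediag (of_int (k t) *s Lam + s t *s logs) z" by metis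
    define o1 :: "complex ^ 'n" where "o1 = (\<chi> j. 1)"
    have o1: "o1 \<noteq> 0" by (simp add: o1_def vec_eq_iff)
    define a where "a = X o1"
    have flow_o1: "flow X t z $ j = flow X t o1 $ j * z $ j" if "z \<noteq> 0" for t z j
      by (simp add: flow[OF that] flow[OF o1]) (simp add: o1_def)
    have Xa: "X = diag_vf a"
    proof
      fix z
      show "X z = diag_vf a z"
      proof (cases "z = 0")
        case False
        have "X z $ j = a $ j * z $ j" for j
        proof -
          have "((\<lambda>t. flow X t z $ j) has_vector_derivative X z $ j) (at 0)"
            using bounded_linear.has_vector_derivative[OF bounded_linear_vec_nth[of j] flow_derivative[OF X False, of 0]]
            by (simp add: flow_solves(2)[OF X False])
          moreover have "((\<lambda>t. flow X t o1 $ j * z $ j) has_vector_derivative a $ j * z $ j) (at 0)"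
            using has_vector_derivative_mult_left[OF bounded_linear.has_vector_derivative[OF bounded_linear_vec_nth[of j] flow_derivative[OF X o1, of 0]]]
            by (simp add: flow_solves(2)[OF X o1] a_def)
          ultimately show ?thesis using flow_o1[OF False] vector_derivative_unique_at by (metis (no_types, lifting) ext)
        qed
        then show ?thesis by (simp add: vec_eq_iff)
      next
        case True
        then show ?thesis using X by (simp add: hopf_vf_def vec_eq_iff[of 0 "diag_vf a 0"])
      qed
    qed
    have "\<exists>m. \<forall>j. of_real t * a $ j = of_int (k t) * Lam $ j + s t * logs $ j + 2 * pi * of_int (m j) * \<i>" for t
    proof -
      have "exp (of_real t * a $ j) = exp (of_int (k t) * Lam $ j + s t * logs $ j)" for j
      proof -
        have "ediag (of_real t *s a) o1 = ediag (of_int (k t) *s Lam + s t *s logs) o1"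
          using flow_diag_vf[OF o1, of a t] flow[OF o1, of t] by (simp only: Xa)
        then have "ediag (of_real t *s a) o1 $ j = ediag (of_int (k t) *s Lam + s t *s logs) o1 $ j" by simp
        then show ?thesis by (simp add: o1_def)
      qed
      then have "\<exists>m :: int. of_real t * a $ j = of_int (k t) * Lam $ j + s t * logs $ j + 2 * pi * of_int m * \<i>" for j
      proof -
        assume "\<And>j. exp (of_real t * a $ j) = exp (of_int (k t) * Lam $ j + s t * logs $ j)"
        then obtain m :: int where "of_real t * a $ j = of_int (k t) * Lam $ j + s t * logs $ j + of_int (2 * m) * pi * \<i>"
          using exp_eq[THEN iffD1] by blast
        then show ?thesis by (intro exI[of _ m]) (simp add: mult_ac)
      qed
      then show ?thesis by metis
    qed
    then obtain m where m: "\<And>t j. of_real t * a $ j = of_int (k t) * Lam $ j + s t * logs $ j + 2 * pi * of_int (m t j) * \<i>"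
      by metis
    have "\<not> inj (\<lambda>t. (k t, m t))"
    proof
      assume "inj (\<lambda>t. (k t, m t))"
      then have "countable (UNIV :: real set)"
        by (rule countable_image_inj_on[rotated]) (rule countableI_type)
      then show False using uncountable_UNIV_real by blast
    qed
    then obtain t t' where tt: "t \<noteq> t'" "k t = k t'" "m t = m t'" unfolding inj_def by auto
    define c where "c = (s t - s t') / of_real (t - t')"
    have "a $ j = c * logs $ j" for j
    proof -
      have "of_real t * a $ j - of_real t' * a $ j = s t * logs $ j - s t' * logs $ j"
        using m[of t j] m[of t' j] tt(2,3) by simp
      then have "of_real (t - t') * a $ j = (s t - s t') * logs $ j" by (simp add: algebra_simps)
      moreover have "complex_of_real (t - t') \<noteq> 0" using tt(1) by simp
      ultimately show ?thesis unfolding c_def by (metis nonzero_mult_div_cancel_left times_divide_eq_left)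
    qed
    then have "a = c *s logs" by (simp add: vec_eq_iff)
    then have "X = scale_vf c (Z_field lam)" by (simp add: Xa Z_field_eq scale_diag_vf)
    then show "X \<in> range (\<lambda>c. scale_vf c (Z_field lam))" by blast
  qed
qed

lemma exp_line: "exp_vf \<gamma> ` range (\<lambda>c. scale_vf c (Z_field lam)) = generated_by_vf \<gamma> (Z_field lam)"
  by (auto simp: generated_by_vf_def)

lemma generated_Z_subgroup: "subgroup (generated_by_vf \<gamma> (Z_field lam)) (BijGroup (hopf \<gamma>))"
  unfolding generated_Z
proof (rule ind_subgroup)
  show "0 \<in> range (\<lambda>s. s *s logs)" by (rule image_eqI[of _ _ 0]) simp_all
  show "v + w \<in> range (\<lambda>s. s *s logs)" if "v \<in> range (\<lambda>s. s *s logs)" "w \<in> range (\<lambda>s. s *s logs)" for v w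
  proof -
    from that obtain s t where "v = s *s logs" "w = t *s logs" by blast
    then have "v + w = (s + t) *s logs" by (simp only: vec.scale_left_distrib)
    then show ?thesis by blast
  qed
  show "- v \<in> range (\<lambda>s. s *s logs)" if "v \<in> range (\<lambda>s. s *s logs)" for v
  proof -
    from that obtain s where "v = s *s logs" by blast
    then have "- v = (- s) *s logs" by (simp only: vec.scale_minus_left)
    then show ?thesis by blast
  qed
qed

lemma generate_generated_Z:
  "generate (BijGroup (hopf \<gamma>)) (generated_by_vf \<gamma> (Z_field lam)) = generated_by_vf \<gamma> (Z_field lam)"
proof -
  interpret B: group "BijGroup (hopf \<gamma>)" by (rule group_BijGroup)
  show ?thesis
  proof
    show "generate (BijGroup (hopf \<gamma>)) (generated_by_vf \<gamma> (Z_field lam)) \<subseteq> generated_by_vf \<gamma> (Z_field lam)"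
      by (rule B.generate_subgroup_incl[OF subset_refl generated_Z_subgroup])
  qed (auto intro: generate.incl)
qed

text \<open>
  The Lie algebra of a complex one-dimensional group in a torus is a line to which
  \<open>torus_line_unique\<close> applies. Conversely the group generated by \<open>Z\<close> lies in \<open>diag_torus\<close>, and
  by \<open>lie_algebra_generated_Z\<close> its Lie algebra is no larger than the line of \<open>Z\<close>.
\<close>

theorem complex_lines:
  "{G. complex_one_dim_subgroup \<gamma> G \<and> (\<exists>H. compact_torus \<gamma> H \<and> G \<subseteq> H)} = {generated_by_vf \<gamma> (Z_field lam)}"
proof (intro equalityI subsetI)
  fix G assume "G \<in> {G. complex_one_dim_subgroup \<gamma> G \<and> (\<exists>H. compact_torus \<gamma> H \<and> G \<subseteq> H)}"
  then obtain H X where H: "compact_torus \<gamma> H" "G \<subseteq> H" and X: "X \<in> hopf_vf \<gamma>" "X \<noteq> (\<lambda>z. 0)"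
    and lie: "lie_algebra \<gamma> G = range (\<lambda>c. scale_vf c X)"
    and gen: "G = generate (BijGroup (hopf \<gamma>)) (exp_vf \<gamma> ` lie_algebra \<gamma> G)"
    unfolding complex_one_dim_subgroup_def by auto
  have sub: "lie_algebra \<gamma> G \<subseteq> lie_algebra \<gamma> H" using H(2) by (auto simp: lie_algebra_def)
  have "scale_vf 1 X \<in> lie_algebra \<gamma> G" "scale_vf \<i> X \<in> lie_algebra \<gamma> G" unfolding lie by blast+
  then have "torus_line \<gamma> H X"
    using sub H(1) by unfold_locales (auto simp: J_vf_def)
  then obtain a where a: "a \<noteq> 0" "X = scale_vf a (Z_field lam)" using torus_line_unique X(2) by blast
  have "range (\<lambda>c. scale_vf c X) = range (\<lambda>c. scale_vf c (Z_field lam))"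
  proof (intro equalityI subsetI)
    fix Y assume "Y \<in> range (\<lambda>c. scale_vf c (Z_field lam))"
    then obtain c where "Y = scale_vf c (Z_field lam)" by blast
    then have "Y = scale_vf (c / a) X" using a by (simp add: scale_vf_scale)
    then show "Y \<in> range (\<lambda>c. scale_vf c X)" by blast
  qed (auto simp: a(2) scale_vf_scale)
  then have "G = generated_by_vf \<gamma> (Z_field lam)" using gen unfolding lie by (simp add: exp_line generate_generated_Z)
  then show "G \<in> {generated_by_vf \<gamma> (Z_field lam)}" by simp
next
  fix G assume "G \<in> {generated_by_vf \<gamma> (Z_field lam)}"
  then have G: "G = generated_by_vf \<gamma> (Z_field lam)" by simp
  have "complex_one_dim_subgroup \<gamma> G"
    unfolding complex_one_dim_subgroup_def
  proof (intro conjI)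
    show "G \<subseteq> hopf_aut_id_comp \<gamma>" using generated_Z_in_torus diag_torus_id_comp by (auto simp: G)
    show "subgroup G (BijGroup (hopf \<gamma>))" unfolding G by (rule generated_Z_subgroup)
    show "\<exists>X\<in>hopf_vf \<gamma>. X \<noteq> (\<lambda>z. 0) \<and> lie_algebra \<gamma> G = range (\<lambda>c. scale_vf c X)"
      using Z_nz lie_algebra_generated_Z diag_vf_in[of logs] by (auto simp: G Z_field_eq)
    show "G = generate (BijGroup (hopf \<gamma>)) (exp_vf \<gamma> ` lie_algebra \<gamma> G)"
      by (simp only: G lie_algebra_generated_Z exp_line generate_generated_Z)
  qed
  then show "G \<in> {G. complex_one_dim_subgroup \<gamma> G \<and> (\<exists>H. compact_torus \<gamma> H \<and> G \<subseteq> H)}"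
    using generated_Z_in_torus diag_torus_compact by (auto simp: G)
qed

end

section \<open>The theorem\<close>

theorem proposition3p2:
  fixes \<gamma> :: "complex ^ 'n \<Rightarrow> complex ^ 'n"
  assumes dim: "CARD('n) \<ge> 2"
    and contr: "contraction \<gamma>"
  shows
    "(non_diagonal \<gamma> \<longrightarrow>
        \<not> (\<exists>H. compact_torus \<gamma> H \<and> J_vf ` lie_algebra \<gamma> H \<inter> lie_algebra \<gamma> H \<noteq> {\<lambda>z. 0}))
     \<and>
     (\<forall>lam :: complex ^ 'n. (\<forall>j. lam $ j \<in> punctured_disc) \<and> \<gamma> = diag_map lam \<longrightarrow>
        Z_field lam \<in> hopf_vf \<gamma> \<and>
        {G. complex_one_dim_subgroup \<gamma> G \<and> (\<exists>H. compact_torus \<gamma> H \<and> G \<subseteq> H)}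
          = {generated_by_vf \<gamma> (Z_field lam)} \<and>
        (\<forall>s t. exp_vf \<gamma> (scale_vf (s + t) (Z_field lam))
           = exp_vf \<gamma> (scale_vf s (Z_field lam))
               \<otimes>\<^bsub>BijGroup (hopf \<gamma>)\<^esub> exp_vf \<gamma> (scale_vf t (Z_field lam))) \<and>
        (\<forall>\<mu> s z. \<mu> \<noteq> 0 \<and> exp s = \<mu> \<and> z \<noteq> 0 \<longrightarrow>
           exp_vf \<gamma> (scale_vf s (Z_field lam)) (hopf_class \<gamma> z)
             = hopf_class \<gamma> (\<chi> j. log_power s (ln (cmod (lam $ j))) * z $ j)) \<and>
        (\<forall>\<mu> z. \<mu> \<noteq> 0 \<and> z \<noteq> 0 \<longrightarrow>
           exp_vf \<gamma> (scale_vf (Ln \<mu>) (Z_field lam)) (hopf_class \<gamma> z)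
             = hopf_class \<gamma> (\<chi> j. \<mu> powr complex_of_real (ln (cmod (lam $ j))) * z $ j)))"
proof (intro conjI allI impI; (elim conjE)?)
  interpret hopf_contraction \<gamma> by unfold_locales (rule contr)
  assume nd: "non_diagonal \<gamma>"
  show "\<not> (\<exists>H. compact_torus \<gamma> H \<and> J_vf ` lie_algebra \<gamma> H \<inter> lie_algebra \<gamma> H \<noteq> {\<lambda>z. 0})"
  proof (intro notI, elim exE conjE)
    fix H assume H: "compact_torus \<gamma> H" "J_vf ` lie_algebra \<gamma> H \<inter> lie_algebra \<gamma> H \<noteq> {\<lambda>z. 0}"
    \<comment> \<open>the zero field belongs to the intersection, so a nonzero field does too\<close>
    have "(\<lambda>z. 0) \<in> lie_algebra \<gamma> H"
    proof -
      have "exp_vf \<gamma> (\<lambda>z. 0) = \<one>\<^bsub>BijGroup (hopf \<gamma>)\<^esub>"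
        unfolding BijGroup_def
      proof (simp, rule extensionalityI[OF exp_vf_extensional])
        fix p assume p: "p \<in> hopf \<gamma>"
        then obtain z where z: "z \<noteq> 0" "p = hopf_class \<gamma> z" by (rule hopf_cases)
        have "solves (\<lambda>z. 0) (- {0}) UNIV (\<lambda>t. z)" using z by (simp add: solves_def)
        from flow_unique_UNIV[OF zero_vf this, of 1] have "flow (\<lambda>z. 0) 1 z = z" by simp
        then show "exp_vf \<gamma> (\<lambda>z. 0) p = (\<lambda>x\<in>hopf \<gamma>. x) p"
          using p exp_vf_class[OF zero_vf z(1)] by (simp add: z(2))
      qed simp
      moreover have "\<one>\<^bsub>BijGroup (hopf \<gamma>)\<^esub> \<in> H"
        using H(1) by (auto simp: compact_torus_def intro: subgroup.one_closed)
      moreover have "scale_vf c (\<lambda>z :: complex ^ 'n. 0) = (\<lambda>z. 0)" for c by (simp add: scale_vf_def)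
      ultimately show ?thesis by (simp add: lie_algebra_def zero_vf)
    qed
    moreover from this have "(\<lambda>z. 0) \<in> J_vf ` lie_algebra \<gamma> H"
      by (intro image_eqI[of _ _ "\<lambda>z. 0"]) (simp_all add: J_vf_def scale_vf_def)
    ultimately obtain X where X: "X \<in> lie_algebra \<gamma> H" "J_vf X \<in> lie_algebra \<gamma> H" "J_vf X \<noteq> (\<lambda>z. 0)"
      using H(2) by blast
    have "X \<noteq> (\<lambda>z. 0)" using X(3) by (auto simp: J_vf_def scale_vf_def)
    moreover have "torus_line \<gamma> H X" using H(1) X by unfold_locales
    ultimately show False using torus_line.diagonalizable nd by blast
  qed
next
  fix lam :: "complex ^ 'n" assume "\<forall>j. lam $ j \<in> punctured_disc" "\<gamma> = diag_map lam"
  then interpret diagonal_contraction \<gamma> lam by unfold_locales (use contr in auto)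
  show "Z_field lam \<in> hopf_vf \<gamma>" by (simp add: Z_field_eq diag_vf_in)
  show "{G. complex_one_dim_subgroup \<gamma> G \<and> (\<exists>H. compact_torus \<gamma> H \<and> G \<subseteq> H)} = {generated_by_vf \<gamma> (Z_field lam)}"
    by (rule complex_lines)
  show "exp_vf \<gamma> (scale_vf (s + t) (Z_field lam))
      = exp_vf \<gamma> (scale_vf s (Z_field lam)) \<otimes>\<^bsub>BijGroup (hopf \<gamma>)\<^esub> exp_vf \<gamma> (scale_vf t (Z_field lam))" for s t
    by (simp add: exp_Z ind_mult vec.scale_left_distrib)
  show formula: "exp_vf \<gamma> (scale_vf s (Z_field lam)) (hopf_class \<gamma> z)
      = hopf_class \<gamma> (\<chi> j. log_power s (ln (cmod (lam $ j))) * z $ j)" if "z \<noteq> 0" for s z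
    using that by (simp add: exp_Z ind_class ediag_def log_power_def logs_def mult.commute)
  show "exp_vf \<gamma> (scale_vf (Ln \<mu>) (Z_field lam)) (hopf_class \<gamma> z)
      = hopf_class \<gamma> (\<chi> j. \<mu> powr complex_of_real (ln (cmod (lam $ j))) * z $ j)" if "\<mu> \<noteq> 0" "z \<noteq> 0" for \<mu> z
    using formula[OF that(2), of "Ln \<mu>"] that(1) by (simp add: log_power_def powr_def)
qed

end
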